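(* Let $a,b,C_1$ be real with $a\ne0$, $b\neq 0$, and let $\alpha=U^{(-1)}\!\left(250\frac{C_1^3}{a^2b}\right)$, that is, let $\alpha\in(0,1)$ satisfy $U(\alpha)=250\frac{C_1^3}{a^2b}$. Then $$X=\frac{b}{250a}\left(R\left(e^{-2\pi\sqrt{k^{(-1)}(\alpha)}}\right)^{-5}-11-R\left(e^{-2\pi\sqrt{k^{(-1)}(\alpha)}}\right)^{5}\right)$$ is a solution of the equation $$\frac{b^2}{20a}+bX+aX^2=C_1X^{5/3}.$$
   Context: The function $U$ is $$U(x)=\frac{256\left(x^2+(1-x^2)^2\right)^3}{x^4(1-x^2)^2}.$$ For $0<x<1$, $$k^{(-1)}(x):=\frac{K(\sqrt{1-x^2})^2}{K(x)^2},\qquad K(x)=\int_0^{\pi/2}\frac{dt}{\sqrt{1-x^2\sin^2t}}.$$ For $0<q<1$, $R(q)$ is the Rogers–Ramanujan continued fraction $$R(q):=\frac{q^{1/5}}{1+}\,\frac{q}{1+}\,\frac{q^2}{1+}\,\frac{q^3}{1+}\cdots .$$ The power $X^{5/3}$ of a real number is taken with the real cube root. *)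

theory Defs
  imports "HOL-Analysis.Analysis"
begin

definition U :: "real \<Rightarrow> real" where
  "U x = 256 * (x^2 + (1 - x^2)^2)^3 / (x^4 * (1 - x^2)^2)"

text \<open>Complete elliptic integral of the first kind, as a function of the modulus (not of the
  parameter \<open>m = x\<^sup>2\<close>).\<close>

definition ellK :: "real \<Rightarrow> real" where
  "ellK x = integral {0..pi/2} (\<lambda>t. 1 / sqrt (1 - x^2 * (sin t)^2))"

text \<open>The function written \<open>k\<^sup>(\<^sup>-\<^sup>1\<^sup>)\<close>; meaningful for \<open>0 < x < 1\<close>.\<close>

definition k_inv :: "real \<Rightarrow> real" where
  "k_inv x = (ellK (sqrt (1 - x^2)))^2 / (ellK x)^2"

text \<open>\<open>rr_denom q m n\<close> is \<open>1 + q^m / (1 + q^(m+1) / (1 + \<dots> + q^(m+n-1) / 1))\<close>, with \<open>n\<close> partial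
  quotients. The continued fraction is the limit of the convergents with first partial
  numerator \<open>q\<close>.\<close>

fun rr_denom :: "real \<Rightarrow> nat \<Rightarrow> nat \<Rightarrow> real" where
  "rr_denom q m 0 = 1"
| "rr_denom q m (Suc n) = 1 + q ^ m / rr_denom q (Suc m) n"

definition RR :: "real \<Rightarrow> real" where
  "RR q = lim (\<lambda>n. q powr (1/5) / rr_denom q 1 n)"

end

theory Submission
  imports Defs
begin

text \<open>
  Put \<open>Y = R\<^sup>-\<^sup>5 - 11 - R\<^sup>5\<close>. Since \<open>X = b Y / (250 a)\<close>, the left-hand side is a multiple of
  \<open>Y\<^sup>2 + 250 Y + 3125\<close>, and the cube of the equation is equivalent to
  \<open>U(\<alpha>) Y\<^sup>5 = (Y\<^sup>2 + 250 Y + 3125)\<^sup>3\<close>, the relation between the \<open>j\<close>-invariant and the Hauptmodul of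
  level five. If \<open>\<alpha> = \<theta>\<^sub>2\<^sup>2 / \<theta>\<^sub>3\<^sup>2\<close> at the nome \<open>p\<^sup>4\<close>, the arithmetic-geometric mean gives
  \<open>K' / K = - 4 ln p / \<pi>\<close>, so \<open>R\<close> is taken at \<open>p\<^sup>8\<close>; there the classical product formula of Ramanujan
  expresses \<open>Y\<close> by the Dedekind eta function as \<open>(\<eta>(\<tau>) / \<eta>(5 \<tau>))\<^sup>6\<close>. Finally, each of the three theta
  constants satisfies \<open>(x - y) (5 y - x) = \<plusminus> 16 E\<close>, where \<open>x, y\<close> are its squares at \<open>\<tau>\<close> and \<open>5 \<tau>\<close>
  and \<open>E = \<eta>(\<tau>)\<^sup>2 \<eta>(5 \<tau>)\<^sup>2\<close>. Together with Jacobi's identity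
  \<open>\<theta>\<^sub>3\<^sup>4 = \<theta>\<^sub>2\<^sup>4 + \<theta>\<^sub>4\<^sup>4\<close> this determines the symmetric functions of the ratios
  \<open>x / y\<close>, whose product is \<open>Y\<close>, and hence \<open>U(\<alpha>)\<close>.
\<close>

section \<open>The \<open>q\<close>-Pochhammer symbol and the Jacobi triple product\<close>

text \<open>With \<lambda> = x^2, \<open>U x\<close> is 256 (1 - \<lambda> + \<lambda>^2)^3 /
  (\<lambda>^2 (1 - \<lambda>)^2), the j-invariant in Legendre form. It equals j(\<tau>) = (Y^2 +
  250 Y + 3125)^3 / Y^5 rather than j(5\<tau>) = (Y^2 + 10 Y + 5)^3 / Y because R is taken at the
  square of the nome, that is at e^(2 pi i \<tau>). No theory of modular functions enters: the same
  E, up to sign, occurs in the three quadratic relations, so Jacobi's identity at \<tau> and at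
  5\<tau> eliminates it and leaves the algebra of three numbers. The quadratic relations and
  Ramanujan's formula need primitive fifth roots of unity, theta_4 an eighth root. Hence products
  and series are developed over an arbitrary complete normed field, the roots of unity entering only
  through polynomial equations; these are met in the complex numbers, and the real statements follow
  because all series and products of real arguments are real. The factorization of the lattice sums
  moreover requires a fifth root of p.\<close>

definition qpoch :: "'a::{real_normed_field,banach} \<Rightarrow> 'a \<Rightarrow> 'a" where
  "qpoch a q = lim (\<lambda>n. \<Prod>k<n. 1 - a * q^k)"

lemma convergent_prod_qpoch:
  fixes q :: "'a::{real_normed_field,banach}"
  assumes "norm q < 1"
  shows "convergent_prod (\<lambda>k. 1 - a * q^k)"
proof (rule abs_convergent_prod_imp_convergent_prod, rule summable_imp_abs_convergent_prod)
  show "summable (\<lambda>k. norm (1 - a * q^k - 1))"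
    using assms by (simp add: norm_mult norm_power summable_mult summable_geometric)
qed

lemma qpoch_tendsto:
  assumes "norm q < 1"
  shows "(\<lambda>n. \<Prod>k<n. 1 - a * q^k) \<longlonglongrightarrow> qpoch a q"
proof -
  have "(\<lambda>n. \<Prod>k\<le>n. 1 - a * q^k) \<longlonglongrightarrow> prodinf (\<lambda>k. 1 - a * q^k)"
    by (rule convergent_prod_LIMSEQ[OF convergent_prod_qpoch[OF assms]])
  then have "(\<lambda>n. \<Prod>k<n. 1 - a * q^k) \<longlonglongrightarrow> prodinf (\<lambda>k. 1 - a * q^k)"
    using filterlim_sequentially_Suc[of "\<lambda>n. \<Prod>k<n. 1 - a * q^k"] by (simp add: lessThan_Suc_atMost)
  then show ?thesis
    by (simp add: qpoch_def limI)
qed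

lemma qpoch_eqI:
  assumes "norm q < 1" "(\<lambda>n. \<Prod>k<n. 1 - a * q^k) \<longlonglongrightarrow> x"
  shows "qpoch a q = x"
  using LIMSEQ_unique[OF qpoch_tendsto assms(2)] assms(1) by blast

lemma qpoch_nonzero:
  assumes "norm q < 1" "\<And>k. a * q^k \<noteq> 1"
  shows "qpoch a q \<noteq> 0"
proof -
  have "(\<lambda>n. \<Prod>k\<le>n. 1 - a * q^k) \<longlonglongrightarrow> qpoch a q"
    using qpoch_tendsto[OF assms(1), of a, THEN LIMSEQ_Suc] by (simp add: lessThan_Suc_atMost)
  moreover have "(\<lambda>n. \<Prod>k\<le>n. 1 - a * q^k) \<longlonglongrightarrow> prodinf (\<lambda>k. 1 - a * q^k)"
    by (rule convergent_prod_LIMSEQ[OF convergent_prod_qpoch[OF assms(1)]])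
  ultimately have "qpoch a q = prodinf (\<lambda>k. 1 - a * q^k)"
    by (rule LIMSEQ_unique)
  moreover have "prodinf (\<lambda>k. 1 - a * q^k) \<noteq> 0"
    by (rule prodinf_nonzero[OF convergent_prod_qpoch[OF assms(1)]]) (use assms(2) in \<open>metis eq_iff_diff_eq_0\<close>)
  ultimately show ?thesis by simp
qed

lemma qpoch_nonzero':
  assumes "norm q < 1" "norm a < 1"
  shows "qpoch a q \<noteq> 0"
proof (rule qpoch_nonzero[OF assms(1)])
  fix k
  have "norm (a * q^k) \<le> norm a * 1"
    unfolding norm_mult norm_power using assms by (intro mult_left_mono power_le_one) auto
  with assms(2) show "a * q^k \<noteq> 1" by auto
qed

lemma qpoch_rec:
  assumes "norm q < 1"
  shows "qpoch a q = (1 - a) * qpoch (a * q) q"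
proof (rule qpoch_eqI[OF assms])
  have "(\<lambda>n. (1 - a) * (\<Prod>k<n. 1 - (a * q) * q^k)) \<longlonglongrightarrow> (1 - a) * qpoch (a * q) q"
    by (intro tendsto_intros qpoch_tendsto assms)
  moreover have "(\<Prod>k<Suc n. 1 - a * q^k) = (1 - a) * (\<Prod>k<n. 1 - (a * q) * q^k)" for n
    by (subst prod.lessThan_Suc_shift) (simp add: mult_ac)
  ultimately have "(\<lambda>n. \<Prod>k<Suc n. 1 - a * q^k) \<longlonglongrightarrow> (1 - a) * qpoch (a * q) q"
    by (simp only:)
  then show "(\<lambda>n. \<Prod>k<n. 1 - a * q^k) \<longlonglongrightarrow> (1 - a) * qpoch (a * q) q"
    using filterlim_sequentially_Suc by blast
qed

lemma norm_power_less_1: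
  fixes q :: "'a::real_normed_field"
  shows "norm q < 1 \<Longrightarrow> k > 0 \<Longrightarrow> norm (q^k) < 1"
  by (simp add: norm_power power_less_one_iff)

text \<open>The factors are sorted by exponent modulo \<open>m\<close>. The finite identity concerns
  \<open>n * m\<close> factors, so the limit on the left is taken along the multiples of
  \<open>m\<close>.\<close>

lemma qpoch_dissect:
  assumes "norm q < 1" "m > 0"
  shows "qpoch a q = (\<Prod>r<m. qpoch (a * q^r) (q^m))"
proof (rule LIMSEQ_unique)
  have qm: "norm (q^m) < 1"
    using assms by (simp add: norm_power power_less_one_iff)
  have "(\<lambda>n. \<Prod>r<m. \<Prod>k<n. 1 - (a * q^r) * (q^m)^k) \<longlonglongrightarrow> (\<Prod>r<m. qpoch (a * q^r) (q^m))"
    by (intro tendsto_prod qpoch_tendsto qm)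
  moreover have "(\<Prod>r<m. \<Prod>k<n. 1 - (a * q^r) * (q^m)^k) = (\<Prod>k<n*m. 1 - a * q^k)" for n
  proof -
    have "(\<Prod>k<n*m. 1 - a * q^k) = (\<Prod>k<n. prod (\<lambda>k. 1 - a * q^k) {k*m..<k*m+m})"
      by (simp add: prod.nat_group)
    also have "\<dots> = (\<Prod>k<n. \<Prod>r<m. 1 - (a * q^r) * (q^m)^k)"
    proof (rule prod.cong[OF refl])
      fix k
      show "prod (\<lambda>k. 1 - a * q^k) {k*m..<k*m+m} = (\<Prod>r<m. 1 - (a * q^r) * (q^m)^k)"
        using prod.shift_bounds_nat_ivl[of "\<lambda>k. 1 - a * q^k" 0 "k*m" m]
        by (simp add: power_add power_mult[symmetric] mult_ac add.commute atLeast0LessThan)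
    qed
    also have "\<dots> = (\<Prod>r<m. \<Prod>k<n. 1 - (a * q^r) * (q^m)^k)"
      by (rule prod.swap)
    finally show ?thesis by simp
  qed
  ultimately show "(\<lambda>n. \<Prod>k<n*m. 1 - a * q^k) \<longlonglongrightarrow> (\<Prod>r<m. qpoch (a * q^r) (q^m))"
    by simp
  have "filterlim (\<lambda>n. n * m) at_top sequentially"
    using assms(2) by (simp add: mult_nat_right_at_top)
  then show "(\<lambda>n. \<Prod>k<n*m. 1 - a * q^k) \<longlonglongrightarrow> qpoch a q"
    by (rule filterlim_compose[OF qpoch_tendsto[OF assms(1)]])
qed

text \<open>Having the factorization of 1 - x^m as a hypothesis lets one lemma serve both the sign
  -1 with \<open>m = 2\<close> and the primitive fifth roots of unity.\<close>

lemma qpoch_roots: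
  assumes "norm q < 1" "m > 0" and root: "\<And>x. (\<Prod>j<m. 1 - z^j * x) = 1 - x^m"
  shows "(\<Prod>j<m. qpoch (z^j * a) q) = qpoch (a^m) (q^m)"
proof (rule qpoch_eqI[symmetric])
  show "norm (q^m) < 1"
    using assms by (simp add: norm_power power_less_one_iff)
  have "(\<lambda>n. \<Prod>j<m. \<Prod>k<n. 1 - (z^j * a) * q^k) \<longlonglongrightarrow> (\<Prod>j<m. qpoch (z^j * a) q)"
    by (intro tendsto_prod qpoch_tendsto assms)
  moreover have "(\<Prod>j<m. \<Prod>k<n. 1 - (z^j * a) * q^k) = (\<Prod>k<n. 1 - a^m * (q^m)^k)" for n
  proof -
    have "(\<Prod>j<m. \<Prod>k<n. 1 - (z^j * a) * q^k) = (\<Prod>k<n. \<Prod>j<m. 1 - z^j * (a * q^k))"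
      by (subst prod.swap) (simp add: mult_ac)
    also have "\<dots> = (\<Prod>k<n. 1 - a^m * (q^m)^k)"
      by (simp add: root power_mult_distrib flip: power_mult) (simp add: mult_ac)
    finally show ?thesis .
  qed
  ultimately show "(\<lambda>n. \<Prod>k<n. 1 - a^m * (q^m)^k) \<longlonglongrightarrow> (\<Prod>j<m. qpoch (z^j * a) q)"
    by simp
qed

lemma qpoch_minus:
  assumes "norm q < 1"
  shows "qpoch a q * qpoch (- a) q = qpoch (a^2) (q^2)"
  using qpoch_roots[OF assms, of 2 "-1" a]
  by (simp add: numeral_2_eq_2 algebra_simps)

lemma qpoch_dissect2:
  assumes "norm q < 1"
  shows "qpoch a q = qpoch a (q^2) * qpoch (a * q) (q^2)"
  using qpoch_dissect[OF assms, of 2 a] by (simp add: numeral_2_eq_2)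

lemma qpoch_of_real:
  assumes "\<bar>q\<bar> < 1"
  shows "qpoch (of_real a) (of_real q) = (of_real (qpoch a q) :: 'a::{real_normed_field,banach})"
proof (rule qpoch_eqI)
  show "norm (of_real q :: 'a) < 1" using assms by simp
  have "(\<lambda>n. of_real (\<Prod>k<n. 1 - a * q^k) :: 'a) \<longlonglongrightarrow> of_real (qpoch a q)"
    using assms by (intro tendsto_of_real qpoch_tendsto) auto
  then show "(\<lambda>n. \<Prod>k<n. 1 - of_real a * of_real q^k :: 'a) \<longlonglongrightarrow> of_real (qpoch a q)"
    by simp
qed

text \<open>Ramanujan's general theta function is \<open>f(a, b) = (\<Sum>j. rterm a b j)\<close>, the sum being over all integers.\<close>

definition rterm :: "'a \<Rightarrow> 'a \<Rightarrow> int \<Rightarrow> 'a::{real_normed_field,banach}" where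
  "rterm a b j = a^nat (j * (j + 1) div 2) * b^nat (j * (j - 1) div 2)"

lemma rterm_0 [simp]: "rterm a b 0 = 1"
  by (simp add: rterm_def)

lemma rterm_minus: "rterm a b (- j) = rterm b a j"
proof -
  have "- j * (- j + 1) = j * (j - 1)" "- j * (- j - 1) = j * (j + 1)"
    by (simp_all add: algebra_simps)
  then show ?thesis
    unfolding rterm_def by (simp only: mult.commute)
qed

lemma rterm_Suc: "rterm a b (int (Suc n)) = rterm a b (int n) * (a * (a * b)^n)"
proof -
  have 1: "int (Suc n) * (int (Suc n) + 1) div 2 = int n * (int n + 1) div 2 + (int n + 1)"
  proof -
    have "int (Suc n) * (int (Suc n) + 1) = int n * (int n + 1) + 2 * (int n + 1)"
      by (simp add: algebra_simps)
    then show ?thesis by simp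
  qed
  have 2: "int (Suc n) * (int (Suc n) - 1) div 2 = int n * (int n - 1) div 2 + int n"
  proof -
    have "int (Suc n) * (int (Suc n) - 1) = int n * (int n - 1) + 2 * int n"
      by (simp add: algebra_simps)
    then show ?thesis by simp
  qed
  have 3: "int n * (int n + 1) div 2 \<ge> 0" "int n * (int n - 1) div 2 \<ge> 0"
    by (cases n; simp)+
  have 4: "nat (int n * (int n + 1) div 2 + (int n + 1)) = nat (int n * (int n + 1) div 2) + Suc n"
    "nat (int n * (int n - 1) div 2 + int n) = nat (int n * (int n - 1) div 2) + n"
    using 3 by linarith+
  show ?thesis
    unfolding rterm_def 1 2 4 by (simp add: power_add power_mult_distrib mult_ac)
qed

lemma summable_rterm_nat:
  assumes "norm (a * b) < 1"
  shows "summable (\<lambda>n. norm (rterm a b (int n)))"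
proof -
  have "(\<lambda>n. norm (a * (a * b)^n)) \<longlonglongrightarrow> 0"
    unfolding norm_mult[of a] norm_power using assms
    by (intro tendsto_mult_right_zero LIMSEQ_power_zero) (auto simp: norm_mult)
  then have "eventually (\<lambda>n. norm (a * (a * b)^n) < 1/2) sequentially"
    by (rule order_tendstoD) simp
  then obtain N where N: "\<And>n. n \<ge> N \<Longrightarrow> norm (a * (a * b)^n) < 1/2"
    unfolding eventually_sequentially by blast
  show ?thesis
  proof (rule summable_ratio_test)
    show "(1/2::real) < 1" by simp
    show "norm (norm (rterm a b (int (Suc n)))) \<le> 1/2 * norm (norm (rterm a b (int n)))" if "n \<ge> N" for n
      unfolding rterm_Suc norm_mult[of "rterm a b (int n)"]
      using mult_left_mono[OF less_imp_le[OF N[OF that]], of "norm (rterm a b (int n))"] by simp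
  qed
qed

lemma summable_on_int_split:
  fixes f :: "int \<Rightarrow> 'a::banach"
  assumes "(\<lambda>n. f (int n)) summable_on UNIV" "(\<lambda>n. f (- int n)) summable_on UNIV"
  shows "f summable_on UNIV"
proof -
  have 1: "f summable_on range int"
    using assms(1) by (subst summable_on_reindex) (auto simp: o_def)
  have "f summable_on range (\<lambda>n. - int n)"
    using assms(2) by (subst summable_on_reindex) (auto simp: o_def inj_def)
  then have 2: "f summable_on range (\<lambda>n. - int n) - range int"
    by (rule summable_on_subset_banach) auto
  have "f summable_on (range int \<union> (range (\<lambda>n. - int n) - range int))"
    by (rule summable_on_Un_disjoint[OF 1 2]) auto
  also have "range int \<union> (range (\<lambda>n. - int n) - range int) = UNIV"
  proof -
    have "x \<in> range int \<union> range (\<lambda>n. - int n)" for x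
      by (cases x rule: int_cases2) auto
    then show ?thesis by auto
  qed
  finally show ?thesis .
qed

lemma rterm_abs_summable:
  assumes "norm (a * b) < 1"
  shows "(\<lambda>j. norm (rterm a b j)) summable_on UNIV"
proof (rule summable_on_int_split)
  show "(\<lambda>n. norm (rterm a b (int n))) summable_on UNIV"
    using summable_rterm_nat[OF assms] by (intro norm_summable_imp_summable_on) auto
  show "(\<lambda>n. norm (rterm a b (- int n))) summable_on UNIV"
    unfolding rterm_minus using summable_rterm_nat[of b a] assms
    by (intro norm_summable_imp_summable_on) (auto simp: mult.commute)
qed

lemma rterm_summable:
  assumes "norm (a * b) < 1"
  shows "rterm a b summable_on UNIV"
  using rterm_abs_summable[OF assms] by (rule abs_summable_summable)

text \<open>Dominated convergence for bilateral series, reduced to Tannery's theorem by enumerating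
  the integers with \<open>int_decode\<close>. The arbitrary filter serves both the limit in the
  triple product and the continuity of \<open>theta\<close> at a point.\<close>

lemma tannery_int:
  fixes f :: "int \<Rightarrow> 'b \<Rightarrow> 'a::{real_normed_algebra,banach}"
  assumes lim: "\<And>j. ((\<lambda>n. f j n) \<longlongrightarrow> g j) F"
    and bound: "eventually (\<lambda>n. \<forall>j. norm (f j n) \<le> M j) F"
    and M: "M summable_on UNIV"
  shows "((\<lambda>n. \<Sum>\<^sub>\<infinity>j. f j n) \<longlongrightarrow> (\<Sum>\<^sub>\<infinity>j. g j)) F"
proof (cases "F = bot")
  case False
  define d where "d = int_decode"
  have bij: "bij_betw d UNIV UNIV"
    unfolding d_def by (rule bij_int_decode)
  have Mn: "(\<lambda>k. M (d k)) summable_on UNIV"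
    using summable_on_reindex_bij_betw[OF bij, of M] M by simp
  have "summable (\<lambda>k. M (d k))"
    by (rule summable_on_imp_summable) (use Mn in auto)
  have tan: "eventually (\<lambda>n. summable (\<lambda>k. norm (f (d k) n))) F \<and>
      summable (\<lambda>k. norm (g (d k))) \<and> ((\<lambda>n. suminf (\<lambda>k. f (d k) n)) \<longlongrightarrow> suminf (\<lambda>k. g (d k))) F"
  proof (rule tannerys_theorem[where M = "\<lambda>k. M (d k)"])
    show "eventually (\<lambda>(k,n). norm (f (d k) n) \<le> M (d k)) (at_top \<times>\<^sub>F F)"
      using eventually_prod2[of sequentially "\<lambda>n. \<forall>k. norm (f (d k) n) \<le> M (d k)" F]
        eventually_mono[OF bound, of "\<lambda>n. \<forall>k. norm (f (d k) n) \<le> M (d k)"]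
      by (auto elim!: eventually_mono simp: case_prod_beta)
  qed (use lim False \<open>summable (\<lambda>k. M (d k))\<close> in auto)
  have infsum_eq: "(\<Sum>\<^sub>\<infinity>j. h j) = suminf (\<lambda>k. h (d k))" if "summable (\<lambda>k. norm (h (d k)))" for h :: "int \<Rightarrow> 'a"
  proof -
    have "(\<Sum>\<^sub>\<infinity>j. h j) = (\<Sum>\<^sub>\<infinity>k. h (d k))"
      using infsum_reindex_bij_betw[OF bij, of h] by simp
    also have "\<dots> = suminf (\<lambda>k. h (d k))"
      using norm_summable_imp_has_sum[OF that summable_sums[OF summable_norm_cancel[OF that]]]
      by (rule infsumI)
    finally show ?thesis .
  qed
  have "((\<lambda>n. suminf (\<lambda>k. f (d k) n)) \<longlongrightarrow> (\<Sum>\<^sub>\<infinity>j. g j)) F"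
    using tan infsum_eq[of g] by simp
  moreover have "eventually (\<lambda>n. suminf (\<lambda>k. f (d k) n) = (\<Sum>\<^sub>\<infinity>j. f j n)) F"
    using tan infsum_eq by (auto elim!: eventually_mono)
  ultimately show ?thesis
    by (rule Lim_transform_eventually)
qed auto

lemma rterm_succ:
  assumes "a \<noteq> 0" "b \<noteq> 0"
  shows "rterm a b (j + 1) = rterm a b j * a * (a * b) powi j"
proof (cases "j \<ge> 0")
  case True
  then obtain n where n: "j = int n" using nonneg_int_cases by blast
  show ?thesis using rterm_Suc[of a b n] by (simp add: n add.commute mult_ac)
next
  case False
  then obtain n where n: "j = - int (Suc n)" by (metis int_cases not_less of_nat_0_le_iff)
  have "rterm a b (j + 1) = rterm b a (int n)"
    using rterm_minus[of a b "int n"] by (simp add: n)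
  moreover have "rterm a b j = rterm b a (int n) * (b * (b * a)^n)"
    unfolding n rterm_minus rterm_Suc ..
  moreover have "(a * b) powi j = inverse ((a * b)^Suc n)"
    unfolding n power_int_minus power_int_of_nat ..
  ultimately show ?thesis using assms by (simp add: field_simps)
qed

text \<open>The convention \<open>1 / (q; q)\<^sub>m = 0\<close> for \<open>m < 0\<close> makes the recurrence below hold for all integers \<open>m\<close>.\<close>

definition inv_qfact :: "'a \<Rightarrow> int \<Rightarrow> 'a::{real_normed_field,banach}" where
  "inv_qfact q m = (if m < 0 then 0 else inverse (\<Prod>k<nat m. 1 - q * q^k))"

lemma one_minus_power_nonzero:
  fixes q :: "'a::{real_normed_field,banach}"
  assumes "norm q < 1"
  shows "1 - q * q^k \<noteq> 0"
proof
  assume "1 - q * q^k = 0"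
  then have "norm (q^Suc k) = 1" by (metis eq_iff_diff_eq_0 norm_one power_Suc)
  moreover have "norm q^Suc k < 1" using assms by (simp add: power_less_one_iff del: power_Suc)
  ultimately show False by (metis norm_power order_less_irrefl)
qed

lemma inv_qfact_rec:
  assumes "norm q < 1"
  shows "inv_qfact q (m - 1) = inv_qfact q m * (1 - q powi m)"
proof -
  consider "m < 0" | "m = 0" | "m > 0" by linarith
  then show ?thesis
  proof cases
    case 3
    then obtain k where k: "m = int (Suc k)" by (metis gr0_implies_Suc pos_int_cases)
    then have "inv_qfact q m = inverse ((\<Prod>k<k. 1 - q * q^k) * (1 - q * q^k))"
      by (simp add: inv_qfact_def nat_add_distrib)
    moreover have "q powi m = q * q^k"
      unfolding k power_int_of_nat by simp
    moreover have "inv_qfact q (m - 1) = inverse (\<Prod>k<k. 1 - q * q^k)"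
      by (simp add: inv_qfact_def k)
    ultimately show ?thesis
      using one_minus_power_nonzero[OF assms, of k] by (simp add: inverse_mult_distrib)
  qed (auto simp: inv_qfact_def)
qed

text \<open>This is the finite triple product, the q-binomial theorem in symmetric form:
  \<open>inv_qfact\<close> vanishes at negative arguments, so only indices between -n and n
  contribute. Unlike the infinite identity it can be proved by induction, comparing the coefficients
  of the theta terms.\<close>

lemma jacobi_triple_finite:
  assumes ab: "a \<noteq> 0" "b \<noteq> 0" and q: "q = a * b" "norm q < 1"
  shows "((\<lambda>j. inv_qfact q (int n - j) * inv_qfact q (int n + j) * rterm a b j) has_sum
           (inv_qfact q (2 * int n) * (\<Prod>k<n. (1 + a * q^k) * (1 + b * q^k)))) UNIV"
proof (induction n)
  case 0
  have "((\<lambda>j. inv_qfact q (int 0 - j) * inv_qfact q (int 0 + j) * rterm a b j) has_sum 1) {0}"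
    by (rule has_sum_finiteI) (auto simp: inv_qfact_def)
  then have "((\<lambda>j. inv_qfact q (int 0 - j) * inv_qfact q (int 0 + j) * rterm a b j) has_sum 1) UNIV"
    by (rule iffD1[OF has_sum_cong_neutral, rotated -1]) (auto simp: inv_qfact_def)
  then show ?case by (simp add: inv_qfact_def)
next
  case (Suc n)
  define c where "c = (\<lambda>j. inv_qfact q (int n - j) * inv_qfact q (int n + j))"
  define S where "S = inv_qfact q (2 * int n) * (\<Prod>k<n. (1 + a * q^k) * (1 + b * q^k))"
  have q0: "q \<noteq> 0" using ab q by simp
  have IH: "((\<lambda>j. c j * rterm a b j) has_sum S) UNIV"
    using Suc by (simp add: c_def S_def)
  have up: "a * rterm a b j = q powi (- j) * rterm a b (j + 1)" for j
    using rterm_succ[OF ab, of j] q0 by (simp add: q(1) power_int_minus field_simps)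
  have down: "b * rterm a b j = q powi j * rterm a b (j - 1)" for j
    using rterm_succ[OF ab, of "j - 1"] q0 by (simp add: q(1) power_int_diff field_simps)
  \<comment> \<open>Multiplication by \<open>a * q^n\<close> or \<open>b * q^n\<close> moves the
    term of index \<open>j\<close> to index \<open>j + 1\<close> or \<open>j - 1\<close>; reindexing
    collects everything at the same \<open>rterm a b j\<close>.\<close>
  have "((\<lambda>j. a * q^n * (c j * rterm a b j)) has_sum a * q^n * S) UNIV"
    by (rule has_sum_cmult_right[OF IH])
  also have "(\<lambda>j. a * q^n * (c j * rterm a b j)) = (\<lambda>j. q powi (int n - j) * c j * rterm a b (j + 1))"
    using up q0 by (simp add: fun_eq_iff power_int_diff power_int_minus field_simps)
  also have "\<dots> = (\<lambda>j. q powi (int n - j + 1) * c (j - 1) * rterm a b j) \<circ> (\<lambda>j. j + 1)"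
    by (simp add: fun_eq_iff algebra_simps)
  finally have A: "((\<lambda>j. q powi (int n - j + 1) * c (j - 1) * rterm a b j) has_sum a * q^n * S) UNIV"
    by (subst (asm) has_sum_reindex[symmetric]) (auto simp: surj_def intro!: exI[of _ "_ - 1"])
  have "((\<lambda>j. b * q^n * (c j * rterm a b j)) has_sum b * q^n * S) UNIV"
    by (rule has_sum_cmult_right[OF IH])
  also have "(\<lambda>j. b * q^n * (c j * rterm a b j)) = (\<lambda>j. q powi (int n + j) * c j * rterm a b (j - 1))"
    using down q0 by (simp add: fun_eq_iff power_int_add field_simps)
  also have "\<dots> = (\<lambda>j. q powi (int n + j + 1) * c (j + 1) * rterm a b j) \<circ> (\<lambda>j. j - 1)"
    by (simp add: fun_eq_iff algebra_simps)
  finally have B: "((\<lambda>j. q powi (int n + j + 1) * c (j + 1) * rterm a b j) has_sum b * q^n * S) UNIV"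
    by (subst (asm) has_sum_reindex[symmetric]) (auto simp: surj_def inj_def intro!: exI[of _ "_ + 1"])
  define D where "D = (1 - q^(2*n+1)) * (1 - q^(2*n+2))"
  have D0: "D \<noteq> 0"
    using one_minus_power_nonzero[OF q(2), of "2*n"] one_minus_power_nonzero[OF q(2), of "2*n+1"] by (simp add: D_def)
  \<comment> \<open>The weight \<open>1 + q^(2*n+1)\<close> appears because (1 + a q^n) (1 + b q^n)
    = 1 + a q^n + b q^n + q^(2n+1) for q = a b.\<close>
  have sum: "((\<lambda>j. (1 + q^(2*n+1)) * (c j * rterm a b j) + q powi (int n - j + 1) * c (j - 1) * rterm a b j
      + q powi (int n + j + 1) * c (j + 1) * rterm a b j) has_sum
      ((1 + q^(2*n+1)) * S + a * q^n * S + b * q^n * S)) UNIV"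
    by (intro has_sum_add A B has_sum_cmult_right[OF IH])
  have "(\<lambda>j. (1 + q^(2*n+1)) * (c j * rterm a b j) + q powi (int n - j + 1) * c (j - 1) * rterm a b j
      + q powi (int n + j + 1) * c (j + 1) * rterm a b j) =
      (\<lambda>j. D * (inv_qfact q (int (Suc n) - j) * inv_qfact q (int (Suc n) + j) * rterm a b j))"
  proof
    fix j
    define r s where "r = inv_qfact q (int n + 1 - j)" and "s = inv_qfact q (int n + 1 + j)"
    define u v where "u = q powi (int n - j)" and "v = q powi (int n + j)"
    have uv: "u * v = q^(2 * n)"
    proof -
      have "u * v = q powi (int (2*n))"
        unfolding u_def v_def using q0 by (simp add: power_int_add[symmetric])
      then show ?thesis by (simp only: power_int_of_nat)
    qed
    have uq: "q powi (int n - j + 1) = u * q" "q powi (int n + j + 1) = v * q"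
      unfolding u_def v_def using q0 by (simp_all add: power_int_add power_int_diff)
    have r1: "inv_qfact q (int n - j) = r * (1 - u * q)"
      unfolding r_def using inv_qfact_rec[OF q(2), of "int n + 1 - j"] uq(1) by (simp add: algebra_simps)
    have r2: "inv_qfact q (int n - j - 1) = r * (1 - u * q) * (1 - u)"
      using inv_qfact_rec[OF q(2), of "int n - j"] r1 by (simp add: u_def)
    have s1: "inv_qfact q (int n + j) = s * (1 - v * q)"
      unfolding s_def using inv_qfact_rec[OF q(2), of "int n + 1 + j"] uq(2) by (simp add: algebra_simps)
    have s2: "inv_qfact q (int n + j - 1) = s * (1 - v * q) * (1 - v)"
      using inv_qfact_rec[OF q(2), of "int n + j"] s1 by (simp add: v_def)
    have c: "c j = r * s * (1 - u * q) * (1 - v * q)" "c (j - 1) = r * s * (1 - v * q) * (1 - v)"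
      "c (j + 1) = r * s * (1 - u * q) * (1 - u)"
    proof -
      show "c j = r * s * (1 - u * q) * (1 - v * q)"
        by (simp add: c_def r1 s1)
      have "int n - (j - 1) = int n + 1 - j" "int n + (j - 1) = int n + j - 1" by auto
      then show "c (j - 1) = r * s * (1 - v * q) * (1 - v)"
        by (simp only: c_def r_def[symmetric] s2) (simp add: mult_ac)
      have "int n - (j + 1) = int n - j - 1" "int n + (j + 1) = int n + 1 + j" by auto
      then show "c (j + 1) = r * s * (1 - u * q) * (1 - u)"
        by (simp only: c_def s_def[symmetric] r2) (simp add: mult_ac)
    qed
    have "(1 + u * v * q) * (1 - u * q) * (1 - v * q) + u * q * ((1 - v * q) * (1 - v)) + v * q * ((1 - u * q) * (1 - u))
        = (1 - u * v * q) * (1 - u * v * q * q)"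
      by (simp add: algebra_simps)
    then have "r * s * rterm a b j * ((1 + u * v * q) * (1 - u * q) * (1 - v * q) + u * q * ((1 - v * q) * (1 - v)) + v * q * ((1 - u * q) * (1 - u)))
        = r * s * rterm a b j * ((1 - u * v * q) * (1 - u * v * q * q))" by simp
    moreover have "q^(2*n+1) = u * v * q" "q^(2*n+2) = u * v * q * q"
      by (simp_all add: uv mult_ac)
    ultimately show "(1 + q^(2*n+1)) * (c j * rterm a b j) + q powi (int n - j + 1) * c (j - 1) * rterm a b j
      + q powi (int n + j + 1) * c (j + 1) * rterm a b j =
      D * (inv_qfact q (int (Suc n) - j) * inv_qfact q (int (Suc n) + j) * rterm a b j)"
      unfolding D_def uq c by (simp only: r_def s_def) (simp add: algebra_simps)
  qed
  with sum have "((\<lambda>j. D * (inv_qfact q (int (Suc n) - j) * inv_qfact q (int (Suc n) + j) * rterm a b j)) has_sum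
      ((1 + q^(2*n+1)) * S + a * q^n * S + b * q^n * S)) UNIV" by (simp only:)
  then have "((\<lambda>j. inverse D * (D * (inv_qfact q (int (Suc n) - j) * inv_qfact q (int (Suc n) + j) * rterm a b j))) has_sum
      inverse D * ((1 + q^(2*n+1)) * S + a * q^n * S + b * q^n * S)) UNIV"
    by (rule has_sum_cmult_right)
  moreover have "inverse D * (D * x) = x" for x
    using D0 by simp
  moreover have "(1 + q^(2*n+1)) * S + a * q^n * S + b * q^n * S = S * ((1 + a * q^n) * (1 + b * q^n))"
  proof -
    have "q^(2*n+1) = a * q^n * (b * q^n)"
      by (simp add: q(1) power_mult_distrib mult_2 power_add)
    then show ?thesis by (simp only:) (simp add: algebra_simps)
  qed
  moreover have "inv_qfact q (2 * int (Suc n)) = inverse D * inv_qfact q (2 * int n)"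
  proof -
    have "nat (2 * int n) = 2 * n" "nat (2 * int (Suc n)) = Suc (Suc (2 * n))" by auto
    then show ?thesis
      unfolding inv_qfact_def D_def by (simp add: mult_ac)
  qed
  ultimately have "((\<lambda>j. inv_qfact q (int (Suc n) - j) * inv_qfact q (int (Suc n) + j) * rterm a b j) has_sum
      inverse D * (S * ((1 + a * q^n) * (1 + b * q^n)))) UNIV"
    by (simp only:)
  moreover have "inverse D * (S * ((1 + a * q^n) * (1 + b * q^n))) =
      inv_qfact q (2 * int (Suc n)) * (\<Prod>k<Suc n. (1 + a * q^k) * (1 + b * q^k))"
    unfolding \<open>inv_qfact q (2 * int (Suc n)) = inverse D * inv_qfact q (2 * int n)\<close> S_def
    by (simp add: mult_ac)
  ultimately show ?case
    by (simp only:)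
qed

text \<open>Let \<open>n\<close> tend to infinity in the finite form. All factors
  \<open>inv_qfact\<close> tend to 1/P with P = (q; q), two of them on the left and one on the
  right, so a single P survives. Their uniform bound \<open>K\<close> supplies the dominating
  series.\<close>

theorem jacobi_triple:
  assumes ab: "a \<noteq> 0" "b \<noteq> 0" "norm (a * b) < 1"
  shows "(rterm a b has_sum (qpoch (- a) (a * b) * qpoch (- b) (a * b) * qpoch (a * b) (a * b))) UNIV"
proof -
  define q where "q = a * b"
  have q: "norm q < 1" using ab by (simp add: q_def)
  define P where "P = qpoch q q"
  have P0: "P \<noteq> 0" unfolding P_def by (rule qpoch_nonzero'[OF q q])
  have lim: "(\<lambda>n. inv_qfact q (int n)) \<longlonglongrightarrow> inverse P"
    unfolding inv_qfact_def P_def using qpoch_tendsto[OF q, of q] P0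
    by (simp add: P_def tendsto_inverse)
  then have "Bseq (\<lambda>n. inv_qfact q (int n))" using convergentI convergent_imp_Bseq by blast
  then obtain K where K: "K > 0" "\<And>n. norm (inv_qfact q (int n)) \<le> K" by (auto elim: BseqE)
  have bnd: "norm (inv_qfact q m) \<le> K" for m
    using K by (cases m) (auto simp: inv_qfact_def)
  have limj: "(\<lambda>n. inv_qfact q (int n + j)) \<longlonglongrightarrow> inverse P" for j
  proof -
    have "filterlim (\<lambda>n. nat (int n + j)) at_top sequentially"
      unfolding filterlim_at_top eventually_sequentially
      by (metis add.commute diff_le_eq nat_le_iff nat_mono of_nat_mono nat_int le_diff_eq)
    then have "(\<lambda>n. inv_qfact q (int (nat (int n + j)))) \<longlonglongrightarrow> inverse P"
      by (rule filterlim_compose[OF lim])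
    moreover have "eventually (\<lambda>n. inv_qfact q (int (nat (int n + j))) = inv_qfact q (int n + j)) sequentially"
      using eventually_ge_at_top[of "nat (- j)"] by eventually_elim auto
    ultimately show ?thesis by (rule Lim_transform_eventually)
  qed
  have "(\<lambda>n. \<Sum>\<^sub>\<infinity>j. inv_qfact q (int n - j) * inv_qfact q (int n + j) * rterm a b j)
      \<longlonglongrightarrow> (\<Sum>\<^sub>\<infinity>j. inverse P * inverse P * rterm a b j)"
  proof (rule tannery_int[where M = "\<lambda>j. K * K * norm (rterm a b j)"])
    show "(\<lambda>n. inv_qfact q (int n - j) * inv_qfact q (int n + j) * rterm a b j) \<longlonglongrightarrow> inverse P * inverse P * rterm a b j" for j
      using limj[of "- j"] limj[of j] by (auto intro!: tendsto_mult)
    show "\<forall>\<^sub>F n in sequentially. \<forall>j. norm (inv_qfact q (int n - j) * inv_qfact q (int n + j) * rterm a b j)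
        \<le> K * K * norm (rterm a b j)"
      using bnd K(1) by (auto intro!: always_eventually mult_right_mono mult_mono simp: norm_mult)
    show "(\<lambda>j. K * K * norm (rterm a b j)) summable_on UNIV"
      by (intro summable_on_cmult_right rterm_abs_summable ab)
  qed
  moreover have "(\<Sum>\<^sub>\<infinity>j. inv_qfact q (int n - j) * inv_qfact q (int n + j) * rterm a b j) =
      inv_qfact q (2 * int n) * (\<Prod>k<n. (1 + a * q^k) * (1 + b * q^k))" for n
    using jacobi_triple_finite[OF ab(1,2) q_def q] by (rule infsumI)
  moreover have "(\<lambda>n. inv_qfact q (2 * int n) * (\<Prod>k<n. (1 + a * q^k) * (1 + b * q^k)))
      \<longlonglongrightarrow> inverse P * (qpoch (- a) q * qpoch (- b) q)"
  proof (intro tendsto_mult)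
    have "filterlim (\<lambda>n. 2 * n) at_top sequentially"
      by (simp add: mult_nat_left_at_top)
    then have "(\<lambda>n. inv_qfact q (int (2 * n))) \<longlonglongrightarrow> inverse P"
      by (rule filterlim_compose[OF lim])
    then show "(\<lambda>n. inv_qfact q (2 * int n)) \<longlonglongrightarrow> inverse P" by simp
    show "(\<lambda>n. \<Prod>k<n. (1 + a * q^k) * (1 + b * q^k)) \<longlonglongrightarrow> qpoch (- a) q * qpoch (- b) q"
      using tendsto_mult[OF qpoch_tendsto[OF q, of "-a"] qpoch_tendsto[OF q, of "-b"]]
      by (simp add: prod.distrib)
  qed
  ultimately have "(\<Sum>\<^sub>\<infinity>j. inverse P * inverse P * rterm a b j) = inverse P * (qpoch (- a) q * qpoch (- b) q)"
    by (simp add: LIMSEQ_unique)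
  moreover have "(\<Sum>\<^sub>\<infinity>j. inverse P * inverse P * rterm a b j) = inverse P * inverse P * (\<Sum>\<^sub>\<infinity>j. rterm a b j)"
    by (rule infsum_cmult_right')
  ultimately have "(\<Sum>\<^sub>\<infinity>j. rterm a b j) = qpoch (- a) q * qpoch (- b) q * P"
    using P0 by (simp add: field_simps)
  then show ?thesis
    using rterm_summable[OF ab(3)] unfolding P_def q_def by (metis has_sum_infsum)
qed

section \<open>Double series, and theta series over residue classes as products\<close>

lemma has_sum_prod_Times:
  fixes f :: "'b \<Rightarrow> 'a::{real_normed_field,banach}" and g :: "'c \<Rightarrow> 'a"
  assumes f: "(\<lambda>x. norm (f x)) summable_on A" and g: "(\<lambda>y. norm (g y)) summable_on B"
  shows "((\<lambda>(x,y). f x * g y) has_sum infsum f A * infsum g B) (A \<times> B)"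
proof -
  have ab: "(\<lambda>w. norm (case w of (x,y) \<Rightarrow> f x * g y)) summable_on A \<times> B"
    by (rule Infinite_Sum.abs_summable_on_Sigma_iff[THEN iffD2])
       (use f g in \<open>auto simp: norm_mult infsum_cmult_right' abs_mult
        intro!: summable_on_cmult_right summable_on_cmult_left\<close>)
  have s: "(\<lambda>(x,y). f x * g y) summable_on A \<times> B"
    using ab by (rule abs_summable_summable)
  have "infsum (\<lambda>(x,y). f x * g y) (A \<times> B) = infsum (\<lambda>x. infsum (\<lambda>y. f x * g y) B) A"
    using infsum_Sigma'_banach[OF s] by simp
  also have "\<dots> = infsum f A * infsum g B"
    by (simp add: infsum_cmult_right' infsum_cmult_left')
  finally show ?thesis using s by (metis has_sum_infsum)
qed

lemma two_tri:
  fixes n :: int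
  shows "2 * (n * (n + 1) div 2) = n * (n + 1)" "2 * (n * (n - 1) div 2) = n * (n - 1)"
  by (simp_all add: dvd_div_mult_self)

lemma tri_nonneg:
  fixes n :: int
  shows "n * (n + 1) div 2 \<ge> 0" "n * (n - 1) div 2 \<ge> 0"
proof -
  have "n * (n + 1) \<ge> 0" "n * (n - 1) \<ge> 0"
    by (cases "n \<ge> 0"; cases "n \<ge> 1"; simp add: mult_nonneg_nonneg mult_nonpos_nonpos)+
  then show "n * (n + 1) div 2 \<ge> 0" "n * (n - 1) div 2 \<ge> 0" by auto
qed

lemma rterm_eq:
  assumes "z \<noteq> 0"
  shows "rterm (x^c * z) (x^d / z) n =
    z powi n * x^nat (int c * (n * (n + 1) div 2) + int d * (n * (n - 1) div 2))"
proof -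
  define s t where "s = n * (n + 1) div 2" and "t = n * (n - 1) div 2"
  have st: "s \<ge> 0" "t \<ge> 0" "s - t = n"
    using tri_nonneg[of n] two_tri[of n] unfolding s_def t_def by (auto simp: algebra_simps)
  have "rterm (x^c * z) (x^d / z) n = x^(c * nat s + d * nat t) * (z^nat s / z^nat t)"
    unfolding rterm_def s_def t_def
    by (simp add: power_mult_distrib power_divide power_add power_mult)
  also have "z^nat s / z^nat t = z powi n"
    using power_int_diff[of z s t] assms st by (simp add: power_int_def)
  also have "c * nat s + d * nat t = nat (int c * s + int d * t)"
    using st by (simp add: nat_add_distrib nat_mult_distrib)
  finally show ?thesis by (simp add: s_def t_def mult.commute)
qed

text \<open>The parameters come from completing the square: m^2 + 2 m r and m^2 - 2 m r are the
  weights for which the two triangular exponents add up to (m n + r)^2 - r^2. The bound on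
  \<open>r\<close> keeps both nonnegative.\<close>

lemma square_rterm:
  fixes m r n :: int
  assumes z: "z \<noteq> 0" and m: "2 * \<bar>r\<bar> \<le> m"
  shows "z powi n * x^nat ((m * n + r)^2) =
    x^nat (r^2) * rterm (x^nat (m^2 + 2 * m * r) * z) (x^nat (m^2 - 2 * m * r) / z) n"
proof -
  have "m * (m + 2 * r) \<ge> 0" "m * (m - 2 * r) \<ge> 0"
    using m by (intro mult_nonneg_nonneg; linarith)+
  then have 1: "m^2 + 2 * m * r \<ge> 0" "m^2 - 2 * m * r \<ge> 0"
    by (simp_all add: algebra_simps power2_eq_square)
  define s t where "s = n * (n + 1) div 2" and "t = n * (n - 1) div 2"
  have s: "2 * s = n * (n + 1)" and t: "2 * t = n * (n - 1)"
    unfolding s_def t_def by (rule two_tri)+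
  have "2 * ((m^2 + 2 * m * r) * s + (m^2 - 2 * m * r) * t) = (m^2 + 2 * m * r) * (2 * s) + (m^2 - 2 * m * r) * (2 * t)"
    by (simp add: algebra_simps)
  also have "\<dots> = 2 * ((m * n + r)^2 - r^2)"
    unfolding s t by (simp add: algebra_simps power2_eq_square)
  finally have e: "(m^2 + 2 * m * r) * s + (m^2 - 2 * m * r) * t = (m * n + r)^2 - r^2"
    by simp
  have nn: "(m * n + r)^2 - r^2 \<ge> 0"
    unfolding e[symmetric] using 1 tri_nonneg[of n] by (simp add: s_def t_def)
  have "rterm (x^nat (m^2 + 2 * m * r) * z) (x^nat (m^2 - 2 * m * r) / z) n = z powi n * x^nat ((m * n + r)^2 - r^2)"
    unfolding rterm_eq[OF z] using 1 by (simp add: s_def[symmetric] t_def[symmetric] e)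
  moreover have "nat ((m * n + r)^2) = nat (r^2) + nat ((m * n + r)^2 - r^2)"
    using nn by (simp add: nat_diff_distrib nat_mono)
  ultimately show ?thesis
    by (simp add: power_add mult_ac)
qed

lemma gauss_sum_product:
  fixes x z :: "'a::{real_normed_field,banach}" and m r :: int
  assumes z: "z \<noteq> 0" and x: "x \<noteq> 0" "norm x < 1" and m: "2 * \<bar>r\<bar> \<le> m" "m > 0"
  defines "a \<equiv> x^nat (m^2 + 2 * m * r) * z" and "b \<equiv> x^nat (m^2 - 2 * m * r) / z"
    and "q \<equiv> x^nat (2 * m^2)"
  shows "((\<lambda>n. z powi n * x^nat ((m * n + r)^2)) has_sum
     x^nat (r^2) * (qpoch (- a) q * qpoch (- b) q * qpoch q q)) UNIV"
proof -
  have "m * (m + 2 * r) \<ge> 0" "m * (m - 2 * r) \<ge> 0"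
    using m by (intro mult_nonneg_nonneg; linarith)+
  then have 1: "m^2 + 2 * m * r \<ge> 0" "m^2 - 2 * m * r \<ge> 0"
    by (simp_all add: algebra_simps power2_eq_square)
  have "a * b = x^(nat (m^2 + 2 * m * r) + nat (m^2 - 2 * m * r))"
    using z by (simp add: a_def b_def power_add)
  also have "nat (m^2 + 2 * m * r) + nat (m^2 - 2 * m * r) = nat (2 * m^2)"
    using 1 by (simp flip: nat_add_distrib)
  finally have ab: "a * b = q" by (simp add: q_def)
  have q: "norm (a * b) < 1"
    unfolding ab using x m by (simp add: q_def norm_power power_less_one_iff)
  have "a \<noteq> 0" "b \<noteq> 0" using x z by (auto simp: a_def b_def)
  note J = jacobi_triple[OF this q, unfolded ab]
  have eq: "(\<lambda>n. z powi n * x^nat ((m * n + r)^2)) = (\<lambda>n. x^nat (r^2) * rterm a b n)"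
    unfolding a_def b_def using square_rterm[OF z m(1)] by blast
  show "((\<lambda>n. z powi n * x^nat ((m * n + r)^2)) has_sum
     x^nat (r^2) * (qpoch (- a) q * qpoch (- b) q * qpoch q q)) UNIV"
    unfolding eq by (rule has_sum_cmult_right[OF J])
qed

lemma square_summable:
  fixes x :: "'a::{real_normed_field,banach}"
  assumes "norm x < 1"
  shows "(\<lambda>n::int. norm (x^nat (n^2))) summable_on A"
proof -
  have eq: "x^nat (n^2) = rterm x x n" for n :: int
    using square_rterm[of 1 0 1 n x] by simp
  have "norm (x * x) < 1 * 1"
    unfolding norm_mult using assms by (intro mult_strict_mono') auto
  then have "(\<lambda>n::int. norm (x^nat (n^2))) summable_on UNIV"
    unfolding eq by (intro rterm_abs_summable) simp
  then show ?thesis by (rule summable_on_subset_banach) auto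
qed

text \<open>\<open>r\<close> may be any representative of the class \<open>s\<close>. Negative ones,
  such as -4 for the class 6 modulo 10, are used later to keep
  \<open>2 * \<bar>r\<bar> \<le> m\<close>.\<close>

lemma residue_has_sum_iff:
  fixes m r s :: int
  assumes "m > 0" "s = r mod m"
  shows "(f has_sum S) {x. x mod m = s} \<longleftrightarrow> ((\<lambda>n. f (m * n + r)) has_sum S) UNIV"
proof (rule has_sum_reindex_bij_witness[of _ "\<lambda>n. m * n + r" "\<lambda>x. (x - r) div m"])
  fix x assume "x \<in> {x. x mod m = s}"
  then have "m dvd x - r" using assms by (simp add: mod_eq_dvd_iff)
  then show "m * ((x - r) div m) + r = x" "f (m * ((x - r) div m) + r) = f x" by simp_all
qed (use assms in auto)

section \<open>Theta functions of level five\<close>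

text \<open>The nome is \<open>q = p\<^sup>4\<close>, so that \<open>\<theta>\<^sub>3(q) = theta 0 p\<close> and \<open>\<theta>\<^sub>2(q) = theta 1 p\<close> are series in integral powers of \<open>p\<close>.\<close>

definition theta :: "int \<Rightarrow> 'a \<Rightarrow> 'a::{real_normed_field,banach}" where
  "theta d p = (\<Sum>\<^sub>\<infinity>x\<in>{x. x mod 2 = d}. p^nat (x^2))"

definition qterm :: "'a \<Rightarrow> int \<times> int \<Rightarrow> 'a::{real_normed_field,banach}" where
  "qterm p = (\<lambda>(x, y). p^nat (x^2 + y^2))"

lemma qterm_prod: "qterm p (x, y) = p^nat (x^2) * p^nat (y^2)"
  by (simp add: qterm_def nat_add_distrib power_add)

lemma qterm_scale:
  assumes "x'\<^sup>2 + y'\<^sup>2 = int k * (x^2 + y^2)"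
  shows "qterm p (x', y') = qterm (p^k) (x, y)"
  unfolding qterm_def using assms by (simp add: nat_mult_distrib power_mult)

lemma qterm_has_sum_Times:
  assumes "norm p < 1"
  shows "(qterm p has_sum infsum (\<lambda>x. p^nat (x^2)) A * infsum (\<lambda>y. p^nat (y^2)) B) (A \<times> B)"
  using has_sum_prod_Times[OF square_summable square_summable, OF assms assms, of A B]
  by (simp add: qterm_prod[symmetric])

lemma qterm_summable:
  assumes "norm p < 1"
  shows "qterm p summable_on A"
  using has_sum_imp_summable[OF qterm_has_sum_Times[OF assms, of UNIV UNIV]]
  by (rule summable_on_subset_banach) auto

abbreviation parity :: "int \<Rightarrow> int set" where "parity d \<equiv> {x. x mod 2 = d}"

lemma theta_square:
  assumes "norm p < 1"
  shows "theta d p^2 = infsum (qterm p) (parity d \<times> parity d)"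
  using infsumI[OF qterm_has_sum_Times[OF assms, of "parity d" "parity d"]]
  by (simp add: theta_def power2_eq_square)

text \<open>Multiplication by 1 + i, that is (x, y) to (x - y, x + y), doubles the norm x^2 + y^2
  and maps the pairs of equal parity onto the pairs of even numbers.\<close>

lemma theta_dissect2:
  assumes p: "norm p < 1"
  shows "theta 0 p^2 = theta 0 (p^2)^2 + theta 1 (p^2)^2"
proof -
  have p2: "norm (p^2) < 1" using p by (simp add: norm_power power_less_one_iff)
  have "(qterm p has_sum s) (parity 0 \<times> parity 0) \<longleftrightarrow>
      (qterm (p^2) has_sum s) (parity 0 \<times> parity 0 \<union> parity 1 \<times> parity 1)" for s
  proof (rule has_sum_reindex_bij_witness[of _ "\<lambda>(x,y). (x - y, x + y)" "\<lambda>(x,y). ((x + y) div 2, (y - x) div 2)"])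
    show "qterm (p^2) (case a of (x, y) \<Rightarrow> ((x + y) div 2, (y - x) div 2)) = qterm p a" if "a \<in> parity 0 \<times> parity 0" for a
    proof -
      obtain x y where a: "a = (x, y)" by (cases a)
      obtain x' y' where xy: "x = 2 * x'" "y = 2 * y'"
        using \<open>a \<in> _\<close> unfolding a by (auto elim!: evenE)
      have d: "(x + y) div 2 = x' + y'" "(y - x) div 2 = y' - x'" unfolding xy by presburger+
      show ?thesis unfolding a prod.case d
        by (rule qterm_scale[symmetric]) (simp add: xy power2_eq_square algebra_simps)
    qed
  qed (auto; presburger)+
  then have "infsum (qterm p) (parity 0 \<times> parity 0) = infsum (qterm (p^2)) (parity 0 \<times> parity 0 \<union> parity 1 \<times> parity 1)"
    using qterm_summable[OF p2] by (metis has_sum_infsum infsumI)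
  also have "\<dots> = infsum (qterm (p^2)) (parity 0 \<times> parity 0) + infsum (qterm (p^2)) (parity 1 \<times> parity 1)"
    by (rule infsum_Un_disjoint) (use qterm_summable[OF p2] in auto)
  finally show ?thesis by (simp add: theta_square p p2)
qed

text \<open>In the Gaussian integers \<open>5 = (2 + \<i>)(2 - \<i>)\<close>; the condition \<open>x + 2 y \<equiv> 0 (mod 5)\<close> says that \<open>2 - \<i>\<close> divides \<open>x + \<i> y\<close>, and multiplication by \<open>\<i>\<close> permutes the four other classes cyclically.\<close>

definition lattice5 :: "int \<Rightarrow> int \<Rightarrow> (int \<times> int) set" where
  "lattice5 d c = {(x, y). x mod 2 = d \<and> y mod 2 = d \<and> (x + 2 * y) mod 5 = c}"

text \<open>The rotation (x, y) to (-y, x) turns x + 2 y into 2 (x + 2 y) - 5 y and so doubles the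
  class; the second congruence expresses the way back, 3 being the inverse of 2 modulo 5.\<close>

lemma lattice5_rotate:
  assumes "d \<in> {0, 1}" "c' = (2 * c) mod 5" "c = (3 * c') mod 5"
  shows "infsum (qterm p) (lattice5 d c) = infsum (qterm p) (lattice5 d c')"
proof -
  have "infsum (qterm p) (lattice5 d c) = infsum (qterm p) ((\<lambda>(x,y). (-y, x)) ` lattice5 d c)"
    by (subst infsum_reindex) (auto simp: inj_on_def o_def case_prod_unfold qterm_def add.commute intro!: infsum_cong)
  also have "(\<lambda>(x,y). (-y, x)) ` lattice5 d c = lattice5 d c'"
  proof -
    have "(x, y) \<in> (\<lambda>(x,y). (-y, x)) ` lattice5 d c \<longleftrightarrow> (y, -x) \<in> lattice5 d c" for x y
      by (force simp: image_iff)
    moreover have "(y, -x) \<in> lattice5 d c \<longleftrightarrow> (x, y) \<in> lattice5 d c'" for x y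
    proof -
      have "(-x) mod 2 = x mod 2" by presburger
      moreover have "(y + 2 * - x) mod 5 = c \<longleftrightarrow> (x + 2 * y) mod 5 = c'"
      proof -
        have "(x + 2 * y) mod 5 = (2 * ((y + 2 * - x) mod 5)) mod 5" "(y + 2 * - x) mod 5 = (3 * ((x + 2 * y) mod 5)) mod 5"
        proof -
          have "x + 2 * y = 2 * (y + 2 * - x) + 5 * x" "y + 2 * - x = 3 * (x + 2 * y) + 5 * (- x - y)" by simp_all
          then show "(x + 2 * y) mod 5 = (2 * ((y + 2 * - x) mod 5)) mod 5" "(y + 2 * - x) mod 5 = (3 * ((x + 2 * y) mod 5)) mod 5"
            by (metis mod_mult_right_eq mod_mult_self2)+
        qed
        then show ?thesis using assms(2,3) by metis
      qed
      ultimately show ?thesis by (auto simp: lattice5_def)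
    qed
    ultimately show ?thesis unfolding set_eq_iff split_paired_All by blast
  qed
  finally show ?thesis .
qed

text \<open>The points of this class are multiples of 2 - i, and (x, y) to (2 x + y, 2 y - x) is
  multiplication by it. The norm grows by the factor 5, which changes \<open>p\<close> into
  \<open>p^5\<close>, and a pair with both coordinates of parity \<open>d\<close> keeps that
  property.\<close>

lemma lattice5_0:
  assumes p: "norm (p::'a::{real_normed_field,banach}) < 1" and d: "d \<in> {0,1}"
  shows "infsum (qterm p) (lattice5 d 0) = theta d (p^5)^2"
proof -
  have p5: "norm (p^5) < 1" using p by (simp add: norm_power power_less_one_iff)
  have "(qterm p has_sum s) (lattice5 d 0) \<longleftrightarrow> (qterm (p^5) has_sum s) (parity d \<times> parity d)" for s
  proof (rule has_sum_reindex_bij_witness[of _ "\<lambda>(x,y). (2 * x + y, 2 * y - x)" "\<lambda>(x,y). ((2 * x - y) div 5, (x + 2 * y) div 5)"])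
    fix a assume "a \<in> lattice5 d 0"
    then obtain x y where a: "a = (x, y)" "x mod 2 = d" "y mod 2 = d" "(x + 2 * y) mod 5 = 0"
      by (auto simp: lattice5_def)
    define u where "u = (x + 2 * y) div 5"
    have x: "x = 5 * u - 2 * y" using a(4) by (simp add: u_def minus_mod_eq_mult_div [symmetric])
    have j: "(case a of (x, y) \<Rightarrow> ((2 * x - y) div 5, (x + 2 * y) div 5)) = (2 * u - y, u)"
    proof -
      have "2 * x - y = 5 * (2 * u - y)" unfolding x by simp
      then show ?thesis by (simp add: a(1) u_def)
    qed
    show "qterm (p^5) (case a of (x, y) \<Rightarrow> ((2 * x - y) div 5, (x + 2 * y) div 5)) = qterm p a"
      unfolding j unfolding a(1) by (rule qterm_scale[symmetric]) (simp add: x power2_eq_square algebra_simps)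
    show "(case a of (x, y) \<Rightarrow> ((2 * x - y) div 5, (x + 2 * y) div 5)) \<in> parity d \<times> parity d"
    proof -
      have "(2 * u - y) mod 2 = d" using a(3) by presburger
      moreover have "u mod 2 = d" using a(2) x by presburger
      ultimately show ?thesis unfolding j by simp
    qed
    show "(case case a of (x, y) \<Rightarrow> ((2 * x - y) div 5, (x + 2 * y) div 5) of (x, y) \<Rightarrow> (2 * x + y, 2 * y - x)) = a"
      unfolding j by (simp add: a(1) x)
  next
    fix b assume "b \<in> parity d \<times> parity d"
    then obtain x y where b: "b = (x, y)" "x mod 2 = d" "y mod 2 = d" by auto
    have "(2 * x + y + 2 * (2 * y - x)) mod 5 = 0" by presburger
    moreover have "(2 * x + y) mod 2 = d" using b(3) by presburger
    moreover have "(2 * y - x) mod 2 = d" using b(2) by presburger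
    ultimately show "(case b of (x, y) \<Rightarrow> (2 * x + y, 2 * y - x)) \<in> lattice5 d 0"
      by (simp add: b(1) lattice5_def)
    show "(case case b of (x, y) \<Rightarrow> (2 * x + y, 2 * y - x) of (x, y) \<Rightarrow> ((2 * x - y) div 5, (x + 2 * y) div 5)) = b"
      unfolding b by (simp add: algebra_simps)
  qed (rule refl)
  then have "infsum (qterm p) (lattice5 d 0) = infsum (qterm (p^5)) (parity d \<times> parity d)"
    using qterm_summable[OF p5] by (metis has_sum_infsum infsumI)
  then show ?thesis by (simp add: theta_square p5)
qed

text \<open>The class 0 gives the theta square at p^5, and the four other classes contribute equally
  by rotation. In the twisted sum the character z^(x + 2 y) is constant on each class, and z + z^2 +
  z^3 + z^4 = -1.\<close>

lemma theta_square_lattice5: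
  assumes p: "norm p < 1" and d: "d \<in> {0,1}"
  shows "theta d p^2 = theta d (p^5)^2 + 4 * infsum (qterm p) (lattice5 d 1)"
    and "z^5 = 1 \<Longrightarrow> 1 + z + z^2 + z^3 + z^4 = 0 \<Longrightarrow>
      infsum (\<lambda>x. z powi x * p^nat (x^2)) (parity d) * infsum (\<lambda>y. (z^2) powi y * p^nat (y^2)) (parity d)
      = theta d (p^5)^2 - infsum (qterm p) (lattice5 d 1)"
proof -
  define N where "N = infsum (qterm p) (lattice5 d 1)"
  have N: "infsum (qterm p) (lattice5 d 2) = N" "infsum (qterm p) (lattice5 d 4) = N" "infsum (qterm p) (lattice5 d 3) = N"
  proof -
    have 1: "infsum (qterm p) (lattice5 d 1) = infsum (qterm p) (lattice5 d 2)" by (rule lattice5_rotate[OF d]) auto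
    have 2: "infsum (qterm p) (lattice5 d 2) = infsum (qterm p) (lattice5 d 4)" by (rule lattice5_rotate[OF d]) auto
    have 3: "infsum (qterm p) (lattice5 d 4) = infsum (qterm p) (lattice5 d 3)" by (rule lattice5_rotate[OF d]) auto
    show "infsum (qterm p) (lattice5 d 2) = N" "infsum (qterm p) (lattice5 d 4) = N" "infsum (qterm p) (lattice5 d 3) = N"
      unfolding N_def 1 2 3 by (rule refl)+
  qed
  have UN: "(\<Union>c\<in>{0,1,2,3,4}. lattice5 d c) = parity d \<times> parity d"
  proof -
    have c5: "c mod 5 \<in> {0,1,2,3,4}" for c :: int
      using pos_mod_bound[of 5 c] pos_mod_sign[of 5 c] by simp linarith
    have "(x, y) \<in> (\<Union>c\<in>C. lattice5 d c) \<longleftrightarrow> (x + 2 * y) mod 5 \<in> C \<and> (x, y) \<in> parity d \<times> parity d" for x y C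
      by (auto simp: lattice5_def)
    then show ?thesis using c5 by (metis (no_types, lifting) pred_equals_eq2 subrelI subset_antisym)
  qed
  have disj: "lattice5 d c \<inter> lattice5 d c' = {}" if "c \<noteq> c'" for c c'
    using that by (auto simp: lattice5_def)
  have "theta d p^2 = (\<Sum>c\<in>{0,1,2,3,4}. infsum (qterm p) (lattice5 d c))"
    unfolding theta_square[OF p] UN[symmetric]
    by (rule sum_infsum[symmetric]) (use qterm_summable[OF p] disj in auto)
  then show "theta d p^2 = theta d (p^5)^2 + 4 * infsum (qterm p) (lattice5 d 1)"
    using lattice5_0[OF p d] by (simp add: N N_def[symmetric])
  assume z5: "z^5 = 1" and z: "1 + z + z^2 + z^3 + z^4 = 0"
  have z0: "z \<noteq> 0" using z5 by auto
  have nz: "norm z = 1" using power_eq_1_iff[OF z5] by simp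
  have zm: "z powi n = z^nat (n mod 5)" for n
  proof -
    have "z powi n = z powi (5 * (n div 5) + n mod 5)" by simp
    also have "\<dots> = (z powi 5) powi (n div 5) * z powi (n mod 5)"
      unfolding power_int_mult[symmetric] using z0 by (intro power_int_add) simp
    also have "z powi 5 = 1" using z5 by (simp add: power_int_def)
    finally show ?thesis by (simp add: power_int_def)
  qed
  define W where "W = (\<lambda>(x, y). z powi (x + 2 * y) * qterm p (x, y))"
  have prod: "(W has_sum infsum (\<lambda>x. z powi x * p^nat (x^2)) A * infsum (\<lambda>y. (z^2) powi y * p^nat (y^2)) B) (A \<times> B)" for A B
  proof -
    have "((\<lambda>(x,y). z powi x * p^nat (x^2) * ((z^2) powi y * p^nat (y^2))) has_sum
      infsum (\<lambda>x. z powi x * p^nat (x^2)) A * infsum (\<lambda>y. (z^2) powi y * p^nat (y^2)) B) (A \<times> B)"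
      by (rule has_sum_prod_Times) (use square_summable[OF p] in \<open>simp_all add: norm_mult norm_power_int norm_power nz\<close>)
    also have "(\<lambda>(x,y). z powi x * p^nat (x^2) * ((z^2) powi y * p^nat (y^2))) = W"
      using z0 by (auto simp: W_def fun_eq_iff qterm_prod power_int_add power_int_mult)
    finally show ?thesis .
  qed
  have Wsum: "W summable_on A" for A
    by (rule summable_on_subset_banach[OF has_sum_imp_summable[OF prod[of UNIV UNIV]]]) auto
  have Wc: "infsum W (lattice5 d c) = z^nat c * infsum (qterm p) (lattice5 d c)" for c
  proof -
    have "infsum W (lattice5 d c) = infsum (\<lambda>w. z^nat c * qterm p w) (lattice5 d c)"
      by (rule infsum_cong) (auto simp: W_def zm lattice5_def)
    then show ?thesis by (simp add: infsum_cmult_right')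
  qed
  have "infsum (\<lambda>x. z powi x * p^nat (x^2)) (parity d) * infsum (\<lambda>y. (z^2) powi y * p^nat (y^2)) (parity d)
      = infsum W (parity d \<times> parity d)"
    using prod by (rule infsumI[symmetric])
  also have "\<dots> = (\<Sum>c\<in>{0,1,2,3,4}. infsum W (lattice5 d c))"
    unfolding UN[symmetric]
    by (rule sum_infsum[symmetric]) (use Wsum disj in auto)
  also have "\<dots> = theta d (p^5)^2 + (z + z^2 + z^3 + z^4) * N"
    using lattice5_0[OF p d] by (simp add: Wc N N_def[symmetric] algebra_simps)
  also have "z + z^2 + z^3 + z^4 = - 1"
    using z by (simp add: eq_neg_iff_add_eq_0 add_ac)
  finally show "infsum (\<lambda>x. z powi x * p^nat (x^2)) (parity d) * infsum (\<lambda>y. (z^2) powi y * p^nat (y^2)) (parity d)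
      = theta d (p^5)^2 - infsum (qterm p) (lattice5 d 1)"
    by (simp add: N_def)
qed

text \<open>Multiplication by 2 + i sends (x, y) to (2 x - y, x + 2 y) and turns the condition on x
  + 2 y into separate conditions on the two coordinates. So the double sum factors; since the norm
  is multiplied by 5, the factors are series in the fifth root \<open>P\<close>.\<close>

lemma lattice5_1:
  assumes P: "norm P < 1" and d: "d \<in> {0,1}"
  shows "infsum (qterm (P^5)) (lattice5 d 1) =
    infsum (\<lambda>x. P^nat (x^2)) {x. x mod 2 = d \<and> x mod 5 = 2} * infsum (\<lambda>x. P^nat (x^2)) {x. x mod 2 = d \<and> x mod 5 = 1}"
proof -
  have "infsum (qterm (P^5)) (lattice5 d 1) =
      infsum (qterm P) ({x. x mod 2 = d \<and> x mod 5 = 2} \<times> {x. x mod 2 = d \<and> x mod 5 = 1})"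
  proof (rule infsum_reindex_bij_witness[of _ "\<lambda>(a,b). ((2 * a + b) div 5, (2 * b - a) div 5)" "\<lambda>(x,y). (2 * x - y, x + 2 * y)"])
    fix a assume "a \<in> lattice5 d 1"
    then obtain x y where a: "a = (x, y)" "x mod 2 = d" "y mod 2 = d" "(x + 2 * y) mod 5 = 1"
      by (auto simp: lattice5_def)
    show "(case case a of (x, y) \<Rightarrow> (2 * x - y, x + 2 * y) of (a, b) \<Rightarrow> ((2 * a + b) div 5, (2 * b - a) div 5)) = a"
      by (simp add: a(1) algebra_simps)
    have "(2 * x - y) mod 2 = d" using a(3) by presburger
    moreover have "(x + 2 * y) mod 2 = d" using a(2) by presburger
    moreover have "(2 * x - y) mod 5 = 2" using a(4) by presburger
    ultimately show "(case a of (x, y) \<Rightarrow> (2 * x - y, x + 2 * y)) \<in> {x. x mod 2 = d \<and> x mod 5 = 2} \<times> {x. x mod 2 = d \<and> x mod 5 = 1}"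
      using a by simp
    show "qterm P (case a of (x, y) \<Rightarrow> (2 * x - y, x + 2 * y)) = qterm (P^5) a"
      unfolding a(1) prod.case by (rule qterm_scale) (simp add: power2_eq_square algebra_simps)
  next
    fix b assume "b \<in> {x. x mod 2 = d \<and> x mod 5 = 2} \<times> {x. x mod 2 = d \<and> x mod 5 = 1}"
    then obtain s t where b: "b = (s, t)" "s mod 2 = d" "s mod 5 = 2" "t mod 2 = d" "t mod 5 = 1" by auto
    define u where "u = (2 * s + t) div 5"
    have "(2 * s + t) mod 5 = 0" using b(3,5) by presburger
    then have t: "t = 5 * u - 2 * s" by (simp add: u_def minus_mod_eq_mult_div [symmetric])
    have j: "(case b of (a, b) \<Rightarrow> ((2 * a + b) div 5, (2 * b - a) div 5)) = (u, 2 * u - s)"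
    proof -
      have "2 * t - s = 5 * (2 * u - s)" unfolding t by simp
      then show ?thesis by (simp add: b(1) u_def)
    qed
    show "(case case b of (a, b) \<Rightarrow> ((2 * a + b) div 5, (2 * b - a) div 5) of (x, y) \<Rightarrow> (2 * x - y, x + 2 * y)) = b"
      unfolding j by (simp add: b(1) t)
    have "u mod 2 = d" using b(4) t by presburger
    moreover have "(2 * u - s) mod 2 = d" using b(2) by presburger
    moreover have "(u + 2 * (2 * u - s)) mod 5 = 1" using b(3) by presburger
    ultimately show "(case b of (a, b) \<Rightarrow> ((2 * a + b) div 5, (2 * b - a) div 5)) \<in> lattice5 d 1"
      unfolding j lattice5_def by simp
  qed
  also have "\<dots> = infsum (\<lambda>x. P^nat (x^2)) {x. x mod 2 = d \<and> x mod 5 = 2} * infsum (\<lambda>x. P^nat (x^2)) {x. x mod 2 = d \<and> x mod 5 = 1}"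
    by (rule infsumI[OF qterm_has_sum_Times[OF P]])
  finally show ?thesis .
qed

text \<open>Here \<open>z\<close> is raised to the summation variable k = m n + r itself, so the
  product formula is applied to \<open>z powi m\<close> and the factor \<open>z powi r\<close> comes
  out.\<close>

lemma residue_sum_product:
  fixes x z :: "'a::{real_normed_field,banach}" and m r s :: int
  assumes z: "z \<noteq> 0" and x: "x \<noteq> 0" "norm x < 1" and m: "2 * \<bar>r\<bar> \<le> m" "m > 0" and s: "s = r mod m"
  defines "q \<equiv> x^nat (2 * m^2)"
  shows "infsum (\<lambda>k. z powi k * x^nat (k^2)) {k. k mod m = s} =
     z powi r * (x^nat (r^2) * (qpoch (- (x^nat (m^2 + 2 * m * r) * z powi m)) q *
       qpoch (- (x^nat (m^2 - 2 * m * r) / z powi m)) q * qpoch q q))" (is "_ = z powi r * ?R")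
proof -
  have "z powi m \<noteq> 0" using z by simp
  then have "((\<lambda>n. (z powi m) powi n * x^nat ((m * n + r)^2)) has_sum
     x^nat (r^2) * (qpoch (- (x^nat (m^2 + 2 * m * r) * z powi m)) q *
       qpoch (- (x^nat (m^2 - 2 * m * r) / z powi m)) q * qpoch q q)) UNIV"
    unfolding q_def by (rule gauss_sum_product[OF _ x m])
  then have "((\<lambda>n. z powi r * ((z powi m) powi n * x^nat ((m * n + r)^2))) has_sum z powi r * ?R) UNIV"
    by (rule has_sum_cmult_right)
  also have "(\<lambda>n. z powi r * ((z powi m) powi n * x^nat ((m * n + r)^2))) =
      (\<lambda>n. z powi (m * n + r) * x^nat ((m * n + r)^2))"
  proof
    fix n
    have "z powi (m * n + r) = (z powi m) powi n * z powi r"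
      using z by (simp add: power_int_add power_int_mult[of z m])
    then show "z powi r * ((z powi m) powi n * x^nat ((m * n + r)^2)) = z powi (m * n + r) * x^nat ((m * n + r)^2)"
      by simp
  qed
  finally have "((\<lambda>k. z powi k * x^nat (k^2)) has_sum z powi r * ?R) {k. k mod m = s}"
    by (subst residue_has_sum_iff[OF m(2) s])
  then show ?thesis by (simp add: infsumI mult_ac)
qed

section \<open>The quadratic relation between the theta squares at p and p^5\<close>

lemma theta_0_product:
  assumes "p \<noteq> 0" "norm p < 1"
  shows "theta 0 p = qpoch (p^8) (p^8) * (qpoch (- (p^4)) (p^8))\<^sup>2"
  using residue_sum_product[of 1 p 0 2 0] assms by (simp add: theta_def power2_eq_square mult_ac)

lemma theta_1_product:
  assumes "p \<noteq> 0" "norm p < 1"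
  shows "theta 1 p = 2 * p * qpoch (p^8) (p^8) * (qpoch (- (p^8)) (p^8))\<^sup>2"
proof -
  have "norm (p^8) < 1" using assms by (simp add: norm_power power_less_one_iff)
  then show ?thesis
    using residue_sum_product[of 1 p 1 2 1] assms qpoch_rec[of "p^8" "-1"]
    by (simp add: theta_def power2_eq_square mult_ac)
qed

text \<open>Pairing z with z^4 and z^2 with z^3 leaves two quadratic factors, whose coefficients z +
  z^4 and z^2 + z^3 have sum and product -1.\<close>

lemma fifth_root_prod:
  fixes z :: "'a::comm_ring_1"
  assumes "z^5 = 1" "1 + z + z^2 + z^3 + z^4 = 0"
  shows "(\<Prod>j<5. 1 - z^j * x) = 1 - x^5"
proof -
  define s t where "s = z + z^4" and "t = z^2 + z^3"
  have st: "s + t = - 1" using assms(2) unfolding s_def t_def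
    by (simp add: eq_neg_iff_add_eq_0 algebra_simps)
  have "s * t = z^3 + z^4 + z^5 * z + z^5 * z^2"
    unfolding s_def t_def by (simp add: algebra_simps eval_nat_numeral)
  also have "\<dots> = s + t" using assms(1) by (simp add: s_def t_def)
  finally have st': "s * t = - 1" using st by simp
  have "(1 - z * x) * (1 - z^4 * x) = 1 - s * x + z^5 * x^2"
    unfolding s_def by (simp add: algebra_simps eval_nat_numeral)
  moreover have "(1 - z^2 * x) * (1 - z^3 * x) = 1 - t * x + z^5 * x^2"
    unfolding t_def by (simp add: algebra_simps eval_nat_numeral)
  moreover have "(\<Prod>j<5. 1 - z^j * x) = (1 - x) * (((1 - z * x) * (1 - z^4 * x)) * ((1 - z^2 * x) * (1 - z^3 * x)))"
    by (simp add: eval_nat_numeral mult_ac)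
  ultimately have "(\<Prod>j<5. 1 - z^j * x) = (1 - x) * ((1 - s * x + x^2) * (1 - t * x + x^2))"
    using assms(1) by simp
  also have "(1 - s * x + x^2) * (1 - t * x + x^2) = 1 - (s + t) * (x + x^3) + (2 + s * t) * x^2 + x^4"
    by (simp add: algebra_simps eval_nat_numeral)
  finally show ?thesis unfolding st st' by (simp add: algebra_simps eval_nat_numeral)
qed

lemma prod_lessThan_5: "(\<Prod>j<5. f j) = f 0 * f 1 * f 2 * f 3 * (f (4::nat) :: 'a::comm_monoid_mult)"
  by (simp add: eval_nat_numeral mult_ac)

text \<open>The two triple products involve the exponents 20, 60, 140, 180 modulo 200: the
  dissection by five of \<open>qpoch (- (P^20)) (P^40)\<close> without its class 100. The missing
  factor is \<open>qpoch (- (p^20)) (p^40)\<close>, put on the left to avoid a quotient.\<close>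

lemma lattice5_product_even:
  assumes P: "P \<noteq> 0" "norm P < 1" and p: "p = P^5"
  shows "infsum (qterm p) (lattice5 0 1) * qpoch (- (p^20)) (p^40) = p^4 * (qpoch (p^40) (p^40))^2 * qpoch (- (p^4)) (p^8)"
proof -
  have sets: "{x::int. x mod 2 = 0 \<and> x mod 5 = 2} = {x. x mod 10 = 2}" "{x::int. x mod 2 = 0 \<and> x mod 5 = 1} = {x. x mod 10 = 6}"
    by (auto; presburger)+
  have "norm (P^40) < 1" using P by (simp add: norm_power power_less_one_iff)
  note D = qpoch_dissect[OF this, of 5 "- (P^20)"]
  have "infsum (qterm p) (lattice5 0 1) = infsum (\<lambda>x. P^nat (x^2)) {x. x mod 10 = 2} * infsum (\<lambda>x. P^nat (x^2)) {x. x mod 10 = 6}"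
    unfolding p using lattice5_1[OF P(2), of 0] by (simp add: sets)
  also have "\<dots> = (P^4 * (qpoch (- (P^140)) (P^200) * qpoch (- (P^60)) (P^200) * qpoch (P^200) (P^200)))
      * (P^16 * (qpoch (- (P^20)) (P^200) * qpoch (- (P^180)) (P^200) * qpoch (P^200) (P^200)))"
    using residue_sum_product[of 1 P 2 10 2] residue_sum_product[of 1 P "-4" 10 6] P by simp
  finally show ?thesis using D
    by (simp add: p power_mult[symmetric] power_add[symmetric] prod_lessThan_5 power2_eq_square mult_ac)
qed

lemma lattice5_product_odd:
  assumes P: "P \<noteq> 0" "norm P < 1" and p: "p = P^5"
  shows "infsum (qterm p) (lattice5 1 1) * qpoch (- (p^40)) (p^40) = p^2 * (qpoch (p^40) (p^40))^2 * qpoch (- (p^8)) (p^8)"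
proof -
  have sets: "{x::int. x mod 2 = 1 \<and> x mod 5 = 2} = {x. x mod 10 = 7}" "{x::int. x mod 2 = 1 \<and> x mod 5 = 1} = {x. x mod 10 = 1}"
    by (auto; presburger)+
  have "norm (P^40) < 1" using P by (simp add: norm_power power_less_one_iff)
  note D = qpoch_dissect[OF this, of 5 "- (P^40)"]
  have "infsum (qterm p) (lattice5 1 1) = infsum (\<lambda>x. P^nat (x^2)) {x. x mod 10 = 7} * infsum (\<lambda>x. P^nat (x^2)) {x. x mod 10 = 1}"
    unfolding p using lattice5_1[OF P(2), of 1] by (simp add: sets)
  also have "\<dots> = (P^9 * (qpoch (- (P^40)) (P^200) * qpoch (- (P^160)) (P^200) * qpoch (P^200) (P^200)))
      * (P * (qpoch (- (P^120)) (P^200) * qpoch (- (P^80)) (P^200) * qpoch (P^200) (P^200)))"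
    using residue_sum_product[of 1 P "-3" 10 7] residue_sum_product[of 1 P 1 10 1] P by simp
  finally have *: "infsum (qterm p) (lattice5 1 1) = \<dots>" .
  have p2: "p^2 = P^9 * P"
    by (simp add: p flip: power_mult power_Suc2)
  show ?thesis unfolding * p2 using D
    by (simp add: p power_mult[symmetric] power_add[symmetric] prod_lessThan_5 power2_eq_square mult_ac)
qed

text \<open>The four twisted factors carry z, z^2, z^3, z^4; \<open>qpoch (- (p^4)) (p^8)\<close>
  supplies the missing power z^0, and the product over all fifth roots raises the arguments to the
  fifth power.\<close>

lemma twisted_product_even:
  assumes p: "p \<noteq> 0" "norm p < 1" and z: "z^5 = 1" "1 + z + z^2 + z^3 + z^4 = 0"
  shows "infsum (\<lambda>x. z powi x * p^nat (x^2)) (parity 0) * infsum (\<lambda>y. (z^2) powi y * p^nat (y^2)) (parity 0)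
      * qpoch (- (p^4)) (p^8) = (qpoch (p^8) (p^8))^2 * qpoch (- (p^20)) (p^40)"
proof -
  have z0: "z \<noteq> 0" using z(1) by auto
  have inv: "inverse (z^2) = z^3" "inverse (z^4) = z"
    using z(1) by (auto intro!: inverse_unique simp flip: power_add power_Suc power_Suc2)
  have p8: "norm (p^8) < 1" using p by (simp add: norm_power power_less_one_iff)
  note R = qpoch_roots[OF p8 _ fifth_root_prod[OF z], of "- (p^4)"]
  have "infsum (\<lambda>x. z powi x * p^nat (x^2)) (parity 0) =
      qpoch (- (p^4 * z^2)) (p^8) * qpoch (- (p^4 * z^3)) (p^8) * qpoch (p^8) (p^8)"
    using residue_sum_product[of z p 0 2 0] p z0 by (simp add: divide_inverse inv)
  moreover have "infsum (\<lambda>y. (z^2) powi y * p^nat (y^2)) (parity 0) =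
      qpoch (- (p^4 * z^4)) (p^8) * qpoch (- (p^4 * z)) (p^8) * qpoch (p^8) (p^8)"
    using residue_sum_product[of "z^2" p 0 2 0] p z0 by (simp add: divide_inverse inv flip: power_mult)
  ultimately show ?thesis using R
    by (simp add: power_mult[symmetric] prod_lessThan_5 power2_eq_square mult_ac)
qed

text \<open>For odd indices each of the two series has a product that starts at exponent 0, which
  leaves the constants 1 + z^3 and 1 + z. With the prefactors z and z^2 they multiply to -1, the
  source of the minus sign in the relation for \<open>theta 1\<close>.\<close>

lemma twisted_product_odd:
  assumes p: "p \<noteq> 0" "norm p < 1" and z: "z^5 = 1" "1 + z + z^2 + z^3 + z^4 = 0"
  shows "infsum (\<lambda>x. z powi x * p^nat (x^2)) (parity 1) * infsum (\<lambda>y. (z^2) powi y * p^nat (y^2)) (parity 1)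
      * qpoch (- (p^8)) (p^8) = - (p^2 * (qpoch (p^8) (p^8))^2 * qpoch (- (p^40)) (p^40))"
proof -
  have z0: "z \<noteq> 0" using z(1) by auto
  have inv: "inverse (z^2) = z^3" "inverse (z^4) = z"
    using z(1) by (auto intro!: inverse_unique simp flip: power_add power_Suc power_Suc2)
  have p8: "norm (p^8) < 1" using p by (simp add: norm_power power_less_one_iff)
  note R = qpoch_roots[OF p8 _ fifth_root_prod[OF z], of "- (p^8)"]
  have 1: "infsum (\<lambda>x. z powi x * p^nat (x^2)) (parity 1) =
      z * p * (1 + z^3) * (qpoch (- (p^8 * z^2)) (p^8) * qpoch (- (p^8 * z^3)) (p^8) * qpoch (p^8) (p^8))"
    using residue_sum_product[of z p 1 2 1] qpoch_rec[OF p8, of "- (z^3)"] p z0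
    by (simp add: divide_inverse inv mult_ac)
  have 2: "infsum (\<lambda>y. (z^2) powi y * p^nat (y^2)) (parity 1) =
      z^2 * p * (1 + z) * (qpoch (- (p^8 * z^4)) (p^8) * qpoch (- (p^8 * z)) (p^8) * qpoch (p^8) (p^8))"
    using residue_sum_product[of "z^2" p 1 2 1] qpoch_rec[OF p8, of "- z"] p z0
    by (simp add: divide_inverse inv mult_ac flip: power_mult)
  have "z * (1 + z^3) * (z^2 * (1 + z)) = z^3 + z^4 + z^5 * z + z^5 * z^2"
    by (simp add: algebra_simps eval_nat_numeral)
  also have "\<dots> = - 1"
    using z by (simp add: eq_neg_iff_add_eq_0 algebra_simps)
  finally have c: "z * (1 + z^3) * (z^2 * (1 + z)) = - 1" .
  define A where "A = qpoch (- (p^8 * z^2)) (p^8) * qpoch (- (p^8 * z^3)) (p^8) *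
    qpoch (- (p^8 * z^4)) (p^8) * qpoch (- (p^8 * z)) (p^8)"
  have "infsum (\<lambda>x. z powi x * p^nat (x^2)) (parity 1) * infsum (\<lambda>y. (z^2) powi y * p^nat (y^2)) (parity 1)
      = z * (1 + z^3) * (z^2 * (1 + z)) * (p^2 * (qpoch (p^8) (p^8))^2 * A)"
    unfolding 1 2 A_def by (simp add: power2_eq_square mult_ac)
  moreover have "A * qpoch (- (p^8)) (p^8) = qpoch (- (p^40)) (p^40)"
    unfolding A_def using R by (simp add: power_mult[symmetric] prod_lessThan_5 mult_ac)
  ultimately show ?thesis
    unfolding c by (simp add: mult_ac)
qed

text \<open>With \<open>N\<close> the sum over a nonzero class and \<open>T\<close> the sum twisted by the character \<open>z\<close>, the two factors on the left are \<open>4 N\<close> and \<open>4 T\<close>; both factor into theta series in one variable, to which the triple product applies.\<close>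

theorem quintic_theta:
  fixes P z :: "'a::{real_normed_field,banach}"
  assumes P: "P \<noteq> 0" "norm P < 1" and p: "p = P^5" and z: "z^5 = 1" "1 + z + z^2 + z^3 + z^4 = 0"
  defines "E \<equiv> p^4 * (qpoch (p^8) (p^8))^2 * (qpoch (p^40) (p^40))^2"
  shows "(theta 0 p^2 - theta 0 (p^5)^2) * (5 * theta 0 (p^5)^2 - theta 0 p^2) = 16 * E" (is ?even)
    and "(theta 1 p^2 - theta 1 (p^5)^2) * (5 * theta 1 (p^5)^2 - theta 1 p^2) = - 16 * E" (is ?odd)
proof -
  have p0: "p \<noteq> 0" "norm p < 1"
    using P by (auto simp: p norm_power power_less_one_iff)
  define T where "T = (\<lambda>d. infsum (\<lambda>x. z powi x * p^nat (x^2)) (parity d) * infsum (\<lambda>y. (z^2) powi y * p^nat (y^2)) (parity d))"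
  define N where "N = (\<lambda>d. infsum (qterm p) (lattice5 d 1))"
  have eq: "(theta d p^2 - theta d (p^5)^2) * (5 * theta d (p^5)^2 - theta d p^2) = 16 * (N d * T d)"
    if "d \<in> {0, 1}" for d
  proof -
    have 1: "theta d p^2 = theta d (p^5)^2 + 4 * N d" and 2: "T d = theta d (p^5)^2 - N d"
      using theta_square_lattice5(1)[OF p0(2) that] theta_square_lattice5(2)[OF p0(2) that z]
      unfolding N_def T_def by blast+
    show ?thesis unfolding 1 2 by (simp add: algebra_simps)
  qed
  have nz: "qpoch (- (p^k)) (p^l) \<noteq> 0" if "k > 0" "l > 0" for k l
    by (rule qpoch_nonzero') (use p0 that in \<open>simp_all add: norm_power power_less_one_iff\<close>)
  have "N 0 * T 0 * (qpoch (- (p^20)) (p^40) * qpoch (- (p^4)) (p^8)) =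
      (N 0 * qpoch (- (p^20)) (p^40)) * (T 0 * qpoch (- (p^4)) (p^8))" by (simp add: mult_ac)
  also have "\<dots> = E * (qpoch (- (p^20)) (p^40) * qpoch (- (p^4)) (p^8))"
    unfolding N_def T_def lattice5_product_even[OF P p] twisted_product_even[OF p0 z] by (simp add: E_def mult_ac)
  finally have "N 0 * T 0 = E" using nz by simp
  then show ?even using eq[of 0] by simp
  have "N 1 * T 1 * (qpoch (- (p^40)) (p^40) * qpoch (- (p^8)) (p^8)) =
      (N 1 * qpoch (- (p^40)) (p^40)) * (T 1 * qpoch (- (p^8)) (p^8))" by (simp add: mult_ac)
  also have "\<dots> = - E * (qpoch (- (p^40)) (p^40) * qpoch (- (p^8)) (p^8))"
    unfolding N_def T_def lattice5_product_odd[OF P p] twisted_product_odd[OF p0 z]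
    by (simp add: E_def mult_ac flip: power_add)
  finally have "N 1 * T 1 = - E"
    using nz[of 40 40] nz[of 8 8] by (simp only: mult_cancel_right) simp
  then show ?odd using eq[of 1] by simp
qed

section \<open>Quadratic transformations of the theta functions\<close>

text \<open>The classical theta_4 at the nome \<open>p^4\<close>, given directly by its product. For
  \<open>w^4 = - 1\<close> it is \<open>theta 0 (w * p)\<close>, since p^4 changes sign and p^8 does
  not; so facts about \<open>theta 0\<close> carry over.\<close>

definition theta4 :: "'a \<Rightarrow> 'a::{real_normed_field,banach}" where
  "theta4 p = qpoch (p^8) (p^8) * (qpoch (p^4) (p^8))\<^sup>2"

lemma eighth_root_powers:
  fixes w :: "'a::comm_ring_1"
  assumes "w^4 = - 1"
  shows "w^8 = 1" "w^16 = 1" "w^20 = - 1" "w^40 = 1"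
proof -
  have "w^8 = (w^4)^2" "w^16 = (w^4)^4" "w^20 = (w^4)^5" "w^40 = (w^4)^10"
    by (simp_all flip: power_mult)
  then show "w^8 = 1" "w^16 = 1" "w^20 = - 1" "w^40 = 1" using assms by simp_all
qed

lemma theta4_eq:
  assumes "w^4 = - 1" "p \<noteq> 0" "norm (p::'a::{real_normed_field,banach}) < 1"
  shows "theta 0 (w * p) = theta4 p"
proof -
  note w8 = eighth_root_powers(1)[OF assms(1)]
  have "norm w = 1" using power_eq_1_iff[OF w8] by simp
  moreover have "w \<noteq> 0" using w8 by auto
  ultimately show ?thesis
    using assms by (subst theta_0_product) (auto simp: norm_mult power_mult_distrib w8 theta4_def)
qed

context
  fixes p :: "'a::{real_normed_field,banach}"
  assumes p: "p \<noteq> 0" "norm p < 1"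
begin

lemma pow2: "p^2 \<noteq> 0" "norm (p^2) < 1"
  using p norm_power_less_1[of p 2] by auto

text \<open>Euler's identity behind partitions into distinct and into odd parts, (-q; q) (q; q^2) =
  1 with q = p^4, obtained from (q; q) (-q; q) = (q^2; q^2).\<close>

lemma qpoch_euler: "qpoch (- (p^4)) (p^8) * qpoch (p^4) (p^8) * qpoch (- (p^8)) (p^8) = 1"
proof -
  have n: "norm (p^4) < 1" using p by (intro norm_power_less_1) auto
  have 1: "qpoch (- (p^4)) (p^4) = qpoch (- (p^4)) (p^8) * qpoch (- (p^8)) (p^8)"
    using qpoch_dissect2[OF n, of "- (p^4)"] by (simp flip: power_mult power_add)
  have 2: "qpoch (p^4) (p^4) = qpoch (p^4) (p^8) * qpoch (p^8) (p^8)"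
    using qpoch_dissect2[OF n, of "p^4"] by (simp flip: power_mult power_add)
  have 3: "qpoch (p^4) (p^4) * qpoch (- (p^4)) (p^4) = qpoch (p^8) (p^8)"
    using qpoch_minus[OF n, of "p^4"] by (simp flip: power_mult)
  have "qpoch (p^8) (p^8) \<noteq> 0"
    by (rule qpoch_nonzero') (use p in \<open>simp_all add: norm_power_less_1\<close>)
  then show ?thesis using 3 unfolding 1 2 by (simp add: mult_ac)
qed

text \<open>In terms of the eta function, with e^(2 pi i \<tau>) = p^8, this is theta_2 theta_3
  theta_4 = 2 eta^3.\<close>

lemma theta_triple: "theta 0 p * theta4 p * theta 1 p = 2 * p * qpoch (p^8) (p^8)^3"
proof -
  have "theta 0 p * theta4 p * theta 1 p = 2 * p * qpoch (p^8) (p^8)^3 *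
      (qpoch (- (p^4)) (p^8) * qpoch (p^4) (p^8) * qpoch (- (p^8)) (p^8))\<^sup>2"
    unfolding theta_0_product[OF p] theta_1_product[OF p] theta4_def
    by (simp add: power2_eq_square power3_eq_cube mult_ac)
  then show ?thesis by (simp add: qpoch_euler)
qed

lemma theta_1_square: "theta 1 p^2 = 2 * theta 1 (p^2) * theta 0 (p^2)"
proof -
  have n: "norm (p^8) < 1" using p by (intro norm_power_less_1) auto
  have 1: "qpoch (- (p^8)) (p^8) = qpoch (- (p^8)) (p^16) * qpoch (- (p^16)) (p^16)"
    using qpoch_dissect2[OF n, of "- (p^8)"] by (simp flip: power_mult power_add)
  have 2: "qpoch (p^16) (p^16) = qpoch (p^8) (p^8) * qpoch (- (p^8)) (p^8)"
    using qpoch_minus[OF n, of "p^8"] by (simp flip: power_mult)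
  have "2 * theta 1 (p^2) * theta 0 (p^2) = 4 * p^2 * (qpoch (p^16) (p^16))\<^sup>2 *
      (qpoch (- (p^8)) (p^16) * qpoch (- (p^16)) (p^16))\<^sup>2"
    unfolding theta_0_product[OF pow2] theta_1_product[OF pow2]
    by (simp flip: power_mult) (simp add: power2_eq_square mult_ac)
  also have "\<dots> = theta 1 p^2"
    unfolding 1[symmetric] 2 theta_1_product[OF p] by (simp add: power2_eq_square mult_ac)
  finally show ?thesis by simp
qed

text \<open>This is \<open>theta_dissect2\<close> at \<open>w * p\<close>: passing from p^2 to w^2
  p^2 fixes the even theta series and multiplies the odd one by w^2, whose square is -1.\<close>

lemma theta4_square:
  fixes w :: 'a
  assumes w: "w^4 = - 1"
  shows "theta4 p^2 = theta 0 (p^2)^2 - theta 1 (p^2)^2"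
proof -
  note w8 = eighth_root_powers(1)[OF assms(1)]
  have nw: "norm w = 1" using power_eq_1_iff[OF w8] by simp
  have w0: "w \<noteq> 0" using w8 by auto
  note ww = eighth_root_powers(2)[OF assms(1)]
  have wp: "(w * p)\<^sup>2 \<noteq> 0" "norm ((w * p)\<^sup>2) < 1" "norm (w * p) < 1"
    using p w0 nw by (auto simp: norm_mult norm_power power_less_one_iff)
  have 0: "theta 0 ((w * p)\<^sup>2) = theta 0 (p^2)"
    unfolding theta_0_product[OF wp(1,2)] theta_0_product[OF pow2]
    by (simp add: power_mult_distrib ww w8 flip: power_mult)
  have 1: "theta 1 ((w * p)\<^sup>2) = w^2 * theta 1 (p^2)"
    unfolding theta_1_product[OF wp(1,2)] theta_1_product[OF pow2]
    by (simp add: power_mult_distrib ww flip: power_mult)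
  have "(theta 0 (w * p))\<^sup>2 = theta 0 (p^2)^2 + (w^2)\<^sup>2 * theta 1 (p^2)^2"
    using theta_dissect2[OF wp(3)] unfolding 0 1 by (simp add: power_mult_distrib)
  moreover have "(w^2)\<^sup>2 = - 1" using w by (simp flip: power_mult)
  ultimately show ?thesis using theta4_eq[OF w p] by simp
qed

end

lemma theta_of_real:
  assumes "\<bar>p\<bar> < 1"
  shows "theta d (of_real p :: 'a::{real_normed_field,banach}) = of_real (theta d p)"
proof -
  have "(\<lambda>x::int. p^nat (x^2)) summable_on parity d"
    by (rule abs_summable_summable[OF square_summable]) (use assms in simp)
  then have "((\<lambda>x::int. p^nat (x^2)) has_sum theta d p) (parity d)"
    unfolding theta_def by (rule has_sum_infsum)
  from has_sum_of_real[OF this, where 'a = 'a] show ?thesis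
    unfolding theta_def by (simp add: infsumI)
qed

lemma theta4_of_real:
  assumes "\<bar>p\<bar> < 1"
  shows "theta4 (of_real p :: 'a::{real_normed_field,banach}) = of_real (theta4 p)"
proof -
  have "\<bar>p^8\<bar> < 1"
    unfolding power_abs using assms by (subst power_less_one_iff) auto
  then show ?thesis
    unfolding theta4_def using qpoch_of_real[of "p^8" "p^8", where 'a = 'a] qpoch_of_real[of "p^8" "p^4", where 'a = 'a]
    by simp
qed

lemma cis_root8: "cis (pi / 4)^4 = - 1"
  unfolding Complex.DeMoivre by simp

lemma cis_root5:
  defines "z \<equiv> cis (2 * pi / 5)"
  shows "z^5 = 1" "1 + z + z^2 + z^3 + z^4 = 0"
proof -
  show z5: "z^5 = 1" unfolding z_def by (subst Complex.DeMoivre) simp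
  have "sin (2 * pi / 5) > 0" by (rule sin_gt_zero) auto
  then have "z \<noteq> 1" by (auto simp: z_def complex_eq_iff)
  moreover have "(z - 1) * (1 + z + z^2 + z^3 + z^4) = z^5 - 1"
    by (simp add: algebra_simps eval_nat_numeral)
  ultimately show "1 + z + z^2 + z^3 + z^4 = 0" using z5 by simp
qed

lemma theta4_square_real:
  fixes p :: real
  assumes "0 < p" "p < 1"
  shows "theta4 p^2 = theta 0 (p^2)^2 - theta 1 (p^2)^2"
proof -
  have p2: "\<bar>p^2\<bar> < 1" "\<bar>p\<bar> < 1" using assms by (auto simp: power_less_one_iff)
  have "(theta4 (complex_of_real p))\<^sup>2 = (theta 0 (complex_of_real p^2))\<^sup>2 - (theta 1 (complex_of_real p^2))\<^sup>2"
    by (rule theta4_square[OF _ _ cis_root8]) (use assms in auto)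
  also have "complex_of_real p^2 = of_real (p^2)" by simp
  finally have "complex_of_real (theta4 p^2) = of_real (theta 0 (p^2)^2 - theta 1 (p^2)^2)"
    unfolding theta_of_real[OF p2(1)] theta4_of_real[OF p2(2)] by simp
  then show ?thesis by (simp only: of_real_eq_iff)
qed

text \<open>The relation for \<open>theta4\<close> is the one for \<open>theta 0\<close> at
  \<open>w * p\<close>; the right side changes sign because E contains the factor p^4 and w^4 =
  -1.\<close>

lemma quintic_theta_real:
  fixes p :: real
  assumes p: "0 < p" "p < 1"
  defines "E \<equiv> p^4 * (qpoch (p^8) (p^8))^2 * (qpoch (p^40) (p^40))^2"
  shows "(theta 0 p^2 - theta 0 (p^5)^2) * (5 * theta 0 (p^5)^2 - theta 0 p^2) = 16 * E"
    and "(theta4 p^2 - theta4 (p^5)^2) * (5 * theta4 (p^5)^2 - theta4 p^2) = - 16 * E"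
    and "(theta 1 p^2 - theta 1 (p^5)^2) * (5 * theta 1 (p^5)^2 - theta 1 p^2) = - 16 * E"
proof -
  define w where "w = cis (pi / 4)"
  have w: "w^4 = - 1" unfolding w_def by (rule cis_root8)
  note wk = eighth_root_powers(1,3,4)[OF w]
  define P where "P = root 5 p"
  have P: "P > 0" "P < 1" "p = P^5" using p by (auto simp: P_def)
  define Q where "Q = complex_of_real P"
  have pk: "\<bar>p^k\<bar> < 1" if "k > 0" for k using p that by (simp add: power_less_one_iff)
  have p1: "\<bar>p\<bar> < 1" using p by simp
  have cp: "complex_of_real p = Q^5" "Q \<noteq> 0" "norm Q < 1" using P by (auto simp: Q_def)
  define F where "F = (\<lambda>k. qpoch (complex_of_real (p^k)) (complex_of_real (p^k)))"
  have F: "F k = of_real (qpoch (p^k) (p^k))" if "k > 0" for k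
    unfolding F_def by (rule qpoch_of_real[OF pk[OF that]])
  have E: "complex_of_real E = of_real p^4 * (F 8)\<^sup>2 * (F 40)\<^sup>2"
    unfolding E_def by (simp add: F)
  note q = quintic_theta[OF cp(2,3,1) cis_root5]
  have t5: "theta d (complex_of_real p^5) = of_real (theta d (p^5))" for d
    using theta_of_real[OF pk[of 5], of d, where 'a = complex] by simp
  have t1: "theta d (complex_of_real p) = of_real (theta d p)" for d
    by (rule theta_of_real[OF p1])
  have "complex_of_real ((theta 0 p^2 - theta 0 (p^5)^2) * (5 * theta 0 (p^5)^2 - theta 0 p^2)) = of_real (16 * E)"
    using q(1) unfolding t1 t5 by (simp add: E F_def)
  then show "(theta 0 p^2 - theta 0 (p^5)^2) * (5 * theta 0 (p^5)^2 - theta 0 p^2) = 16 * E"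
    by (simp only: of_real_eq_iff)
  have "complex_of_real ((theta 1 p^2 - theta 1 (p^5)^2) * (5 * theta 1 (p^5)^2 - theta 1 p^2)) = of_real (- 16 * E)"
    using q(2) unfolding t1 t5 by (simp add: E F_def)
  then show "(theta 1 p^2 - theta 1 (p^5)^2) * (5 * theta 1 (p^5)^2 - theta 1 p^2) = - 16 * E"
    by (simp only: of_real_eq_iff)
  \<comment> \<open>A fifth root of w p is needed as well. Since w^25 = w, the number w^5 Q is
    one.\<close>
  have v: "w * of_real p = (w^5 * Q)^5"
  proof -
    have "(w^5 * Q)^5 = w^25 * Q^5"
      by (simp add: power_mult_distrib flip: power_mult)
    also have "w^25 = (w^8)^3 * w" by (simp flip: power_mult power_Suc2)
    finally show ?thesis by (simp add: wk cp)
  qed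
  have nw: "norm w = 1" by (simp add: w_def)
  have vQ: "w^5 * Q \<noteq> 0" "norm (w^5 * Q) < 1"
    using cp(2,3) nw by (auto simp: norm_mult norm_power)
  have a1: "theta 0 (w * complex_of_real p) = of_real (theta4 p)"
    using theta4_eq[OF w, of "of_real p"] p theta4_of_real[OF p1, where 'a = complex] by simp
  have "(w^5)^4 = - 1" using wk by (simp flip: power_mult)
  moreover have "norm (complex_of_real p^5) < 1" using pk[of 5] p by (simp add: norm_power)
  ultimately have "theta 0 (w^5 * complex_of_real p^5) = theta4 (complex_of_real p^5)"
    using p by (intro theta4_eq) auto
  with theta4_of_real[OF pk[of 5], where 'a = complex]
  have a5: "theta 0 ((w * complex_of_real p)^5) = of_real (theta4 (p^5))"
    by (simp add: power_mult_distrib)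
  have "complex_of_real ((theta4 p^2 - theta4 (p^5)^2) * (5 * theta4 (p^5)^2 - theta4 p^2)) = of_real (- 16 * E)"
    using quintic_theta(1)[OF vQ v cis_root5] unfolding a1 a5
    by (simp add: E F_def power_mult_distrib w wk)
  then show "(theta4 p^2 - theta4 (p^5)^2) * (5 * theta4 (p^5)^2 - theta4 p^2) = - 16 * E"
    by (simp only: of_real_eq_iff)
qed

section \<open>The quintic identity for the Rogers--Ramanujan theta functions\<close>

text \<open>Ramanujan's f(-x^2, -x^3), whose product involves the residues 2 and 3 modulo 5;
  \<open>rr_theta1\<close> belongs to the residues 1 and 4. The quotient
  \<open>rr_theta1 x / rr_theta2 x\<close> is R(x) without the factor x^(1/5).\<close>

definition rr_theta2 :: "'a \<Rightarrow> 'a::{real_normed_field,banach}" where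
  "rr_theta2 x = infsum (rterm (- (x^2)) (- (x^3))) UNIV"

definition rr_theta1 :: "'a \<Rightarrow> 'a::{real_normed_field,banach}" where
  "rr_theta1 x = infsum (rterm (- x) (- (x^4))) UNIV"

lemma rterm_swap: "(rterm a b has_sum S) UNIV \<longleftrightarrow> (rterm b a has_sum S) UNIV"
  by (rule has_sum_reindex_bij_witness[of _ uminus uminus]) (auto simp: rterm_minus)

lemma rterm_has_sum5:
  assumes "x \<noteq> 0" "norm x < 1" "c + d = 5"
  shows "(rterm (- (x^c)) (- (x^d)) has_sum
    qpoch (x^c) (x^5) * qpoch (x^d) (x^5) * qpoch (x^5) (x^5)) UNIV"
proof -
  have e: "(- (x^c)) * (- (x^d)) = x^5" using assms(3) by (simp flip: power_add)
  have "norm (x^5) < 1" using assms by (intro norm_power_less_1) auto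
  then show ?thesis
    using jacobi_triple[of "- (x^c)" "- (x^d)"] assms(1) unfolding e by simp
qed

lemma rr_theta2_has_sum:
  assumes "x \<noteq> 0" "norm x < 1"
  shows "(rterm (- (x^2)) (- (x^3)) has_sum rr_theta2 x) UNIV" "(rterm (- (x^3)) (- (x^2)) has_sum rr_theta2 x) UNIV"
    "rr_theta2 x = qpoch (x^2) (x^5) * qpoch (x^3) (x^5) * qpoch (x^5) (x^5)"
  using rterm_has_sum5[OF assms, of 2 3] rterm_swap[of "- (x^2)" "- (x^3)" "rr_theta2 x"]
  by (simp_all add: rr_theta2_def infsumI)

lemma rr_theta1_has_sum:
  assumes "x \<noteq> 0" "norm x < 1"
  shows "(rterm (- x) (- (x^4)) has_sum rr_theta1 x) UNIV" "(rterm (- (x^4)) (- x) has_sum rr_theta1 x) UNIV"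
    "rr_theta1 x = qpoch x (x^5) * qpoch (x^4) (x^5) * qpoch (x^5) (x^5)"
  using rterm_has_sum5[OF assms, of 1 4] rterm_swap[of "- x" "- (x^4)" "rr_theta1 x"]
  by (simp_all add: rr_theta1_def infsumI)

lemma qpoch_self_dissect5:
  assumes "norm x < 1"
  shows "qpoch x x = qpoch x (x^5) * qpoch (x^2) (x^5) * qpoch (x^3) (x^5) * qpoch (x^4) (x^5) * qpoch (x^5) (x^5)"
proof -
  have "x * x = x^2" "x * x^2 = x^3" "x * x^3 = x^4" "x * x^4 = x^5"
    by (simp_all add: eval_nat_numeral)
  then show ?thesis
    using qpoch_dissect[OF assms, of 5 x] by (simp add: prod_lessThan_5)
qed

lemma rr_theta_mult:
  assumes "x \<noteq> 0" "norm x < 1"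
  shows "rr_theta2 x * rr_theta1 x = qpoch x x * qpoch (x^5) (x^5)"
  unfolding rr_theta2_has_sum(3)[OF assms] rr_theta1_has_sum(3)[OF assms] qpoch_self_dissect5[OF assms(2)] by (simp only: mult_ac)

text \<open>The triple product series with a = -s z and b = -1/z is split by the index modulo 5, on
  which z^n depends. Classes 0 and 4 give \<open>rr_theta2\<close>, classes 1 and 3 give
  \<open>rr_theta1\<close>, and class 2 vanishes. The common factor 1 - z^4 is the first factor of
  (1/z; s) and cancels.\<close>

lemma twisted_pentagonal:
  fixes s z :: "'a::{real_normed_field,banach}"
  assumes s: "s \<noteq> 0" "norm s < 1" and z: "z^5 = 1" "1 + z + z^2 + z^3 + z^4 = 0"
  shows "qpoch (s * z) s * qpoch (s * z^4) s * qpoch s s = rr_theta2 (s^5) + (z^2 + z^3) * (s * rr_theta1 (s^5))"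
proof -
  have z0: "z \<noteq> 0" using z(1) by auto
  have z1: "z \<noteq> 1"
  proof
    assume "z = 1"
    then have "(5::'a) = 0" using z(2) by simp
    then show False by simp
  qed
  have zi: "1 / z = z^4" using z(1) z0 by (simp add: divide_eq_eq flip: power_Suc2)
  define x where "x = s^5"
  have x: "x \<noteq> 0" "norm x < 1" using s norm_power_less_1[of s 5] by (auto simp: x_def)
  have zm: "z powi (5 * k + r) = z powi r" for k r
  proof -
    have "z powi (5 * k + r) = (z powi 5) powi k * z powi r"
      unfolding power_int_mult[symmetric] using z0 by (intro power_int_add) simp
    also have "z powi 5 = 1" using z(1) by (simp add: power_int_def)
    finally show ?thesis by simp
  qed
  define f where "f = rterm (- (s * z)) (- (1 / z))"
  have f: "f n = (- z) powi n * s^nat (n * (n + 1) div 2)" for n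
    using rterm_eq[of "- z" s 1 0 n] z0 by (simp add: f_def)
  have J: "(f has_sum qpoch (s * z) s * qpoch (1 / z) s * qpoch s s) UNIV"
    using jacobi_triple[of "- (s * z)" "- (1 / z)"] s z0 by (simp add: f_def)
  \<comment> \<open>Expanding the triangular number of 5 k + r shows that each class is again a
    theta series in x = s^5; comparing coefficients forces c + d = 5 and c - d = 2 r + 1.\<close>
  have shift: "f (5 * k + r) = (- 1) powi r * z powi r * s^nat e * rterm (- (x^c)) (- (x^d)) k"
    if "2 * e = r * (r + 1)" "int c + int d = 5" "int c - int d = 2 * r + 1" for k r e :: int and c d :: nat
  proof -
    define S T where "S = k * (k + 1) div 2" and "T = k * (k - 1) div 2"
    have S: "2 * S = k * (k + 1)" and T: "2 * T = k * (k - 1)" unfolding S_def T_def by (rule two_tri)+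
    have nn: "S \<ge> 0" "T \<ge> 0" unfolding S_def T_def by (rule tri_nonneg)+
    have "2 * ((5 * k + r) * ((5 * k + r) + 1) div 2) = (5 * k + r) * ((5 * k + r) + 1)" by (rule two_tri)
    also have "\<dots> = 25 * k * k + 5 * k * (2 * r + 1) + r * (r + 1)" by (simp add: algebra_simps)
    also have "\<dots> = 5 * (int c + int d) * k * k + 5 * k * (int c - int d) + 2 * e"
      unfolding that by simp
    also have "\<dots> = 2 * e + 5 * (int c * (2 * S) + int d * (2 * T))"
      unfolding S T by (simp add: algebra_simps)
    also have "\<dots> = 2 * (e + 5 * (int c * S + int d * T))"
      by (simp add: algebra_simps)
    finally have E: "(5 * k + r) * ((5 * k + r) + 1) div 2 = e + 5 * (int c * S + int d * T)" by simp
    have "r * (r + 1) \<ge> 0" by (cases "r \<ge> 0") (auto simp: mult_nonneg_nonneg mult_nonpos_nonpos)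
    then have e: "e \<ge> 0" using that(1) by linarith
    have "s^nat (e + 5 * (int c * S + int d * T)) = s^nat e * x^nat (int c * S + int d * T)"
      using e nn by (simp add: nat_add_distrib nat_mult_distrib power_add power_mult x_def)
    moreover have "rterm (- (x^c)) (- (x^d)) k = (- 1) powi k * x^nat (int c * S + int d * T)"
      using rterm_eq[of "- 1" x c d k] by (simp add: S_def T_def)
    moreover have "(- z) powi (5 * k + r) = (- 1) powi (5 * k + r) * z powi r"
      using power_int_mult_distrib[of "-1" z "5 * k + r"] by (simp add: zm)
    moreover have "(- 1 :: 'a) powi (5 * k + r) = (- 1) powi k * (- 1) powi r"
      by (simp add: power_int_add power_int_mult)
    ultimately show ?thesis unfolding f E by (simp add: mult_ac)
  qed
  have cls: "(f has_sum S) {n. n mod 5 = r mod 5} \<longleftrightarrow> ((\<lambda>k. f (5 * k + r)) has_sum S) UNIV" for S r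
    by (rule residue_has_sum_iff) auto
  have h0: "(f has_sum rr_theta2 x) {n. n mod 5 = 0}"
    using cls[where S = "rr_theta2 x" and r = 0] shift[of 0 0 3 2] rr_theta2_has_sum(2)[OF x] by simp
  have h4: "(f has_sum (- (z^4 * rr_theta2 x))) {n. n mod 5 = 4}"
  proof -
    have "(\<lambda>k. f (5 * k + - 1)) = (\<lambda>k. - (z^4) * rterm (- (x^2)) (- (x^3)) k)"
      using shift[of 0 "-1" 2 3] z0 zi by (simp add: power_int_minus field_simps)
    then show ?thesis using cls[where r = "-1"] has_sum_cmult_right[OF rr_theta2_has_sum(1)[OF x], of "- (z^4)"] by simp
  qed
  have h1: "(f has_sum (- (z * s * rr_theta1 x))) {n. n mod 5 = 1}"
  proof -
    have "(\<lambda>k. f (5 * k + 1)) = (\<lambda>k. - (z * s) * rterm (- (x^4)) (- x) k)"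
      using shift[of 1 1 4 1] by simp
    then show ?thesis using cls[where r = 1] has_sum_cmult_right[OF rr_theta1_has_sum(2)[OF x], of "- (z * s)"] by simp
  qed
  have h3: "(f has_sum (z^3 * s * rr_theta1 x)) {n. n mod 5 = 3}"
  proof -
    have "z powi (- 2) = z^3" using zm[of "-1" 3] by (simp add: power_int_def)
    then have "(\<lambda>k. f (5 * k + - 2)) = (\<lambda>k. z^3 * s * rterm (- x) (- (x^4)) k)"
      using shift[of 1 "-2" 1 4] by simp
    then show ?thesis using cls[where r = "-2"] has_sum_cmult_right[OF rr_theta1_has_sum(1)[OF x], of "z^3 * s"] by simp
  qed
  \<comment> \<open>Here c = 5 and d = 0, and the triple product contains
    \<open>qpoch 1 (x^5)\<close>, which is 0.\<close>
  have h2: "(f has_sum 0) {n. n mod 5 = 2}"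
  proof -
    have "(\<lambda>k. f (5 * k + 2)) = (\<lambda>k. z^2 * s^3 * rterm (- (x^5)) (- 1) k)"
      using shift[of 3 2 5 0] by simp
    moreover have "(rterm (- (x^5)) (- 1) has_sum 0) UNIV"
      using jacobi_triple[of "- (x^5)" "- 1"] x norm_power_less_1[of x 5] qpoch_rec[of "x^5" 1] by simp
    ultimately show ?thesis using cls[where r = 2] has_sum_cmult_right[where c = "z^2 * s^3" and f = "rterm (- (x^5)) (- 1)" and a = 0 and A = UNIV] by simp
  qed
  define t where "t = (\<lambda>r::int. if r = 0 then rr_theta2 x else if r = 1 then - (z * s * rr_theta1 x) else if r = 2 then 0
     else if r = 3 then z^3 * s * rr_theta1 x else - (z^4 * rr_theta2 x))"
  have "(f has_sum (\<Sum>r\<in>{0,1,2,3,4}. t r)) (\<Union>r\<in>{0,1,2,3,4}. {n. n mod 5 = r})"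
    by (rule sum_has_sum) (use h0 h1 h2 h3 h4 in \<open>auto simp: t_def\<close>)
  also have "(\<Union>r\<in>{0,1,2,3,4}. {n::int. n mod 5 = r}) = UNIV"
  proof -
    have "n mod 5 \<in> {0,1,2,3,4}" for n :: int
      using pos_mod_bound[of 5 n] pos_mod_sign[of 5 n] by simp linarith
    then show ?thesis by blast
  qed
  finally have "qpoch (s * z) s * qpoch (1 / z) s * qpoch s s = (\<Sum>r\<in>{0,1,2,3,4}. t r)"
    using J by (rule has_sum_unique[rotated])
  also have "\<dots> = (1 - z^4) * rr_theta2 x + (z^3 - z) * (s * rr_theta1 x)"
    by (simp add: t_def algebra_simps)
  also have "z^3 - z = (1 - z^4) * (z^2 + z^3)"
  proof -
    have "(1 - z^4) * (z^2 + z^3) = z^2 + z^3 - z^5 * z - z^5 * z^2"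
      by (simp add: algebra_simps eval_nat_numeral)
    then show ?thesis by (simp add: z(1))
  qed
  also have "qpoch (1 / z) s = (1 - z^4) * qpoch (s * z^4) s"
    using qpoch_rec[OF s(2), of "z^4"] by (simp add: zi mult.commute)
  finally have "(1 - z^4) * (qpoch (s * z) s * qpoch (s * z^4) s * qpoch s s) =
      (1 - z^4) * (rr_theta2 x + (z^2 + z^3) * (s * rr_theta1 x))"
    by (simp add: algebra_simps)
  moreover have "1 - z^4 \<noteq> 0"
    using zi z1 by (metis divide_eq_1_iff eq_iff_diff_eq_0 z0)
  ultimately show ?thesis by (simp add: x_def)
qed

lemma fifth_root_power:
  fixes z :: "'a::comm_ring_1"
  assumes z: "z^5 = 1" "1 + z + z^2 + z^3 + z^4 = 0" and r: "r \<in> {1,2,3,4}"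
  shows "(z^r)^5 = 1" "1 + z^r + (z^r)^2 + (z^r)^3 + (z^r)^4 = 0"
proof -
  show "(z^r)^5 = 1"
    using z(1) by (metis power_mult mult.commute power_one)
  have "z^6 = z^5 * z" "z^8 = z^5 * z^3" "z^9 = z^5 * z^4" "z^12 = z^5 * (z^5 * z^2)" "z^16 = z^5 * (z^5 * (z^5 * z))"
    by (simp_all flip: power_add power_Suc2)
  then have "z^6 = z" "z^8 = z^3" "z^9 = z^4" "z^12 = z^2" "z^16 = z"
    by (simp_all add: z(1))
  show "1 + z^r + (z^r)^2 + (z^r)^3 + (z^r)^4 = 0"
  proof (cases "r = 1")
    case False
    then show ?thesis
      using r z(2) \<open>z^6 = z\<close> \<open>z^8 = z^3\<close> \<open>z^9 = z^4\<close> \<open>z^12 = z^2\<close> \<open>z^16 = z\<close>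
      by (auto simp: add_ac simp flip: power_mult)
  qed (use z(2) in simp)
qed

text \<open>The coefficients \<open>z\<^sup>2 + z\<^sup>3\<close> and \<open>z + z\<^sup>4\<close> are the roots of \<open>t\<^sup>2 + t = 1\<close>. Multiplying over the conjugates \<open>z\<^sup>j s\<close>, which fix \<open>s\<^sup>5\<close>, gives the fifth powers.\<close>

lemma qpoch_self_golden:
  fixes s z :: "'a::{real_normed_field,banach}"
  assumes s: "s \<noteq> 0" "norm s < 1" and z: "z^5 = 1" "1 + z + z^2 + z^3 + z^4 = 0"
  defines "a \<equiv> rr_theta2 (s^5)" and "b \<equiv> s * rr_theta1 (s^5)"
  shows "qpoch s s * qpoch (s^5) (s^5) = (a + (z^2 + z^3) * b) * (a + (z + z^4) * b)"
proof -
  have n: "qpoch s s \<noteq> 0" by (rule qpoch_nonzero'[OF s(2) s(2)])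
  have 68: "z^6 = z" "z^8 = z^3"
  proof -
    have "z^6 = z^5 * z" "z^8 = z^5 * z^3"
      by (simp_all flip: power_add power_Suc2)
    then show "z^6 = z" "z^8 = z^3" by (simp_all add: z(1))
  qed
  note A = twisted_pentagonal[OF s z, folded a_def b_def]
  have B: "qpoch (s * z^2) s * qpoch (s * z^3) s * qpoch s s = a + (z + z^4) * b"
    using twisted_pentagonal[OF s fifth_root_power[OF z, of 2]]
    by (simp add: a_def b_def 68 add.commute flip: power_mult)
  have "(\<Prod>j<5. qpoch (z^j * s) s) = qpoch (s^5) (s^5)"
    by (rule qpoch_roots[OF s(2) _ fifth_root_prod[OF z]]) simp
  then have "qpoch (s^5) (s^5) = qpoch s s * qpoch (s * z) s * qpoch (s * z^2) s * qpoch (s * z^3) s * qpoch (s * z^4) s"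
    by (simp add: prod_lessThan_5 mult.commute[of s])
  then show ?thesis unfolding A[symmetric] B[symmetric] by (simp only: mult_ac)
qed

text \<open>Each (z^j s; z^j s) is dissected by exponents modulo 5; the fifth power of every
  conjugate is x. A nonzero class r multiplies over the conjugates to (x^r; x^5), the zero class
  gives (x; x)^5, and the extra factor (x^5; x^5) completes one more (x; x).\<close>

lemma qpoch_self_conjugates:
  fixes s z :: "'a::{real_normed_field,banach}"
  assumes s: "s \<noteq> 0" "norm s < 1" and z: "z^5 = 1" "1 + z + z^2 + z^3 + z^4 = 0" and x: "x = s^5"
  shows "(\<Prod>j<5. qpoch (z^j * s) (z^j * s)) * qpoch (x^5) (x^5) = qpoch x x^6"
proof -
  have nx: "norm x < 1" using s norm_power_less_1[of s 5] by (simp add: x)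
  have nz: "norm z = 1" using power_eq_1_iff[OF z(1)] by simp
  have c5: "(z^j * s)^5 = x" for j
    using fifth_root_power[OF z, of 1] z(1) by (simp add: power_mult_distrib x) (metis power_mult mult.commute power_one mult_1)
  have cn: "norm (z^j * s) < 1" for j using s nz by (simp add: norm_mult norm_power)
  have R: "(\<Prod>j<5. qpoch ((z^j * s)^r) x) = qpoch (x^r) (x^5)" if "r \<in> {1,2,3,4}" for r
  proof -
    have "(\<Prod>j<5. qpoch ((z^r)^j * s^r) x) = qpoch ((s^r)^5) (x^5)"
      by (rule qpoch_roots[OF nx _ fifth_root_prod[OF fifth_root_power[OF z that]]]) simp
    moreover have "(z^j * s)^r = (z^r)^j * s^r" for j
      by (simp add: power_mult_distrib mult.commute flip: power_mult)
    moreover have "(s^r)^5 = x^r" by (simp add: x mult.commute flip: power_mult)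
    ultimately show ?thesis by simp
  qed
  have "(\<Prod>j<5. qpoch (z^j * s) (z^j * s)) =
      (\<Prod>j<5. qpoch ((z^j * s)^1) x * qpoch ((z^j * s)^2) x * qpoch ((z^j * s)^3) x * qpoch ((z^j * s)^4) x * qpoch x x)"
    by (rule prod.cong[OF refl]) (use qpoch_self_dissect5[OF cn] in \<open>simp add: c5\<close>)
  also have "\<dots> = qpoch (x^1) (x^5) * qpoch (x^2) (x^5) * qpoch (x^3) (x^5) * qpoch (x^4) (x^5) * qpoch x x^5"
    unfolding prod.distrib by (subst (1 2 3 4) R) auto
  finally show ?thesis
    using qpoch_self_dissect5[OF nx] by (simp add: eval_nat_numeral(2,3) mult_ac)
qed

text \<open>This is where the 11 in the statement originates: -t and -u are the roots of X^2 - X -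
  1, and 11 is the fifth Lucas number.\<close>

lemma golden_fifth_powers:
  fixes t u :: "'a::comm_ring_1"
  assumes "t + u = - 1" "t * u = - 1"
  shows "t^5 + u^5 = - 11" "t^5 * u^5 = - 1"
proof -
  have u: "u = - 1 - t" using assms(1) by (simp add: algebra_simps)
  have t2: "t * t = 1 - t" using assms(2) by (simp add: u algebra_simps)
  have t3: "t * t * t = 2 * t - 1" by (simp add: t2 algebra_simps)
  have t5: "t^5 = 5 * t - 3"
  proof -
    have "t^5 = (t * t * t) * (t * t)" by (simp add: eval_nat_numeral mult_ac)
    also have "\<dots> = (2 * t - 1) * (t * t)" by (simp only: t3)
    also have "\<dots> = (2 * t - 1) * (1 - t)" by (simp only: t2)
    also have "\<dots> = 3 * t - 2 * (t * t) - 1" by (simp add: algebra_simps)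
    finally show ?thesis by (simp add: t2 algebra_simps)
  qed
  have u2: "u * u = 1 - u" by (simp add: u t2 algebra_simps)
  have u3: "u * u * u = 2 * u - 1" by (simp add: u2 algebra_simps)
  have u5: "u^5 = 5 * u - 3"
  proof -
    have "u^5 = (u * u * u) * (u * u)" by (simp add: eval_nat_numeral mult_ac)
    also have "\<dots> = (2 * u - 1) * (u * u)" by (simp only: u3)
    also have "\<dots> = (2 * u - 1) * (1 - u)" by (simp only: u2)
    also have "\<dots> = 3 * u - 2 * (u * u) - 1" by (simp add: algebra_simps)
    finally show ?thesis by (simp add: u2 algebra_simps)
  qed
  show "t^5 + u^5 = - 11" unfolding t5 u5 by (simp add: u)
  show "t^5 * u^5 = - 1"
    using assms(2) by (simp flip: power_mult_distrib)
qed

text \<open>The fifth power of R is B^5 / A^5. Multiplying \<open>qpoch_self_golden\<close> over the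
  five conjugates turns the golden factors into A^5 + t^5 B^5 and A^5 + u^5 B^5; their product
  divided by A^5 B^5 = x E^5 F^5 is the left side.\<close>

theorem rr_quintic:
  fixes x s z :: "'a::{real_normed_field,banach}"
  assumes s: "s \<noteq> 0" "norm s < 1" and z: "z^5 = 1" "1 + z + z^2 + z^3 + z^4 = 0" and x: "x = s^5"
  shows "inverse (x * (rr_theta1 x / rr_theta2 x)^5) - 11 - x * (rr_theta1 x / rr_theta2 x)^5 = qpoch x x^6 / (x * qpoch (x^5) (x^5)^6)"
proof -
  have nx: "norm x < 1" "x \<noteq> 0" using s norm_power_less_1[of s 5] by (auto simp: x)
  have nz: "norm z = 1" "z \<noteq> 0" using power_eq_1_iff[OF z(1)] z(1) by auto
  define A B where "A = rr_theta2 x" and "B = s * rr_theta1 x"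
  define t u where "t = z^2 + z^3" and "u = z + z^4"
  have tu1: "t + u = - 1" using z(2) unfolding t_def u_def
    by (simp add: eq_neg_iff_add_eq_0 algebra_simps)
  have "t * u = z^3 + z^4 + z^5 * z + z^5 * z^2"
    unfolding t_def u_def by (simp add: algebra_simps eval_nat_numeral)
  also have "\<dots> = t + u" using z(1) by (simp add: t_def u_def)
  finally have tu2: "t * u = - 1" using tu1 by simp
  define E F where "E = qpoch x x" and "F = qpoch (x^5) (x^5)"
  have EF0: "E \<noteq> 0" "F \<noteq> 0"
    unfolding E_def F_def using nx norm_power_less_1[of x 5] by (simp_all add: qpoch_nonzero')
  have AB: "A * B = s * E * F"
    using rr_theta_mult[OF nx(2,1)] by (simp add: A_def B_def E_def F_def)
  then have AB0: "A \<noteq> 0" "B \<noteq> 0" using EF0 s(1) by auto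
  have step: "qpoch (z^j * s) (z^j * s) * E = (A + t * (z^j * B)) * (A + u * (z^j * B))" for j
  proof -
    have c: "z^j * s \<noteq> 0" "norm (z^j * s) < 1" using s nz by (auto simp: norm_mult norm_power)
    have "(z^j * s)^5 = x"
      using z(1) by (simp add: power_mult_distrib x) (metis power_mult mult.commute power_one mult_1)
    then show ?thesis
      using qpoch_self_golden[OF c z] by (simp add: E_def A_def B_def t_def u_def mult_ac)
  qed
  have homog: "(\<Prod>j<5. A + v * (z^j * B)) = A^5 + v^5 * B^5" for v
  proof -
    have "(\<Prod>j<5. A + v * (z^j * B)) = (\<Prod>j<5. A * (1 - z^j * (- v * B / A)))"
      using AB0 by (intro prod.cong refl) (simp add: field_simps)
    also have "\<dots> = A^5 * (1 - (- v * B / A)^5)"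
      by (simp only: prod.distrib fifth_root_prod[OF z]) simp
    also have "\<dots> = A^5 + v^5 * B^5"
      using AB0 by (simp add: power_mult_distrib power_divide field_simps)
    finally show ?thesis .
  qed
  have "(\<Prod>j<5. qpoch (z^j * s) (z^j * s) * E) = (A^5 + t^5 * B^5) * (A^5 + u^5 * B^5)"
    unfolding step by (simp only: prod.distrib homog)
  also have "\<dots> = A^10 + (t^5 + u^5) * (A^5 * B^5) + (t^5 * u^5) * B^10"
  proof -
    have "A^10 = A^5 * A^5" "B^10 = B^5 * B^5" by (simp_all flip: power_add)
    then show ?thesis by (simp add: algebra_simps)
  qed
  also have "\<dots> = A^10 - 11 * (A^5 * B^5) - B^10"
    unfolding golden_fifth_powers[OF tu1 tu2] by simp
  finally have poly: "A^10 - 11 * (A^5 * B^5) - B^10 = (\<Prod>j<5. qpoch (z^j * s) (z^j * s)) * E^5"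
    by (simp add: prod.distrib)
  have "(A^10 - 11 * (A^5 * B^5) - B^10) * F = ((\<Prod>j<5. qpoch (z^j * s) (z^j * s)) * F) * E^5"
    unfolding poly by (simp only: mult_ac)
  also have "\<dots> = E^11"
    using qpoch_self_conjugates[OF s z x, folded E_def F_def] by (simp flip: power_add)
  finally have *: "(A^10 - 11 * (A^5 * B^5) - B^10) * F = E^11" .
  have AB5: "A^5 * B^5 = x * E^5 * F^5"
    unfolding power_mult_distrib[symmetric] AB by (simp add: power_mult_distrib x)
  have r: "x * (rr_theta1 x / rr_theta2 x)^5 = B^5 / A^5"
    by (simp add: A_def B_def x power_divide power_mult_distrib)
  have "inverse (B^5 / A^5) - 11 - B^5 / A^5 = (A^10 - 11 * (A^5 * B^5) - B^10) / (A^5 * B^5)"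
  proof -
    have "A^10 = A^5 * A^5" "B^10 = B^5 * B^5" by (simp_all flip: power_add)
    then show ?thesis using AB0 by (simp add: field_simps)
  qed
  also have "\<dots> = (E^11 / F) / (x * E^5 * F^5)"
  proof -
    have "A^10 - 11 * (A^5 * B^5) - B^10 = E^11 / F"
      using * EF0(2) by (simp add: eq_divide_eq)
    then show ?thesis by (simp add: AB5)
  qed
  also have "\<dots> = E^6 / (x * F^6)"
  proof -
    have "E^11 = E^6 * E^5" "F^6 = F * F^5" by (simp_all flip: power_add power_Suc)
    then show ?thesis using EF0 nx by (simp add: field_simps)
  qed
  finally show ?thesis unfolding r E_def F_def .
qed

section \<open>Convergence of the continued fraction\<close>

text \<open>At k = 0 the truncated subtraction 5 k - 3 is harmless, since it is multiplied by
  k.\<close>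

definition pent :: "nat \<Rightarrow> nat" where "pent k = k * (5 * k - 3) div 2"

lemma pent_Suc: "pent (Suc k) = pent k + 5 * k + 1"
proof (cases k)
  case (Suc m)
  have "Suc k * (5 * Suc k - 3) = k * (5 * k - 3) + 2 * (5 * k + 1)"
    by (simp add: Suc algebra_simps)
  then show ?thesis by (simp add: pent_def)
qed (simp add: pent_def)

lemma pent_0 [simp]: "pent 0 = 0" by (simp add: pent_def)

lemma pent_ge: "k \<le> pent k"
  by (induction k) (auto simp: pent_Suc)

lemma two_pent: "2 * int (pent k) = int k * (5 * int k - 3)"
  by (induction k) (auto simp: pent_Suc algebra_simps)

text \<open>Rogers' series: for a variable \<open>a\<close>, \<open>rogers2 q a / (a; q)\<^sub>\<infinity>\<close> satisfies \<open>F(a) = F(a q) + a F(a q\<^sup>2)\<close>, which is the recurrence of the continued fraction. The exponent \<open>pent k\<close> is \<open>k (5 k - 3) / 2\<close>.\<close>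

definition rogers_c :: "real \<Rightarrow> real \<Rightarrow> nat \<Rightarrow> real" where
  "rogers_c q a k = (\<Prod>i<k. (1 - a * q^i) / (1 - q * q^i))"

definition rogers_term1 :: "real \<Rightarrow> real \<Rightarrow> nat \<Rightarrow> real" where
  "rogers_term1 q a k = (-1)^k * a^(2 * k) * q^(pent k + k) * (1 - a * q^(2 * k)) * rogers_c q a k"

definition rogers_term2 :: "real \<Rightarrow> real \<Rightarrow> nat \<Rightarrow> real" where
  "rogers_term2 q a k = (-1)^k * a^(2 * k) * q^pent k * (1 - a^2 * q^(4 * k)) * rogers_c q a k"

text \<open>\<open>rogers1\<close> splits the second-order recurrence into two first-order ones: it
  turns out to be (1 - a) times \<open>rogers2\<close> at a q, so that its quotient by (a; q) is F(a
  q).\<close>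

definition rogers1 :: "real \<Rightarrow> real \<Rightarrow> real" where "rogers1 q a = suminf (rogers_term1 q a)"
definition rogers2 :: "real \<Rightarrow> real \<Rightarrow> real" where "rogers2 q a = suminf (rogers_term2 q a)"

context
  fixes q :: real
  assumes q: "0 < q" "q < 1"
begin

lemma q_power: "0 < q^k" "q^k \<le> 1" "q * q^k < 1"
proof -
  show "0 < q^k" "q^k \<le> 1" using q by (auto simp: power_le_one)
  then have "q * q^k \<le> q * 1" using q by (intro mult_left_mono) auto
  then show "q * q^k < 1" by (rule le_less_trans) (use q in simp)
qed

definition euler_q where "euler_q = qpoch q q"

lemma euler_q_pos: "euler_q > 0" and euler_q_le: "euler_q \<le> (\<Prod>k<n. 1 - q * q^k)"
proof -
  have lim: "(\<lambda>n. \<Prod>k<n. 1 - q * q^k) \<longlonglongrightarrow> euler_q"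
    unfolding euler_q_def using q by (intro qpoch_tendsto) auto
  have "decseq (\<lambda>n. \<Prod>k<n. 1 - q * q^k)"
  proof (rule decseq_SucI)
    have "0 \<le> (\<Prod>k<n. 1 - q * q^k)" "0 \<le> 1 - q * q^n" "1 - q * q^n \<le> 1" for n
      using q q_power less_imp_le[OF q_power(3)] by (auto intro!: prod_nonneg)
    then show "(\<Prod>k<Suc n. 1 - q * q^k) \<le> (\<Prod>k<n. 1 - q * q^k)" for n
      unfolding prod.lessThan_Suc by (rule mult_right_le_one_le)
  qed
  then show le: "euler_q \<le> (\<Prod>k<n. 1 - q * q^k)" for n
    using lim by (rule decseq_ge)
  have "euler_q \<ge> 0"
    using lim by (rule LIMSEQ_le_const) (use less_imp_le[OF q_power(3)] in \<open>auto intro!: exI[of _ 0] prod_nonneg\<close>)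
  moreover have "euler_q \<noteq> 0" unfolding euler_q_def using q by (intro qpoch_nonzero') auto
  ultimately show "euler_q > 0" by simp
qed

lemma rogers_c_bounds:
  assumes a: "0 \<le> a" "a \<le> 1"
  shows "0 \<le> rogers_c q a k" "rogers_c q a k \<le> 1 / euler_q"
proof -
  have b: "0 \<le> 1 - a * q^i" "1 - a * q^i \<le> 1" for i
    using a q_power[of i] mult_mono[of a 1 "q^i" 1] by auto
  show "0 \<le> rogers_c q a k"
    unfolding rogers_c_def using b less_imp_le[OF q_power(3)] by (intro prod_nonneg) (auto intro!: divide_nonneg_nonneg)
  have "rogers_c q a k = (\<Prod>i<k. 1 - a * q^i) / (\<Prod>i<k. 1 - q * q^i)"
    by (simp add: rogers_c_def prod_dividef)
  also have "\<dots> \<le> 1 / euler_q"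
    using b euler_q_pos euler_q_le[of k] by (intro frac_le prod_nonneg prod_le_1) auto
  finally show "rogers_c q a k \<le> 1 / euler_q" .
qed

lemma rogers_c_shift:
  shows "rogers_c q a k * (1 - a * q^k) = (1 - a) * rogers_c q (a * q) k"
    and "rogers_c q a (Suc k) * (1 - q * q^k) = (1 - a) * rogers_c q (a * q) k"
proof -
  have "(\<Prod>i<k. 1 - a * q^i) * (1 - a * q^k) = (\<Prod>i<Suc k. 1 - a * q^i)" by simp
  also have "\<dots> = (1 - a) * (\<Prod>i<k. 1 - a * q * q^i)"
    by (subst prod.lessThan_Suc_shift) (simp add: mult_ac)
  finally have p: "(\<Prod>i<k. 1 - a * q^i) * (1 - a * q^k) = (1 - a) * (\<Prod>i<k. 1 - a * q * q^i)" .
  show 1: "rogers_c q a k * (1 - a * q^k) = (1 - a) * rogers_c q (a * q) k"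
    by (simp only: rogers_c_def prod_dividef times_divide_eq_left times_divide_eq_right p)
  have "1 - q * q^k \<noteq> 0" using q_power(3)[of k] by simp
  then have "rogers_c q a (Suc k) * (1 - q * q^k) = rogers_c q a k * (1 - a * q^k)"
    by (simp add: rogers_c_def)
  then show "rogers_c q a (Suc k) * (1 - q * q^k) = (1 - a) * rogers_c q (a * q) k" using 1 by simp
qed

lemma summable_rogers_bound:
  fixes f :: "nat \<Rightarrow> real"
  assumes a: "0 \<le> a" "a \<le> 1" and "\<And>k. norm (f k) \<le> q^k * norm (rogers_c q a k)"
  shows "summable f"
proof (rule summable_comparison_test')
  show "summable (\<lambda>k. q^k * (1 / euler_q))"
    using q by (intro summable_mult2 summable_geometric) auto
  show "norm (f k) \<le> q^k * (1 / euler_q)" for k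
    by (rule order_trans[OF assms(3)], rule mult_left_mono) (use rogers_c_bounds[OF a, of k] q_power(1)[of k] in auto)
qed

lemma rogers_c_term_bound:
  assumes a: "0 \<le> a" "a \<le> 1" and e: "e \<ge> k" and c: "\<bar>c\<bar> \<le> 1"
  shows "norm ((-1)^k * a^(2 * k) * q^e * c * rogers_c q a' k) \<le> q^k * norm (rogers_c q a' k)"
proof -
  have "\<bar>a^(2 * k)\<bar> \<le> 1" using a by (simp add: power_le_one)
  moreover have "\<bar>q^e\<bar> \<le> q^k" using q e by (simp add: power_decreasing)
  ultimately have "\<bar>a^(2 * k)\<bar> * \<bar>q^e\<bar> * \<bar>c\<bar> \<le> 1 * q^k * 1"
    using c by (intro mult_mono) auto
  then have "\<bar>a^(2 * k)\<bar> * \<bar>q^e\<bar> * \<bar>c\<bar> * \<bar>rogers_c q a' k\<bar> \<le> q^k * \<bar>rogers_c q a' k\<bar>"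
    by (intro mult_right_mono) auto
  then show ?thesis by (simp add: abs_mult power_abs)
qed

lemma one_minus_bound: "0 \<le> a \<Longrightarrow> a \<le> 1 \<Longrightarrow> \<bar>1 - a^i * q^j\<bar> \<le> 1"
proof -
  assume "0 \<le> a" "a \<le> 1"
  then have "0 \<le> a^i * q^j" "a^i * q^j \<le> 1"
    using q_power[of j] by (auto simp: power_le_one intro!: mult_le_one)
  then show ?thesis by simp
qed

lemma rogers_term_bounds:
  assumes a: "0 \<le> a" "a \<le> 1"
  shows "norm (rogers_term1 q a k) \<le> q^k * norm (rogers_c q a k)" "norm (rogers_term2 q a k) \<le> q^k * norm (rogers_c q a k)"
proof -
  show "norm (rogers_term1 q a k) \<le> q^k * norm (rogers_c q a k)"
    unfolding rogers_term1_def by (rule rogers_c_term_bound[OF a]) (use one_minus_bound[OF a, of 1 "2 * k"] in simp_all)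
  show "norm (rogers_term2 q a k) \<le> q^k * norm (rogers_c q a k)"
    unfolding rogers_term2_def by (rule rogers_c_term_bound[OF a pent_ge one_minus_bound[OF a]])
qed

lemma rogers_term_summable:
  assumes a: "0 \<le> a" "a \<le> 1"
  shows "summable (rogers_term1 q a)" "summable (rogers_term2 q a)"
  by (rule summable_rogers_bound[OF a], rule rogers_term_bounds[OF a])+

text \<open>The factors split as q^k (1 - a q^(2k)) = q^(2k) (1 - a q^k) + q^k (1 - q^k) and 1 - a^2
  q^(4k) - q^k (1 - a q^(2k)) = a q^(3k) (1 - a q^k) + (1 - q^k). The part with 1 - q^k vanishes at
  k = 0 and cancels the last denominator of \<open>rogers_c\<close>, so its index can be lowered by
  one, after which it recombines with the other part.\<close>

lemma rogers_rec:
  assumes a: "0 \<le> a" "a \<le> 1"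
  shows "rogers1 q a = (1 - a) * rogers2 q (a * q)" "rogers2 q a - rogers1 q a = a * (1 - a) * rogers1 q (a * q)"
proof -
  have aq: "0 \<le> a * q" "a * q \<le> 1" using a q by (auto intro: mult_le_one)
  define c where "c = (\<lambda>k. (-1)^k * a^(2 * k) * q^pent k * rogers_c q (a * q) k)"
  have cb: "summable (\<lambda>k. c k * q^i k * d)" if "\<bar>d\<bar> \<le> 1" for i d
  proof (rule summable_rogers_bound[OF aq])
    fix k
    have "\<bar>q^i k * d\<bar> \<le> 1"
      unfolding abs_mult using that q_power[of "i k"] by (intro mult_le_one) auto
    from rogers_c_term_bound[OF a pent_ge[of k] this, where a' = "a * q"]
    show "norm (c k * q^i k * d) \<le> q^k * norm (rogers_c q (a * q) k)" by (simp add: c_def mult_ac)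
  qed
  have gen: "- (s * t * r) * (P * Q * q) * ((1 - a) * C) = (1 - a) * - (s * t * P * C * Q * (r * q))" for s t r P Q C :: real
    by (simp add: mult_ac)
  have a2: "\<bar>a^2\<bar> \<le> 1" using a by (simp add: power_le_one)
  have a2q: "\<bar>a^2 * q\<bar> \<le> 1" "\<bar>a\<bar> \<le> 1" using a a2 q by (auto simp: power_le_one intro!: mult_le_one)
  have key: "(\<lambda>k. (1 - a) * (c k * q^i k * e + (case k of 0 \<Rightarrow> 0 | Suc m \<Rightarrow> - (c m * q^j m * d))))
     sums ((1 - a) * suminf (\<lambda>k. c k * q^i k * e - c k * q^j k * d))" if "\<bar>d\<bar> \<le> 1" "\<bar>e\<bar> \<le> 1" for i j d e
  proof (rule sums_mult)
    let ?g = "\<lambda>k. case k of 0 \<Rightarrow> 0 | Suc m \<Rightarrow> - (c m * q^j m * d)"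
    have s: "summable (\<lambda>k. c k * q^j k * d)" by (rule cb[OF that(1)])
    have "(\<lambda>k. ?g (Suc k)) sums (- suminf (\<lambda>k. c k * q^j k * d))"
      using sums_minus[OF summable_sums[OF s]] by simp
    then have g: "?g sums (- suminf (\<lambda>k. c k * q^j k * d))"
      by (subst (asm) sums_Suc_iff) simp
    show "(\<lambda>k. c k * q^i k * e + ?g k) sums suminf (\<lambda>k. c k * q^i k * e - c k * q^j k * d)"
      using sums_add[OF summable_sums[OF cb[OF that(2), of i]] g] suminf_diff[OF cb[OF that(2), of i] s] by simp
  qed
  have "rogers_term1 q a k = (1 - a) * (c k * q^(2 * k) * 1 + (case k of 0 \<Rightarrow> 0 | Suc m \<Rightarrow> - (c m * q^(6 * m + 1) * (a^2 * q))))" for k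
  proof -
    define X where "X = (-1)^k * a^(2 * k) * q^pent k"
    have "q^(2 * k) = q^k * q^k" by (simp flip: power_add add: mult_2)
    then have "rogers_term1 q a k = X * (q^(2 * k) * (rogers_c q a k * (1 - a * q^k)) + q^k * (rogers_c q a k * (1 - q^k)))"
      unfolding rogers_term1_def X_def power_add[of q "pent k" k] by (simp add: algebra_simps)
    moreover have "X * (q^k * (rogers_c q a k * (1 - q^k))) = (1 - a) * (case k of 0 \<Rightarrow> 0 | Suc m \<Rightarrow> - (c m * q^(6 * m + 1) * (a^2 * q)))"
    proof (cases k)
      case (Suc m)
      have "q^k * (rogers_c q a k * (1 - q^k)) = q^k * ((1 - a) * rogers_c q (a * q) m)"
        using rogers_c_shift(2)[of a m] by (simp add: Suc)
      then have "X * (q^k * (rogers_c q a k * (1 - q^k))) =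
          - ((-1)^m * a^(2 * m) * a^2) * (q^pent k * q^k) * ((1 - a) * rogers_c q (a * q) m)"
        by (simp add: X_def Suc power2_eq_square)
      also have "q^pent k * q^k = q^(pent m + (6 * m + 1) + 1)"
        by (simp add: Suc pent_Suc add_ac flip: power_add)
      also have "\<dots> = q^pent m * q^(6 * m + 1) * q"
        by (simp only: power_add power_one_right)
      also have "- ((-1)^m * a^(2 * m) * a^2) * (q^pent m * q^(6 * m + 1) * q) * ((1 - a) * rogers_c q (a * q) m)
          = (1 - a) * - (c m * q^(6 * m + 1) * (a^2 * q))"
        unfolding c_def by (rule gen)
      finally show ?thesis by (simp only: Suc nat.case)
    qed simp
    moreover have "X * (q^(2 * k) * (rogers_c q a k * (1 - a * q^k))) = (1 - a) * (c k * q^(2 * k) * 1)"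
      unfolding rogers_c_shift(1) X_def c_def by (simp add: mult_ac)
    ultimately show ?thesis by (simp only: distrib_left)
  qed
  then have eq: "rogers_term1 q a = (\<lambda>k. (1 - a) * (c k * q^(2 * k) * 1 + (case k of 0 \<Rightarrow> 0 | Suc m \<Rightarrow> - (c m * q^(6 * m + 1) * (a^2 * q)))))"
    by (rule ext)
  have "rogers_term1 q a sums ((1 - a) * suminf (\<lambda>k. c k * q^(2 * k) * 1 - c k * q^(6 * k + 1) * (a^2 * q)))"
    unfolding eq by (rule key[OF a2q(1)]) simp
  moreover have "(\<lambda>k. c k * q^(2 * k) * 1 - c k * q^(6 * k + 1) * (a^2 * q)) = rogers_term2 q (a * q)"
  proof
    fix k
    have "q^(6 * k + 1) * q = q^(2 * k + (2 + 4 * k))" by simp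
    then have "q^(6 * k + 1) * q = q^(2 * k) * (q^2 * q^(4 * k))" by (simp only: power_add)
    then show "c k * q^(2 * k) * 1 - c k * q^(6 * k + 1) * (a^2 * q) = rogers_term2 q (a * q) k"
      unfolding rogers_term2_def c_def power_mult_distrib by (simp add: algebra_simps)
  qed
  ultimately show "rogers1 q a = (1 - a) * rogers2 q (a * q)"
    unfolding rogers1_def rogers2_def by (simp add: sums_iff)
  have "rogers_term2 q a k - rogers_term1 q a k = (1 - a) * (c k * q^(3 * k) * a + (case k of 0 \<Rightarrow> 0 | Suc m \<Rightarrow> - (c m * q^(5 * m) * (a^2 * q))))" for k
  proof -
    define X where "X = (-1)^k * a^(2 * k) * q^pent k"
    have "q^(4 * k) = q^(3 * k) * q^k" "q^(3 * k) = q^(2 * k) * q^k" by (simp_all flip: power_add)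
    then have "rogers_term2 q a k - rogers_term1 q a k = X * (q^(3 * k) * a * (rogers_c q a k * (1 - a * q^k)) + rogers_c q a k * (1 - q^k))"
      unfolding rogers_term1_def rogers_term2_def X_def power_add[of q "pent k" k] by (simp add: algebra_simps power2_eq_square)
    moreover have "X * (rogers_c q a k * (1 - q^k)) = (1 - a) * (case k of 0 \<Rightarrow> 0 | Suc m \<Rightarrow> - (c m * q^(5 * m) * (a^2 * q)))"
    proof (cases k)
      case (Suc m)
      have "rogers_c q a k * (1 - q^k) = (1 - a) * rogers_c q (a * q) m"
        using rogers_c_shift(2)[of a m] by (simp add: Suc)
      then have "X * (rogers_c q a k * (1 - q^k)) =
          - ((-1)^m * a^(2 * m) * a^2) * q^pent k * ((1 - a) * rogers_c q (a * q) m)"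
        by (simp add: X_def Suc power2_eq_square)
      also have "q^pent k = q^(pent m + 5 * m + 1)"
        by (simp add: Suc pent_Suc)
      also have "\<dots> = q^pent m * q^(5 * m) * q"
        by (simp only: power_add power_one_right)
      also have "- ((-1)^m * a^(2 * m) * a^2) * (q^pent m * q^(5 * m) * q) * ((1 - a) * rogers_c q (a * q) m)
          = (1 - a) * - (c m * q^(5 * m) * (a^2 * q))"
        unfolding c_def by (rule gen)
      finally show ?thesis by (simp only: Suc nat.case)
    qed simp
    moreover have "X * (q^(3 * k) * a * (rogers_c q a k * (1 - a * q^k))) = (1 - a) * (c k * q^(3 * k) * a)"
      unfolding rogers_c_shift(1) X_def c_def by (simp add: mult_ac)
    ultimately show ?thesis by (simp only: distrib_left)
  qed
  then have eq: "(\<lambda>k. rogers_term2 q a k - rogers_term1 q a k) = (\<lambda>k. (1 - a) * (c k * q^(3 * k) * a + (case k of 0 \<Rightarrow> 0 | Suc m \<Rightarrow> - (c m * q^(5 * m) * (a^2 * q)))))"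
    by (rule ext)
  have "(\<lambda>k. rogers_term2 q a k - rogers_term1 q a k) sums ((1 - a) * suminf (\<lambda>k. c k * q^(3 * k) * a - c k * q^(5 * k) * (a^2 * q)))"
    unfolding eq by (rule key[OF a2q])
  moreover have "(\<lambda>k. c k * q^(3 * k) * a - c k * q^(5 * k) * (a^2 * q)) = (\<lambda>k. a * rogers_term1 q (a * q) k)"
  proof
    fix k
    have "q^(5 * k) = q^(2 * k) * (q^k * q^(2 * k))" "q^(3 * k) = q^(2 * k) * q^k" by (simp_all flip: power_add)
    then show "c k * q^(3 * k) * a - c k * q^(5 * k) * (a^2 * q) = a * rogers_term1 q (a * q) k"
      unfolding rogers_term1_def c_def power_mult_distrib power_add[of q "pent k" k] by (simp add: algebra_simps power2_eq_square)
  qed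
  moreover have "(\<lambda>k. rogers_term2 q a k - rogers_term1 q a k) sums (rogers2 q a - rogers1 q a)"
    unfolding rogers1_def rogers2_def by (intro sums_diff summable_sums rogers_term_summable a)
  moreover have "suminf (\<lambda>k. a * rogers_term1 q (a * q) k) = a * rogers1 q (a * q)"
    unfolding rogers1_def by (intro suminf_mult rogers_term_summable aq)
  ultimately show "rogers2 q a - rogers1 q a = a * (1 - a) * rogers1 q (a * q)"
    by (simp add: sums_iff mult_ac)
qed

text \<open>As a = q^n tends to 0 every term with k > 0 disappears, under a bound that is geometric
  in k and uniform in n.\<close>

lemma rogers2_tendsto: "(\<lambda>n. rogers2 q (q^n)) \<longlonglongrightarrow> 1"
proof -
  have "(\<lambda>n. suminf (\<lambda>k. rogers_term2 q (q^n) k)) \<longlonglongrightarrow> suminf (\<lambda>k. if k = 0 then 1 else (0::real))"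
  proof (rule tannerys_theorem[THEN conjunct2, THEN conjunct2])
    have qn: "(\<lambda>n. q^n) \<longlonglongrightarrow> 0" using q by (intro LIMSEQ_realpow_zero) auto
    have lim: "(\<lambda>n. rogers_term2 q (q^n) k) \<longlonglongrightarrow>
      (-1)^k * 0^(2 * k) * q^pent k * (1 - 0\<^sup>2 * q^(4 * k)) * rogers_c q 0 k" for k
      unfolding rogers_term2_def rogers_c_def by (intro tendsto_intros qn) (use q_power in \<open>auto simp: less_imp_neq\<close>)
    have lim_eq: "(-1)^k * 0^(2 * k) * q^pent k * (1 - 0\<^sup>2 * q^(4 * k)) * rogers_c q 0 k = (if k = 0 then 1 else 0)" for k
      by (simp add: rogers_c_def)
    show "(\<lambda>n. rogers_term2 q (q^n) k) \<longlonglongrightarrow> (if k = 0 then 1 else 0)" for k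
      using lim[of k] unfolding lim_eq .
    have "norm (rogers_term2 q (q^n) k) \<le> q^k * (1 / euler_q)" for n k
    proof -
      have "0 \<le> q^n" "q^n \<le> 1" using q_power[of n] by auto
      note b = rogers_term_bounds(2)[OF this, of k] rogers_c_bounds[OF this, of k]
      show ?thesis
        by (rule order_trans[OF b(1)], rule mult_left_mono) (use b(2,3) q_power(1)[of k] in auto)
    qed
    then show "\<forall>\<^sub>F (k, n) in sequentially \<times>\<^sub>F sequentially. norm (rogers_term2 q (q^n) k) \<le> q^k * (1 / euler_q)"
      by (intro always_eventually) auto
    show "summable (\<lambda>k. q^k * (1 / euler_q))"
      using q by (intro summable_mult2 summable_geometric) auto
  qed simp
  moreover have "suminf (\<lambda>k. if k = 0 then 1 else (0::real)) = 1"
    using suminf_finite[of "{0}" "\<lambda>k. if k = 0 then 1 else (0::real)"] by simp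
  ultimately show ?thesis by (simp add: rogers2_def)
qed

text \<open>This is \<open>F(q\<^sup>n\<^sup>+\<^sup>1)\<close>, written without the factor \<open>(q\<^sup>n\<^sup>+\<^sup>1; q)\<^sub>\<infinity>\<close>.\<close>

definition rogers_seq :: "nat \<Rightarrow> real" where
  "rogers_seq n = rogers2 q (q^Suc n) * (\<Prod>k<n. 1 - q * q^k) / euler_q"

lemma rogers_seq_rec: "rogers_seq n = rogers_seq (Suc n) + q^Suc n * rogers_seq (Suc (Suc n))"
proof -
  define a where "a = q^Suc n"
  have a: "0 \<le> a" "a \<le> 1" "0 \<le> a * q" "a * q \<le> 1"
    using q_power(1)[of "Suc n"] q_power(2)[of "Suc n"] q_power(1)[of "Suc (Suc n)"] q_power(2)[of "Suc (Suc n)"]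
    by (auto simp: a_def mult_ac)
  have "rogers2 q a = rogers1 q a + a * (1 - a) * rogers1 q (a * q)" using rogers_rec(2)[OF a(1,2)] by simp
  also have "\<dots> = (1 - a) * rogers2 q (a * q) + a * ((1 - a) * (1 - a * q)) * rogers2 q (a * q * q)"
    unfolding rogers_rec(1)[OF a(1,2)] rogers_rec(1)[OF a(3,4)] by (simp add: mult_ac)
  finally have *: "rogers2 q a = \<dots>" .
  have e: "q^Suc (Suc n) = a * q" "q^Suc (Suc (Suc n)) = a * q * q" "q * q^n = a" "q * q^Suc n = a * q"
    by (simp_all add: a_def mult_ac)
  show ?thesis
    unfolding rogers_seq_def prod.lessThan_Suc e a_def[symmetric] * using euler_q_pos by (simp add: field_simps)
qed

lemma rogers_seq_tendsto: "rogers_seq \<longlonglongrightarrow> 1"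
proof -
  have "(\<lambda>n. \<Prod>k<n. 1 - q * q^k) \<longlonglongrightarrow> euler_q"
    unfolding euler_q_def using q by (intro qpoch_tendsto) auto
  then have "(\<lambda>n. rogers2 q (q^Suc n) * (\<Prod>k<n. 1 - q * q^k) / euler_q) \<longlonglongrightarrow> 1 * euler_q / euler_q"
    using euler_q_pos by (intro tendsto_intros LIMSEQ_Suc[OF rogers2_tendsto]) auto
  then show ?thesis using euler_q_pos unfolding rogers_seq_def by simp
qed

text \<open>Positivity holds far out because the limit is 1, and the recurrence with positive
  coefficients carries it back to small n.\<close>

lemma rogers_seq_pos: "rogers_seq n > 0"
proof -
  have "eventually (\<lambda>n. rogers_seq n > 0) sequentially"
    using rogers_seq_tendsto by (rule order_tendstoD) simp
  then obtain N where N: "\<And>n. n \<ge> N \<Longrightarrow> rogers_seq n > 0" unfolding eventually_sequentially by blast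
  have "rogers_seq m > 0" if "N \<le> m + j" for m j
    using that
  proof (induction j arbitrary: m)
    case (Suc j)
    then have "rogers_seq (Suc m) > 0" "rogers_seq (Suc (Suc m)) > 0" by auto
    then show ?case using rogers_seq_rec[of m] q_power(1)[of "Suc m"] by (simp add: add_pos_pos)
  qed (use N in auto)
  from this[of n N] show ?thesis by simp
qed

lemma rr_denom_ge_1: "rr_denom q m n \<ge> 1"
proof (induction n arbitrary: m)
  case (Suc n)
  have "0 \<le> q^m / rr_denom q (Suc m) n"
    using Suc[of "Suc m"] q_power(1)[of m] by (intro divide_nonneg_nonneg) auto
  then show ?case by simp
qed simp

text \<open>The quotients of consecutive \<open>rogers_seq\<close> obey the recursion of the
  truncated fractions. For arguments at least 1 the map x to 1 + q^(m+1) / x shrinks distances by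
  the factor q or better, so the error made by the innermost 1 is damped by q^n.\<close>

lemma rr_denom_error:
  "\<bar>rr_denom q (Suc m) n - rogers_seq m / rogers_seq (Suc m)\<bar> \<le> q^n * \<bar>1 - rogers_seq (m + n) / rogers_seq (Suc (m + n))\<bar>"
proof (induction n arbitrary: m)
  case (Suc n)
  define D g where "D = rr_denom q (Suc (Suc m)) n" and "g = rogers_seq (Suc m) / rogers_seq (Suc (Suc m))"
  have D: "D \<ge> 1" unfolding D_def by (rule rr_denom_ge_1)
  have g1: "rogers_seq j / rogers_seq (Suc j) = 1 + q^Suc j / (rogers_seq (Suc j) / rogers_seq (Suc (Suc j)))" for j
    using rogers_seq_rec[of j] rogers_seq_pos[of "Suc j"] rogers_seq_pos[of "Suc (Suc j)"] by (simp add: field_simps)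
  have g: "g \<ge> 1"
    unfolding g_def g1[of "Suc m"] using rogers_seq_pos q_power(1) by (simp add: less_imp_le del: power_Suc)
  have "rr_denom q (Suc m) (Suc n) - rogers_seq m / rogers_seq (Suc m) = q^Suc m * ((g - D) / (D * g))"
    unfolding g1[of m] g_def[symmetric] rr_denom.simps D_def[symmetric] using D g by (simp add: field_simps)
  then have "\<bar>rr_denom q (Suc m) (Suc n) - rogers_seq m / rogers_seq (Suc m)\<bar> = q^Suc m * (\<bar>D - g\<bar> / (D * g))"
    using D g q by (simp add: abs_mult abs_minus_commute)
  also have "\<dots> \<le> q * (\<bar>D - g\<bar> / 1)"
  proof (intro mult_mono divide_left_mono)
    show "q^Suc m \<le> q" using q q_power(2)[of m] by simp
    show "1 \<le> D * g" using mult_mono[of 1 D 1 g] D g by simp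
  qed (use D g q in auto)
  also have "\<bar>D - g\<bar> \<le> q^n * \<bar>1 - rogers_seq (Suc m + n) / rogers_seq (Suc (Suc m + n))\<bar>"
    unfolding D_def g_def by (rule Suc)
  finally show ?case using q by (simp add: mult_left_mono)
qed simp

lemma rr_denom_tendsto: "(\<lambda>n. rr_denom q 1 n) \<longlonglongrightarrow> rogers_seq 0 / rogers_seq 1"
proof -
  have "(\<lambda>n. q^n * \<bar>1 - rogers_seq n / rogers_seq (Suc n)\<bar>) \<longlonglongrightarrow> 0 * \<bar>1 - 1 / 1\<bar>"
    using q by (intro tendsto_intros rogers_seq_tendsto LIMSEQ_Suc[OF rogers_seq_tendsto] LIMSEQ_realpow_zero) auto
  then have lim: "(\<lambda>n. q^n * \<bar>1 - rogers_seq n / rogers_seq (Suc n)\<bar>) \<longlonglongrightarrow> 0" by simp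
  have "(\<lambda>n. rr_denom q 1 n - rogers_seq 0 / rogers_seq 1) \<longlonglongrightarrow> 0"
    by (rule Lim_null_comparison[OF _ lim]) (use rr_denom_error[of 0] in simp)
  then show ?thesis by (simp add: LIM_zero_iff)
qed

lemma RR_eq_rogers_seq: "RR q = q powr (1/5) * (rogers_seq 1 / rogers_seq 0)"
proof -
  have "(\<lambda>n. q powr (1/5) / rr_denom q 1 n) \<longlonglongrightarrow> q powr (1/5) / (rogers_seq 0 / rogers_seq 1)"
    using rogers_seq_pos by (intro tendsto_intros rr_denom_tendsto) (metis divide_pos_pos less_irrefl)
  then show ?thesis unfolding RR_def by (simp add: limI)
qed

section \<open>Rogers' series at a = q and the two theta series\<close>

lemma infsum_int_pairs:
  fixes f :: "int \<Rightarrow> real"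
  assumes f: "f summable_on UNIV"
  shows "(\<lambda>k. f (- int k) + f (int k + 1)) sums infsum f UNIV"
proof -
  have sA: "f summable_on A" for A by (rule summable_on_subset_banach[OF f]) auto
  have h: "(f has_sum infsum f A) A" for A by (rule has_sum_infsum[OF sA])
  have r1: "((\<lambda>k. f (- int k)) has_sum infsum f {..0}) UNIV"
    using h[of "{..0}"]
    by (subst has_sum_reindex_bij_witness[of UNIV "\<lambda>n. nat (- n)" "\<lambda>k. - int k" "{..0}" f]) auto
  have r2: "((\<lambda>k. f (int k + 1)) has_sum infsum f {1..}) UNIV"
    using h[of "{1..}"]
    by (subst has_sum_reindex_bij_witness[of UNIV "\<lambda>n. nat (n - 1)" "\<lambda>k. int k + 1" "{1..}" f]) auto
  have "infsum f {..0} + infsum f {1..} = infsum f ({..0} \<union> {1..})"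
    by (rule infsum_Un_disjoint[symmetric]) (use sA in auto)
  also have "{..0} \<union> {1..} = (UNIV :: int set)" by auto
  finally show ?thesis using sums_add[OF has_sum_imp_sums[OF r1] has_sum_imp_sums[OF r2]] by simp
qed

lemma rogers_c_self: "rogers_c q q k = 1"
proof -
  have "1 - q * q^i \<noteq> 0" for i using q_power(3)[of i] by simp
  then show ?thesis by (simp add: rogers_c_def)
qed

lemma rterm_neg_powers:
  assumes "2 * int e = int c * (n * (n + 1)) + int d * (n * (n - 1))"
  shows "rterm (- (q^c)) (- (q^d)) n = (- 1) powi n * q^e"
proof -
  define s t where "s = n * (n + 1) div 2" and "t = n * (n - 1) div 2"
  have "2 * int e = 2 * (int c * s + int d * t)"
    using assms two_tri[of n] unfolding s_def t_def by (simp add: algebra_simps)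
  then have "int c * s + int d * t = int e" by simp
  then show ?thesis using rterm_eq[of "-1" q c d n] by (simp add: s_def t_def)
qed

lemma rogers_seq_0: "rogers_seq 0 = rr_theta2 q / euler_q"
proof -
  have s: "rterm (- (q^2)) (- (q^3)) summable_on UNIV"
  proof (rule rterm_summable)
    have "- (q^2) * - (q^3) = q^5" by (simp flip: power_add)
    then show "norm (- (q^2) * - (q^3)) < 1" using q by (simp add: power_less_one_iff)
  qed
  \<comment> \<open>The indices -k and k + 1 of the bilateral series give the two parts of the k-th
    Rogers term, in which \<open>rogers_c q q k\<close> is 1.\<close>
  have "rterm (- (q^2)) (- (q^3)) (- int k) + rterm (- (q^2)) (- (q^3)) (int k + 1) = rogers_term2 q q k" for k
  proof -
    have 1: "rterm (- (q^2)) (- (q^3)) (- int k) = (- 1) powi (- int k) * q^(pent k + 2 * k)"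
      by (rule rterm_neg_powers) (use two_pent[of k] in \<open>simp add: algebra_simps\<close>)
    have 2: "rterm (- (q^2)) (- (q^3)) (int k + 1) = (- 1) powi (int k + 1) * q^(pent k + 2 * k + (4 * k + 2))"
      by (rule rterm_neg_powers) (use two_pent[of k] in \<open>simp add: algebra_simps\<close>)
    have 3: "(- 1 :: real) powi (- int k) = (- 1)^k" "(- 1 :: real) powi (int k + 1) = - ((- 1)^k)"
      by (simp_all add: power_int_minus power_int_add flip: power_inverse)
    show ?thesis
      unfolding 1 2 3 rogers_term2_def rogers_c_self power_add[of q "pent k + 2 * k"] power_add[of q "pent k" "2 * k"] power_add[of q "4 * k" 2]
      by (simp add: algebra_simps)
  qed
  then have "rogers_term2 q q sums rr_theta2 q"
    using infsum_int_pairs[OF s] by (simp add: rr_theta2_def)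
  then have "rogers2 q q = rr_theta2 q" unfolding rogers2_def by (rule sums_unique[symmetric])
  then show ?thesis by (simp add: rogers_seq_def)
qed

text \<open>The value at a = q^2 is reached from \<open>rogers1 q q\<close>: the factor 1 - q
  between the two is exactly the finite product contained in \<open>rogers_seq 1\<close>.\<close>

lemma rogers_seq_1: "rogers_seq 1 = rr_theta1 q / euler_q"
proof -
  have s: "rterm (- q) (- (q^4)) summable_on UNIV"
  proof (rule rterm_summable)
    have "- q * - (q^4) = q^5" by (simp flip: power_Suc)
    then show "norm (- q * - (q^4)) < 1" using q by (simp add: power_less_one_iff)
  qed
  have "rterm (- q) (- (q^4)) (- int k) + rterm (- q) (- (q^4)) (int k + 1) = rogers_term1 q q k" for k
  proof -
    have 1: "rterm (- (q^1)) (- (q^4)) (- int k) = (- 1) powi (- int k) * q^(pent k + 3 * k)"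
      by (rule rterm_neg_powers) (use two_pent[of k] in \<open>simp add: algebra_simps\<close>)
    have 2: "rterm (- (q^1)) (- (q^4)) (int k + 1) = (- 1) powi (int k + 1) * q^(pent k + 3 * k + (2 * k + 1))"
      by (rule rterm_neg_powers) (use two_pent[of k] in \<open>simp add: algebra_simps\<close>)
    have 3: "(- 1 :: real) powi (- int k) = (- 1)^k" "(- 1 :: real) powi (int k + 1) = - ((- 1)^k)"
      by (simp_all add: power_int_minus power_int_add flip: power_inverse)
    have 4: "q^(3 * k) = q^(2 * k) * q^k" by (simp flip: power_add)
    show ?thesis
      unfolding 1[unfolded power_one_right] 2[unfolded power_one_right] 3 rogers_term1_def rogers_c_self power_add[of q "pent k + 3 * k"]
        power_add[of q "pent k" "3 * k"] power_add[of q "2 * k" 1] power_add[of q "pent k" k] 4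
      by (simp add: algebra_simps)
  qed
  then have "rogers_term1 q q sums rr_theta1 q"
    using infsum_int_pairs[OF s] by (simp add: rr_theta1_def)
  then have "rogers1 q q = rr_theta1 q" unfolding rogers1_def by (rule sums_unique[symmetric])
  moreover have "rogers1 q q = (1 - q) * rogers2 q (q * q)" using rogers_rec(1)[of q] q by simp
  ultimately show ?thesis by (simp add: rogers_seq_def power2_eq_square mult.commute)
qed

lemma RR_eq: "RR q = q powr (1/5) * (rr_theta1 q / rr_theta2 q)"
  unfolding RR_eq_rogers_seq rogers_seq_0 rogers_seq_1 using euler_q_pos by simp

end

section \<open>The arithmetic-geometric mean\<close>

text \<open>Gauss's form of the complete integral, homogeneous of degree -1 and invariant under a
  step of the arithmetic-geometric mean. K(x) is its value at 1 and sqrt (1 - x^2), so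
  \<open>gauss_int 1 k\<close> is K' at the modulus k.\<close>

definition gauss_int :: "real \<Rightarrow> real \<Rightarrow> real" where
  "gauss_int a b = integral {0..pi/2} (\<lambda>t. 1 / sqrt (a^2 * cos t^2 + b^2 * sin t^2))"

lemma gauss_integrand_pos:
  fixes a b t :: real
  assumes "a > 0" "b > 0"
  shows "a^2 * cos t^2 + b^2 * sin t^2 > 0"
proof (cases "sin t = 0")
  case True
  then have "cos t^2 = 1" using sin_cos_squared_add[of t] by simp
  then show ?thesis using assms True by simp
next
  case False
  then have "b^2 * sin t^2 > 0" using assms by simp
  then show ?thesis by (simp add: add_nonneg_pos)
qed

lemma gauss_integrand_continuous:
  fixes a b :: real
  assumes "a > 0" "b > 0"
  shows "continuous_on A (\<lambda>t. 1 / sqrt (a^2 * cos t^2 + b^2 * sin t^2))"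
  by (intro continuous_intros) (use gauss_integrand_pos[OF assms] in \<open>auto simp: less_imp_neq[symmetric]\<close>)

lemma gauss_integrand_integrable:
  assumes "a > 0" "b > 0"
  shows "(\<lambda>t. 1 / sqrt (a^2 * cos t^2 + b^2 * sin t^2)) integrable_on {c..d}"
  by (rule integrable_continuous_interval[OF gauss_integrand_continuous[OF assms]])

lemma gauss_int_scale:
  assumes "c > 0" "a > 0" "b > 0"
  shows "gauss_int (c * a) (c * b) = gauss_int a b / c"
proof -
  have "1 / sqrt ((c * a)\<^sup>2 * cos t^2 + (c * b)\<^sup>2 * sin t^2) = (1 / c) * (1 / sqrt (a^2 * cos t^2 + b^2 * sin t^2))" for t
  proof -
    have "(c * a)\<^sup>2 * cos t^2 + (c * b)\<^sup>2 * sin t^2 = c^2 * (a^2 * cos t^2 + b^2 * sin t^2)"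
      by (simp add: power_mult_distrib algebra_simps)
    then show ?thesis using assms(1) by (simp add: real_sqrt_mult)
  qed
  then show ?thesis unfolding gauss_int_def by (simp only: integral_mult_right) simp
qed

text \<open>Landen's substitution \<open>tan (\<psi> - t) = (b / a) tan t\<close>, written as \<open>\<psi> = 2 t - arctan (S t / D t)\<close> so that it is smooth up to \<open>t = \<pi> / 2\<close>.\<close>

lemma gauss_int_agm:
  assumes a: "a > 0" and b: "b > 0"
  shows "gauss_int a b = gauss_int ((a + b) / 2) (sqrt (a * b))"
proof -
  define h where "h = (\<lambda>t. 1 / sqrt (((a + b) / 2)\<^sup>2 * cos t^2 + sqrt (a * b)^2 * sin t^2))"
  define D S R where "D = (\<lambda>t. a * cos t^2 + b * sin t^2)" and "S = (\<lambda>t. (a - b) * (sin t * cos t))"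
    and "R = (\<lambda>t. sqrt (a^2 * cos t^2 + b^2 * sin t^2))"
  define g where "g = (\<lambda>t. 2 * t - arctan (S t / D t))"
  have ab: "(a + b) / 2 > 0" "sqrt (a * b) > 0" using a b by auto
  have hc: "continuous_on A h" for A unfolding h_def by (rule gauss_integrand_continuous[OF ab])
  have D: "D t > 0" for t
    using gauss_integrand_pos[of "sqrt a" "sqrt b" t] a b by (simp add: D_def)
  have R: "R t > 0" for t unfolding R_def using gauss_integrand_pos[OF a b, of t] by simp
  have sc: "cos t^2 = 1 - sin t^2" for t :: real by (simp add: cos_squared_eq)
  have R2: "R t^2 = a^2 * cos t^2 + b^2 * sin t^2" for t
    unfolding R_def using gauss_integrand_pos[OF a b, of t] by (simp add: less_imp_le)
  \<comment> \<open>Hence \<open>arctan (S t / D t)\<close> is the angle with cosine D / R and sine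
    S / R, which makes cos (g t) and sin (g t) algebraic in sin t, cos t and R t.\<close>
  have DS: "D t^2 + S t^2 = R t^2" for t
    unfolding R2 D_def S_def power_mult_distrib sc by (simp add: algebra_simps power2_eq_square)
  have sq: "sqrt (1 + (S t / D t)\<^sup>2) = R t / D t" for t
  proof -
    have "1 + (S t / D t)\<^sup>2 = (D t^2 + S t^2) / D t^2"
      using D[of t] by (simp add: field_simps)
    also have "\<dots> = (R t / D t)\<^sup>2" unfolding DS by (simp add: power_divide)
    finally show ?thesis using D[of t] R[of t] by simp
  qed
  have ca: "cos (arctan (S t / D t)) = D t / R t" and sa: "sin (arctan (S t / D t)) = S t / R t" for t
    unfolding cos_arctan sin_arctan sq using D[of t] by simp_all
  have cg: "cos (g t) = (a * cos t^2 - b * sin t^2) / R t" for t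
  proof -
    have "cos (g t) = ((cos t^2 - sin t^2) * D t + 2 * sin t * cos t * S t) / R t"
      unfolding g_def cos_diff ca sa cos_double sin_double by (simp add: add_divide_distrib)
    also have "(cos t^2 - sin t^2) * D t + 2 * sin t * cos t * S t =
        (cos t^2 - sin t^2) * (a * cos t^2 + b * sin t^2) + 2 * (a - b) * (sin t^2 * cos t^2)"
      by (simp add: D_def S_def power2_eq_square)
    also have "\<dots> = a * cos t^2 - b * sin t^2"
      unfolding sc by (simp add: algebra_simps power2_eq_square)
    finally show ?thesis .
  qed
  have sg: "sin (g t) = (a + b) * (sin t * cos t) / R t" for t
  proof -
    have "sin (g t) = (2 * sin t * cos t * D t - (cos t^2 - sin t^2) * S t) / R t"
      unfolding g_def sin_diff ca sa cos_double sin_double by (simp add: diff_divide_distrib)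
    also have "2 * sin t * cos t * D t - (cos t^2 - sin t^2) * S t =
       (sin t * cos t) * (2 * (a * cos t^2 + b * sin t^2) - (cos t^2 - sin t^2) * (a - b))"
      by (simp add: D_def S_def algebra_simps)
    also have "2 * (a * cos t^2 + b * sin t^2) - (cos t^2 - sin t^2) * (a - b) = a + b"
      unfolding sc by (simp add: algebra_simps)
    finally show ?thesis by (simp add: mult_ac)
  qed
  have hg: "h (g t) = 2 * R t / ((a + b) * D t)" for t
  proof -
    have "((a + b) / 2)\<^sup>2 * (a * cos t^2 - b * sin t^2)\<^sup>2 + a * b * ((a + b) * (sin t * cos t))\<^sup>2
        = ((a + b) / 2)\<^sup>2 * ((a * cos t^2 - b * sin t^2)\<^sup>2 + 4 * (a * cos t^2) * (b * sin t^2))"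
      by (simp add: power2_eq_square algebra_simps)
    also have "\<dots> = ((a + b) / 2 * D t)\<^sup>2"
      by (simp add: D_def power2_eq_square algebra_simps)
    finally have e: "((a + b) / 2)\<^sup>2 * (a * cos t^2 - b * sin t^2)\<^sup>2 + a * b * ((a + b) * (sin t * cos t))\<^sup>2 = ((a + b) / 2 * D t)\<^sup>2" .
    have "((a + b) / 2)\<^sup>2 * (cos (g t))\<^sup>2 + sqrt (a * b)^2 * (sin (g t))\<^sup>2 =
        (((a + b) / 2)\<^sup>2 * (a * cos t^2 - b * sin t^2)\<^sup>2 + a * b * ((a + b) * (sin t * cos t))\<^sup>2) / R t^2"
      unfolding cg sg using a b by (simp only: power_divide add_divide_distrib times_divide_eq_right) simp
    also have "\<dots> = ((a + b) / 2 * D t / R t)\<^sup>2"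
      unfolding e by (simp only: power_divide)
    finally have "((a + b) / 2)\<^sup>2 * (cos (g t))\<^sup>2 + sqrt (a * b)^2 * (sin (g t))\<^sup>2 = ((a + b) / 2 * D t / R t)\<^sup>2" .
    then have "h (g t) = 1 / ((a + b) / 2 * D t / R t)"
      unfolding h_def using D[of t] R[of t] a b by simp
    then show ?thesis by simp
  qed
  have g': "(g has_real_derivative (a + b) * D t / R t^2) (at t within A)" for t A
  proof -
    have dS: "(S has_real_derivative (a - b) * (cos t^2 - sin t^2)) (at t within A)"
      unfolding S_def by (auto intro!: derivative_eq_intros simp: power2_eq_square algebra_simps)
    have dD: "(D has_real_derivative - 2 * (a - b) * (sin t * cos t)) (at t within A)"
      unfolding D_def by (auto intro!: derivative_eq_intros simp: power2_eq_square algebra_simps)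
    define N where "N = (a - b) * (cos t^2 - sin t^2) * D t - S t * (- 2 * (a - b) * (sin t * cos t))"
    have "(g has_real_derivative 2 - N / (D t * D t) * inverse (1 + (S t / D t)\<^sup>2)) (at t within A)"
      unfolding g_def N_def using D[of t]
      by (auto intro!: derivative_eq_intros dS dD DERIV_arctan simp: field_simps)
    also have "inverse (1 + (S t / D t)\<^sup>2) = D t^2 / R t^2"
      using D[of t] R[of t] by (simp flip: DS add: field_simps)
    also have "N / (D t * D t) * (D t^2 / R t^2) = N / R t^2"
      using D[of t] by (simp add: power2_eq_square)
    also have "2 - N / R t^2 = (2 * R t^2 - N) / R t^2"
      using R[of t] by (simp add: field_simps)
    also have "2 * R t^2 - N = (a + b) * D t"
    proof -
      have "N = (a - b) * ((cos t^2 - sin t^2) * (a * cos t^2 + b * sin t^2) + 2 * (a - b) * (sin t^2 * cos t^2))"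
        unfolding N_def D_def S_def by (simp add: power2_eq_square algebra_simps)
      also have "\<dots> = (a - b) * (a * cos t^2 - b * sin t^2)"
        unfolding sc by (simp add: algebra_simps power2_eq_square)
      finally show ?thesis unfolding R2 D_def sc by (simp add: algebra_simps power2_eq_square)
    qed
    finally show ?thesis .
  qed
  \<comment> \<open>The substitution stretches [0, pi/2] to [0, pi]; the symmetry of
    \<open>h\<close> about pi/2 halves the new interval at the end.\<close>
  have g0: "g 0 = 0" "g (pi / 2) = pi" by (simp_all add: g_def S_def)
  have "((\<lambda>t. ((a + b) * D t / R t^2) *\<^sub>R h (g t)) has_integral (integral {g 0..g (pi/2)} h)) {0..pi/2}"
  proof (rule has_integral_substitution[where c = "- pi" and d = "2 * pi"])
    show "g ` {0..pi/2} \<subseteq> {- pi..2 * pi}"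
    proof safe
      fix t :: real assume "t \<in> {0..pi/2}"
      then show "g t \<in> {- pi..2 * pi}"
        unfolding g_def using arctan_bounded[of "S t / D t"] by auto
    qed
  qed (use g' hc g0 in auto)
  moreover have "((a + b) * D t / R t^2) *\<^sub>R h (g t) = 2 * (1 / R t)" for t
  proof -
    have "(c / R t^2) *\<^sub>R (2 * R t / c) = 2 * (1 / R t)" if "c \<noteq> 0" for c
      using that R[of t] by (simp add: power2_eq_square)
    from this[of "(a + b) * D t"] show ?thesis unfolding hg using a b D[of t] by simp
  qed
  ultimately have "((\<lambda>t. 2 * (1 / R t)) has_integral (integral {0..pi} h)) {0..pi/2}"
    by (simp add: g0)
  moreover have "((\<lambda>t. 2 * (1 / R t)) has_integral 2 * gauss_int a b) {0..pi/2}"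
    unfolding gauss_int_def R_def using gauss_integrand_integrable[OF a b] by (intro has_integral_mult_right integrable_integral)
  ultimately have 1: "2 * gauss_int a b = integral {0..pi} h"
    by (rule has_integral_unique[rotated])
  have hint: "h integrable_on {c..d}" for c d unfolding h_def by (rule gauss_integrand_integrable[OF ab])
  have "((\<lambda>t. 1 *\<^sub>R h (t + pi)) has_integral (integral {- (pi/2) + pi..0 + pi} h)) {- (pi/2)..0}"
    by (rule has_integral_substitution[where c = 0 and d = pi]) (auto intro!: derivative_eq_intros hc)
  then have "integral {- (pi/2)..0} (\<lambda>t. h (- t)) = integral {pi/2..pi} h"
    by (simp add: h_def integral_unique)
  moreover have "integral {- (pi/2)..0} (\<lambda>t. h (- t)) = integral {0..pi/2} h"
    using Henstock_Kurzweil_Integration.integral_reflect_real[of "pi/2" 0 h] by simp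
  ultimately have "integral {0..pi} h = 2 * integral {0..pi/2} h"
    using Henstock_Kurzweil_Integration.integral_combine[of 0 "pi/2" pi h] hint by simp
  then show ?thesis using 1 by (simp add: gauss_int_def h_def)
qed

lemma sum_squares_eq_1_less_1:
  fixes x y :: real
  assumes "0 < x" "0 < y" "x^2 + y^2 = 1"
  shows "x < 1" "y < 1"
proof -
  have "0 < x^2" "0 < y^2" by (rule zero_less_power, rule assms)+
  then have "x^2 < 1^2" "y^2 < 1^2" using assms(3) unfolding power_one by linarith+
  then show "x < 1" "y < 1" by (auto intro: power_less_imp_less_base[of _ 2 1])
qed

text \<open>The means of 1 + k' and 1 - k' are 1 and k; for the second identity the step is applied
  to 1 and k'. Homogeneity normalizes the first argument to 1.\<close>

lemma gauss_int_landen: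
  assumes k: "0 < k" "0 < kp" "k^2 + kp^2 = 1"
  shows "gauss_int 1 ((1 - kp) / (1 + kp)) = (1 + kp) * gauss_int 1 k"
    and "gauss_int 1 (2 * sqrt kp / (1 + kp)) = (1 + kp) / 2 * gauss_int 1 kp"
proof -
  have kp1: "kp < 1" by (rule sum_squares_eq_1_less_1(2)[OF k])
  have "gauss_int (1 + kp) (1 - kp) = gauss_int 1 k"
  proof -
    have "(1 + kp) * (1 - kp) = k^2" using k(3) by (simp add: algebra_simps power2_eq_square)
    then show ?thesis using gauss_int_agm[of "1 + kp" "1 - kp"] k kp1 by simp
  qed
  moreover have "gauss_int (1 + kp) (1 - kp) = gauss_int 1 ((1 - kp) / (1 + kp)) / (1 + kp)"
    using gauss_int_scale[of "1 + kp" 1 "(1 - kp) / (1 + kp)"] k kp1 by simp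
  ultimately show "gauss_int 1 ((1 - kp) / (1 + kp)) = (1 + kp) * gauss_int 1 k"
    using k by (simp add: field_simps)
  have "gauss_int 1 kp = gauss_int ((1 + kp) / 2) (sqrt kp)" using gauss_int_agm[of 1 kp] k by simp
  also have "\<dots> = gauss_int ((1 + kp) / 2 * 1) ((1 + kp) / 2 * (2 * sqrt kp / (1 + kp)))" using k by simp
  also have "\<dots> = gauss_int 1 (2 * sqrt kp / (1 + kp)) / ((1 + kp) / 2)" using k by (intro gauss_int_scale) auto
  finally show "gauss_int 1 (2 * sqrt kp / (1 + kp)) = (1 + kp) / 2 * gauss_int 1 kp" using k by (simp add: field_simps)
qed

lemma gauss_int_bounds:
  assumes k: "0 < k" "k \<le> 1"
  shows "pi / 2 \<le> gauss_int 1 k" "gauss_int 1 k \<le> pi / (2 * k)"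
proof -
  have b: "k^2 \<le> 1\<^sup>2 * cos t^2 + k^2 * sin t^2" "1\<^sup>2 * cos t^2 + k^2 * sin t^2 \<le> 1" for t :: real
  proof -
    have "k^2 \<le> 1" using k by (simp add: power_le_one)
    then have "k^2 * sin t^2 \<le> 1 * sin t^2" "k^2 * cos t^2 \<le> 1 * cos t^2" by (intro mult_right_mono; simp)+
    moreover have "k^2 = k^2 * cos t^2 + k^2 * sin t^2" by (simp flip: distrib_left)
    ultimately show "k^2 \<le> 1\<^sup>2 * cos t^2 + k^2 * sin t^2" "1\<^sup>2 * cos t^2 + k^2 * sin t^2 \<le> 1"
      using sin_cos_squared_add[of t] by (simp_all, linarith+)
  qed
  have int: "(\<lambda>t. 1 / sqrt (1\<^sup>2 * cos t^2 + k^2 * sin t^2)) integrable_on {0..pi/2}"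
    using k by (intro gauss_integrand_integrable) auto
  have "integral {0..pi/2} (\<lambda>t::real. 1) \<le> gauss_int 1 k"
    unfolding gauss_int_def
  proof (rule integral_le[OF _ int])
    fix t :: real
    show "1 \<le> 1 / sqrt (1\<^sup>2 * cos t^2 + k^2 * sin t^2)"
      using b(2)[of t] gauss_integrand_pos[of 1 k t] k by (simp add: real_sqrt_le_1_iff)
  qed auto
  then show "pi / 2 \<le> gauss_int 1 k" by simp
  have "gauss_int 1 k \<le> integral {0..pi/2} (\<lambda>t::real. 1 / k)"
    unfolding gauss_int_def
  proof (rule integral_le[OF int])
    fix t :: real
    have "k \<le> sqrt (1\<^sup>2 * cos t^2 + k^2 * sin t^2)"
      using b(1)[of t] k by (intro real_le_rsqrt) auto
    then show "1 / sqrt (1\<^sup>2 * cos t^2 + k^2 * sin t^2) \<le> 1 / k"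
      using k gauss_integrand_pos[of 1 k t] by (intro divide_left_mono mult_pos_pos) auto
  qed auto
  then show "gauss_int 1 k \<le> pi / (2 * k)" by simp
qed

text \<open>The function sin t / sqrt (c^2 cos^2 t + k^2) has the primitive -arsinh (c cos t / k) /
  c. The lower bound takes c = 1. The upper one takes c = m, where the denominator is that of the
  integral itself; replacing the numerator 1 by sin t then costs at most pi / 2, because 1 - sin t
  \<le> cos t.\<close>

lemma gauss_int_log_bounds:
  assumes k: "0 < k" "k < 1"
  shows "ln (1 / k) \<le> gauss_int 1 k" "gauss_int 1 k \<le> pi / 2 + (ln (1 / k) + ln 3) / sqrt (1 - k^2)"
proof -
  define m where "m = sqrt (1 - k^2)"
  have k2: "k^2 < 1" using k by (simp add: power_less_one_iff)
  have m: "0 < m" "m \<le> 1" "m^2 = 1 - k^2" using k2 k by (auto simp: m_def)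
  define f where "f = (\<lambda>t. 1 / sqrt (1\<^sup>2 * cos t^2 + k^2 * sin t^2))"
  have fint: "f integrable_on {c..d}" for c d unfolding f_def using k by (intro gauss_integrand_integrable) auto
  have prim: "((\<lambda>t. sin t / sqrt ((c * cos t)\<^sup>2 + k^2)) has_integral arsinh (c / k) / c) {0..pi/2}"
    if c: "c > 0" for c
  proof -
    have "((\<lambda>t. sin t / sqrt ((c * cos t)\<^sup>2 + k^2)) has_integral
        - (arsinh (c * cos (pi/2) / k) / c) - (- (arsinh (c * cos 0 / k) / c))) {0..pi/2}"
    proof (rule fundamental_theorem_of_calculus)
      fix t :: real
      have "sqrt ((c * cos t / k)\<^sup>2 + 1) = sqrt ((c * cos t)\<^sup>2 + k^2) / k"
      proof -
        have "(c * cos t / k)\<^sup>2 + 1 = ((c * cos t)\<^sup>2 + k^2) / k^2"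
          using k by (simp add: field_simps)
        then show ?thesis using k by (simp add: real_sqrt_divide)
      qed
      moreover have "(c * cos t)\<^sup>2 + k^2 > 0" using k by (simp add: add_nonneg_pos)
      ultimately have "((\<lambda>t. - (arsinh (c * cos t / k) / c)) has_real_derivative sin t / sqrt ((c * cos t)\<^sup>2 + k^2)) (at t within {0..pi/2})"
      proof -
        assume *: "sqrt ((c * cos t / k)\<^sup>2 + 1) = sqrt ((c * cos t)\<^sup>2 + k^2) / k" and **: "(c * cos t)\<^sup>2 + k^2 > 0"
        have "((\<lambda>t. c * cos t / k) has_real_derivative - (c * sin t / k)) (at t within {0..pi/2})"
          using k by (auto intro!: derivative_eq_intros)
        from DERIV_chain2[OF arsinh_real_has_field_derivative this]
        have "((\<lambda>t. arsinh (c * cos t / k)) has_real_derivative 1 / sqrt ((c * cos t / k)\<^sup>2 + 1) * - (c * sin t / k)) (at t within {0..pi/2})" .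
        from DERIV_minus[OF DERIV_cdivide[OF this, of c]] show ?thesis
          unfolding * using c k ** by simp
      qed
      then show "((\<lambda>t. - (arsinh (c * cos t / k) / c)) has_vector_derivative sin t / sqrt ((c * cos t)\<^sup>2 + k^2)) (at t within {0..pi/2})"
        by (simp add: has_real_derivative_iff_has_vector_derivative)
    qed auto
    then show ?thesis by simp
  qed
  have D: "(m * cos t)\<^sup>2 + k^2 = 1\<^sup>2 * cos t^2 + k^2 * sin t^2" for t
    unfolding power_mult_distrib m sin_squared_eq by (simp add: algebra_simps)
  have pos: "1\<^sup>2 * cos t^2 + k^2 * sin t^2 > 0" for t using k by (intro gauss_integrand_pos) auto
  have ars: "arsinh (1 / k) = ln (1 / k + sqrt (1 / k^2 + 1))"
    by (simp add: arsinh_real_def power_divide)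
  have "arsinh (1 / k) \<le> gauss_int 1 k"
    unfolding gauss_int_def f_def[symmetric]
  proof (rule has_integral_le[OF _ integrable_integral[OF fint]])
    show "((\<lambda>t. sin t / sqrt ((1 * cos t)\<^sup>2 + k^2)) has_integral arsinh (1 / k)) {0..pi/2}"
      using prim[of 1] by simp
    fix t :: real assume t: "t \<in> {0..pi/2}"
    have "k^2 * sin t^2 \<le> k\<^sup>2 * 1" by (intro mult_left_mono) (simp_all add: abs_square_le_1)
    then have "sqrt (1\<^sup>2 * cos t^2 + k^2 * sin t^2) \<le> sqrt ((1 * cos t)\<^sup>2 + k^2)" by simp
    then have "sin t / sqrt ((1 * cos t)\<^sup>2 + k^2) \<le> 1 / sqrt (1\<^sup>2 * cos t^2 + k^2 * sin t^2)"
      using pos[of t] by (intro frac_le) auto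
    then show "sin t / sqrt ((1 * cos t)\<^sup>2 + k^2) \<le> f t" unfolding f_def .
  qed
  moreover have "ln (1 / k) \<le> arsinh (1 / k)"
    unfolding ars using k by (subst ln_le_cancel_iff) (auto intro: add_pos_nonneg)
  ultimately show "ln (1 / k) \<le> gauss_int 1 k" by simp
  have arle: "arsinh (1 / k) \<le> ln (1 / k) + ln 3"
  proof -
    have "1 \<le> 1 / k^2" using k k2 by simp
    moreover have "(2 / k)\<^sup>2 = 4 * (1 / k^2)" by (simp add: power_divide)
    ultimately have "1 / k^2 + 1 \<le> (2 / k)\<^sup>2" by linarith
    then have "sqrt (1 / k^2 + 1) \<le> 2 / k" using k by (intro real_le_lsqrt) auto
    then have "1 / k + sqrt (1 / k^2 + 1) \<le> 1 / k * 3" by simp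
    then have "arsinh (1 / k) \<le> ln (1 / k * 3)"
      unfolding ars using k by (subst ln_le_cancel_iff) (auto intro: add_pos_nonneg)
    also have "\<dots> = ln (1 / k) + ln 3" using k by (subst ln_mult) auto
    finally show ?thesis .
  qed
  have "gauss_int 1 k \<le> pi / 2 + arsinh (m / k) / m"
    unfolding gauss_int_def f_def[symmetric]
  proof (rule has_integral_le[OF integrable_integral[OF fint]])
    have "((\<lambda>t. 1) has_integral pi / 2) {0..pi/2}"
      using has_integral_const_real[of "1::real" 0 "pi/2"] by simp
    then show "((\<lambda>t. 1 + sin t / sqrt ((m * cos t)\<^sup>2 + k^2)) has_integral pi / 2 + arsinh (m / k) / m) {0..pi/2}"
      by (rule has_integral_add[OF _ prim[OF m(1)]])
    fix t :: real assume t: "t \<in> {0..pi/2}"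
    then have s: "0 \<le> sin t" "0 \<le> cos t" by (auto intro: sin_ge_zero cos_ge_zero)
    have "1 \<le> (sin t + cos t)\<^sup>2"
      using s sin_cos_squared_add[of t] by (simp add: power2_sum)
    then have "1 - sin t \<le> cos t" using s power2_le_imp_le[of 1 "sin t + cos t"] by simp
    also have "cos t \<le> sqrt (1\<^sup>2 * cos t^2 + k^2 * sin t^2)"
      by (rule real_le_rsqrt) simp
    finally have "(1 - sin t) / sqrt (1\<^sup>2 * cos t^2 + k^2 * sin t^2) \<le> 1"
      using pos[of t] by (simp add: divide_le_eq)
    then show "f t \<le> 1 + sin t / sqrt ((m * cos t)\<^sup>2 + k^2)"
      unfolding D f_def by (simp add: diff_divide_distrib)
  qed
  also have "arsinh (m / k) \<le> arsinh (1 / k)"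
  proof (cases "m = 1")
    case False
    then have "m / k < 1 / k" using m k by (simp add: divide_strict_right_mono)
    then show ?thesis by (simp add: less_imp_le)
  qed simp
  also note arle
  finally show "gauss_int 1 k \<le> pi / 2 + (ln (1 / k) + ln 3) / sqrt (1 - k^2)"
    using m by (simp add: m_def divide_right_mono)
qed

lemma divide_pow2_tendsto: "(\<lambda>n. c / 2^n) \<longlonglongrightarrow> (0::real)"
proof -
  have "(\<lambda>n. c * (1 / 2)^n) \<longlonglongrightarrow> c * 0" by (intro tendsto_intros LIMSEQ_realpow_zero) auto
  then show ?thesis by (simp add: power_divide)
qed

text \<open>Each Landen step doubles the ratio \<open>K' / K\<close>, and \<open>K'\<close> is asymptotic to \<open>ln (1 / k)\<close>, so the ratio can be read off in the limit.\<close>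

theorem gauss_int_ratio:
  fixes k kp :: "nat \<Rightarrow> real"
  assumes k: "\<And>n. 0 < k n" "\<And>n. 0 < kp n" "\<And>n. k n^2 + kp n^2 = 1"
    and rec: "\<And>n. k (Suc n) = (1 - kp n) / (1 + kp n)"
    and k0: "k \<longlonglongrightarrow> 0" and L: "(\<lambda>n. ln (1 / k n) / 2^n) \<longlonglongrightarrow> L"
  shows "gauss_int 1 (k 0) / gauss_int 1 (kp 0) = 2 * L / pi"
proof -
  have k1: "k n < 1" "kp n < 1" for n
    by (rule sum_squares_eq_1_less_1[OF k(1) k(2) k(3)])+
  have kp: "kp n = sqrt (1 - k n^2)" for n
    using k(2,3)[of n] by (intro real_sqrt_unique[symmetric]) auto
  have rec': "kp (Suc n) = 2 * sqrt (kp n) / (1 + kp n)" for n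
  proof -
    have "1 - k (Suc n)^2 = (2 * sqrt (kp n) / (1 + kp n))\<^sup>2"
    proof -
      have "1 - k (Suc n)^2 = ((1 + kp n)\<^sup>2 - (1 - kp n)\<^sup>2) / (1 + kp n)\<^sup>2"
        unfolding rec power_divide using k(2)[of n] by (simp add: diff_divide_distrib)
      also have "(1 + kp n)\<^sup>2 - (1 - kp n)\<^sup>2 = (2 * sqrt (kp n))\<^sup>2"
        using k(2)[of n] by (simp add: power_mult_distrib power2_eq_square algebra_simps)
      finally show ?thesis by (simp only: power_divide)
    qed
    then show ?thesis unfolding kp[of "Suc n"] using k(2)[of n] by (simp add: real_sqrt_unique)
  qed
  have pos: "gauss_int 1 (k n) > 0" "gauss_int 1 (kp n) > 0" for n
    using gauss_int_bounds(1)[of "k n"] gauss_int_bounds(1)[of "kp n"] k(1,2)[of n] k1[of n] pi_gt_zero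
    by (simp_all, linarith+)
  have step: "gauss_int 1 (k (Suc n)) / gauss_int 1 (kp (Suc n)) = 2 * (gauss_int 1 (k n) / gauss_int 1 (kp n))" for n
  proof -
    have "(c * A) / (c / 2 * B) = 2 * (A / B)" if "c \<noteq> 0" for c A B :: real using that by simp
    then show ?thesis
      unfolding rec rec' gauss_int_landen[OF k(1) k(2) k(3)] using k(2)[of n] by simp
  qed
  define r where "r = gauss_int 1 (k 0) / gauss_int 1 (kp 0)"
  have "gauss_int 1 (k n) / gauss_int 1 (kp n) = 2^n * r" for n
    by (induction n) (simp_all add: step r_def)
  moreover have "(gauss_int 1 (k n) / 2^n) / gauss_int 1 (kp n) = (gauss_int 1 (k n) / gauss_int 1 (kp n)) / 2^n" for n
    by (simp add: mult.commute)
  ultimately have r: "r = (gauss_int 1 (k n) / 2^n) / gauss_int 1 (kp n)" for n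
    by simp
  have kplim: "kp \<longlonglongrightarrow> 1"
    unfolding kp[abs_def] by (rule tendsto_eq_intros k0 refl)+ simp
  have "(\<lambda>n. gauss_int 1 (k n) / 2^n) \<longlonglongrightarrow> L"
  proof (rule tendsto_sandwich[OF _ _ L])
    show "\<forall>\<^sub>F n in sequentially. ln (1 / k n) / 2^n \<le> gauss_int 1 (k n) / 2^n"
      using gauss_int_log_bounds(1)[OF k(1) k1(1)] by (intro always_eventually allI divide_right_mono) auto
    show "\<forall>\<^sub>F n in sequentially. gauss_int 1 (k n) / 2^n \<le> (pi / 2) / 2^n + (ln (1 / k n) / 2^n + ln 3 / 2^n) / kp n"
    proof (intro always_eventually allI)
      fix n
      have "gauss_int 1 (k n) / 2^n \<le> (pi / 2 + (ln (1 / k n) + ln 3) / kp n) / 2^n"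
        using gauss_int_log_bounds(2)[OF k(1) k1(1), of n] unfolding kp[symmetric] by (intro divide_right_mono) auto
      also have "\<dots> = (pi / 2) / 2^n + (ln (1 / k n) / 2^n + ln 3 / 2^n) / kp n"
        by (simp add: add_divide_distrib mult.commute)
      finally show "gauss_int 1 (k n) / 2^n \<le> (pi / 2) / 2^n + (ln (1 / k n) / 2^n + ln 3 / 2^n) / kp n" .
    qed
    have "(\<lambda>n. (pi / 2) / 2^n + (ln (1 / k n) / 2^n + ln 3 / 2^n) / kp n) \<longlonglongrightarrow> 0 + (L + 0) / 1"
      by (intro tendsto_intros divide_pow2_tendsto L kplim) auto
    then show "(\<lambda>n. (pi / 2) / 2^n + (ln (1 / k n) / 2^n + ln 3 / 2^n) / kp n) \<longlonglongrightarrow> L" by simp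
  qed
  moreover have "(\<lambda>n. gauss_int 1 (kp n)) \<longlonglongrightarrow> pi / 2"
  proof (rule tendsto_sandwich)
    show "\<forall>\<^sub>F n in sequentially. pi / 2 \<le> gauss_int 1 (kp n)"
      using gauss_int_bounds(1)[OF k(2) less_imp_le[OF k1(2)]] by (intro always_eventually) auto
    show "\<forall>\<^sub>F n in sequentially. gauss_int 1 (kp n) \<le> pi / (2 * kp n)"
      using gauss_int_bounds(2)[OF k(2) less_imp_le[OF k1(2)]] by (intro always_eventually) auto
    have "(\<lambda>n. pi / (2 * kp n)) \<longlonglongrightarrow> pi / (2 * 1)"
      by (intro tendsto_intros kplim) auto
    then show "(\<lambda>n. pi / (2 * kp n)) \<longlonglongrightarrow> pi / 2" by simp
  qed simp
  ultimately have "(\<lambda>n. (gauss_int 1 (k n) / 2^n) / gauss_int 1 (kp n)) \<longlonglongrightarrow> L / (pi / 2)"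
    by (intro tendsto_divide) auto
  then have "(\<lambda>n. r) \<longlonglongrightarrow> L / (pi / 2)" using r by simp
  then have "r = L / (pi / 2)" using LIMSEQ_unique[OF tendsto_const] by blast
  then show ?thesis by (simp add: r_def)
qed

section \<open>The nome as a function of the modulus\<close>

lemma theta_has_sum:
  assumes p: "norm p < 1"
  shows "((\<lambda>x. p^nat (x^2)) has_sum theta d p) (parity d)"
  unfolding theta_def
  by (intro has_sum_infsum abs_summable_summable[OF square_summable] p)

lemma theta_has_sum_UNIV:
  assumes p: "norm p < 1" and d: "d \<in> {0,1}"
  shows "((\<lambda>n. p^nat ((2 * n + d)^2)) has_sum theta d p) UNIV"
  using theta_has_sum[OF p, of d] d by (subst (asm) residue_has_sum_iff[of 2 d d]) auto

lemma continuous_on_theta: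
  assumes d: "d \<in> {0,1}"
  shows "continuous_on {0<..<1} (theta d :: real \<Rightarrow> real)"
proof -
  have "(theta d \<longlongrightarrow> theta d p) (at p)" if p: "p \<in> {0<..<1}" for p :: real
  proof -
    \<comment> \<open>A point strictly between p and 1: near p the series is dominated by the one at
      r.\<close>
    define r where "r = (1 + p) / 2"
    have r: "p < r" "r < 1" "0 < r" using p by (auto simp: r_def)
    have ev: "eventually (\<lambda>x. x \<in> {0<..<r}) (at p)"
      by (rule eventually_at_in_open') (use p r in auto)
    have eq: "theta d x = (\<Sum>\<^sub>\<infinity>n. x^nat ((2 * n + d)^2))" if "x \<in> {0<..<1}" for x :: real
      by (rule infsumI[OF theta_has_sum_UNIV[OF _ d], symmetric]) (use that in auto)
    have "((\<lambda>x. \<Sum>\<^sub>\<infinity>n. x^nat ((2 * n + d)^2)) \<longlongrightarrow> (\<Sum>\<^sub>\<infinity>n. p^nat ((2 * n + d)^2))) (at p)"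
    proof (rule tannery_int)
      show "((\<lambda>x. x^nat ((2 * n + d)^2)) \<longlongrightarrow> p^nat ((2 * n + d)^2)) (at p)" for n
        by (intro tendsto_intros)
      show "\<forall>\<^sub>F x in at p. \<forall>n. norm (x^nat ((2 * n + d)^2)) \<le> r^nat ((2 * n + d)^2)"
        using ev by eventually_elim (auto intro: power_mono simp: power_abs)
      show "(\<lambda>n. r^nat ((2 * n + d)^2)) summable_on UNIV"
        using has_sum_imp_summable[OF theta_has_sum_UNIV[OF _ d, of r]] r by simp
    qed
    moreover have "eventually (\<lambda>x. (\<Sum>\<^sub>\<infinity>n. x^nat ((2 * n + d)^2)) = theta d x) (at p)"
      using ev by eventually_elim (use eq r in auto)
    ultimately show ?thesis using eq[OF p] by (simp add: Lim_transform_eventually)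
  qed
  then show ?thesis by (auto intro!: continuous_at_imp_continuous_on simp: continuous_at)
qed

lemma theta_ge:
  fixes p :: real
  assumes p: "0 < p" "p < 1"
  shows "theta 0 p \<ge> 1" "theta 1 p \<ge> p"
proof -
  have "(\<Sum>x\<in>{d}. p^nat (x^2)) \<le> theta d p" if "d \<in> {0,1}" for d
    by (rule finite_sum_le_has_sum[OF theta_has_sum]) (use p that in auto)
  from this[of 0] this[of 1] show "theta 0 p \<ge> 1" "theta 1 p \<ge> p" by auto
qed

lemma theta_le:
  fixes p r :: real
  assumes p: "0 < p" "p \<le> r" "r < 1"
  shows "theta 0 p \<le> theta 0 r" "theta 1 p \<le> p * (theta 1 r / r)"
proof -
  have n: "norm p < 1" "norm r < 1" using p by auto
  show "theta 0 p \<le> theta 0 r"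
    by (rule has_sum_mono[OF theta_has_sum theta_has_sum, OF n]) (use p in \<open>auto intro: power_mono\<close>)
  have "((\<lambda>x. p / r * r^nat (x^2)) has_sum p / r * theta 1 r) (parity 1)"
    by (rule has_sum_cmult_right[OF theta_has_sum[OF n(2)]])
  then have "theta 1 p \<le> p / r * theta 1 r"
  proof (rule has_sum_mono[OF theta_has_sum[OF n(1)]])
    fix x :: int assume "x \<in> parity 1"
    then have "x \<noteq> 0" by auto
    then have "x^2 > 0" by simp
    then obtain m where m: "nat (x^2) = Suc m" by (metis gr0_conv_Suc zero_less_nat_eq)
    have "p^m \<le> r^m" using p by (intro power_mono) auto
    then show "p^nat (x^2) \<le> p / r * r^nat (x^2)" using p by (simp add: m)
  qed
  then show "theta 1 p \<le> p * (theta 1 r / r)" by simp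
qed

definition modulus :: "real \<Rightarrow> real" where "modulus p = (theta 1 p / theta 0 p)\<^sup>2"
definition comp_modulus :: "real \<Rightarrow> real" where "comp_modulus p = (theta4 p / theta 0 p)\<^sup>2"

lemma theta4_nonzero:
  fixes p :: real
  assumes p: "0 < p" "p < 1"
  shows "theta4 p \<noteq> 0"
proof -
  have "p^4 < 1" "p^8 < 1" using p by (auto simp: power_less_one_iff)
  then have "qpoch (p^8) (p^8) \<noteq> 0" "qpoch (p^4) (p^8) \<noteq> 0"
    using p by (simp_all add: qpoch_nonzero')
  then show ?thesis by (simp add: theta4_def)
qed

text \<open>In A and B, the squares of the even and odd theta series at p^2, the three theta squares
  at p are A + B, A - B and 2 sqrt (A B). Jacobi's identity becomes (A + B)^2 = (A - B)^2 + 4 A B,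
  and squaring \<open>p\<close> is a Landen step.\<close>

lemma modulus_facts:
  fixes p :: real
  assumes p: "0 < p" "p < 1"
  shows "modulus p > 0" "comp_modulus p > 0" "modulus p^2 + comp_modulus p^2 = 1" "modulus (p^2) = (1 - comp_modulus p) / (1 + comp_modulus p)"
    "(theta 0 p^2)\<^sup>2 = (theta 1 p^2)\<^sup>2 + (theta4 p^2)\<^sup>2"
proof -
  have p2: "0 < p\<^sup>2" "p^2 < 1" using p by (auto simp: power_less_one_iff)
  have pos: "theta 0 p > 0" "theta 1 p > 0" "theta 0 (p^2) > 0" "theta 1 (p^2) > 0"
    using theta_ge[OF p] theta_ge[OF p2] p p2 by linarith+
  define A B where "A = theta 0 (p^2)^2" and "B = theta 1 (p^2)^2"
  have AB: "A > 0" "B > 0" using pos by (auto simp: A_def B_def)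
  have e0: "theta 0 p^2 = A + B" unfolding A_def B_def using p by (intro theta_dissect2) auto
  have e4: "theta4 p^2 = A - B" unfolding A_def B_def by (rule theta4_square_real[OF p])
  have "theta 1 p^2 = 2 * theta 1 (p^2) * theta 0 (p^2)" using p by (intro theta_1_square) auto
  then have e1: "(theta 1 p^2)\<^sup>2 = 4 * A * B" by (simp add: A_def B_def power2_eq_square)
  show J: "(theta 0 p^2)\<^sup>2 = (theta 1 p^2)\<^sup>2 + (theta4 p^2)\<^sup>2"
    unfolding e0 e1 e4 by (simp add: power2_eq_square algebra_simps)
  show "modulus p > 0" "comp_modulus p > 0" using pos theta4_nonzero[OF p] by (auto simp: modulus_def comp_modulus_def)
  have "modulus p^2 + comp_modulus p^2 = ((theta 1 p^2)\<^sup>2 + (theta4 p^2)\<^sup>2) / (theta 0 p^2)\<^sup>2"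
    by (simp add: modulus_def comp_modulus_def power_divide add_divide_distrib)
  then show "modulus p^2 + comp_modulus p^2 = 1" unfolding J[symmetric] using pos by simp
  have "modulus (p^2) = B / A" by (simp add: modulus_def A_def B_def power_divide)
  moreover have kp: "comp_modulus p = (A - B) / (A + B)" by (simp add: comp_modulus_def power_divide e0 e4)
  moreover have "1 - (A - B) / (A + B) = 2 * B / (A + B)" "1 + (A - B) / (A + B) = 2 * A / (A + B)"
    using AB by (simp_all add: field_simps)
  ultimately show "modulus (p^2) = (1 - comp_modulus p) / (1 + comp_modulus p)" using AB by simp
qed

text \<open>For fixed r both bounds are constant multiples of p^2, so ln (modulus p) is 2 ln p up to
  a bounded error.\<close>

lemma modulus_bounds:
  fixes p r :: real
  assumes p: "0 < p" "p \<le> r" "r < 1"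
  shows "p^2 * (1 / (theta 0 r)\<^sup>2) \<le> modulus p" "modulus p \<le> p\<^sup>2 * (theta 1 r / r)\<^sup>2"
proof -
  have g: "1 \<le> theta 0 p" "p \<le> theta 1 p" "theta 0 p \<le> theta 0 r" "theta 1 p \<le> p * (theta 1 r / r)"
    using theta_ge[of p] theta_le[of p r] p by auto
  have "p / theta 0 r \<le> theta 1 p / theta 0 p" using g p by (intro frac_le) auto
  then have "(p / theta 0 r)\<^sup>2 \<le> modulus p" unfolding modulus_def using g p by (intro power_mono) auto
  then show "p^2 * (1 / (theta 0 r)\<^sup>2) \<le> modulus p" by (simp add: power_divide)
  have "theta 1 p / theta 0 p \<le> theta 1 p / 1" using g p by (intro divide_left_mono) auto
  then have "theta 1 p / theta 0 p \<le> p * (theta 1 r / r)" using g by simp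
  then have "modulus p \<le> (p * (theta 1 r / r))\<^sup>2" unfolding modulus_def using g p by (intro power_mono) auto
  then show "modulus p \<le> p\<^sup>2 * (theta 1 r / r)\<^sup>2" by (simp only: power_mult_distrib)
qed

lemma modulus_lt_1:
  assumes "0 < p" "p < 1"
  shows "modulus p < 1" "comp_modulus p < 1"
  by (rule sum_squares_eq_1_less_1[OF modulus_facts(1-3)[OF assms]])+

lemma iterated_square:
  fixes p :: real
  assumes "0 < p" "p < 1"
  shows "0 < p^(2^n)" "p^(2^n) < 1" "p^(2^n) \<le> p"
proof -
  have "(1::nat) \<le> 2^n" by simp
  then show "0 < p^(2^n)" "p^(2^n) < 1" "p^(2^n) \<le> p"
    using assms power_decreasing[of 1 "2^n" p] by (auto simp: power_less_one_iff)
qed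

lemma iterated_square_tendsto:
  fixes p :: real
  assumes "0 < p" "p < 1"
  shows "(\<lambda>n. p^(2^n)) \<longlonglongrightarrow> 0"
proof -
  have "filterlim (\<lambda>n. 2^n :: nat) at_top sequentially"
    by (rule filterlim_subseq) (simp add: strict_mono_def)
  then show ?thesis
    by (rule filterlim_compose[OF LIMSEQ_realpow_zero, rotated -1]) (use assms in auto)
qed

lemma modulus_tendsto:
  assumes p: "0 < p" "p < 1"
  shows "(\<lambda>n. modulus (p^(2^n))) \<longlonglongrightarrow> 0"
proof (rule tendsto_sandwich)
  note i = iterated_square[OF p]
  show "\<forall>\<^sub>F n in sequentially. 0 \<le> modulus (p^(2^n))" by (simp add: modulus_def)
  show "\<forall>\<^sub>F n in sequentially. modulus (p^(2^n)) \<le> (p^(2^n))\<^sup>2 * (theta 1 p / p)\<^sup>2"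
    using modulus_bounds(2)[OF i(1) i(3) p(2)] by simp
  have "(\<lambda>n. (p^(2^n))\<^sup>2 * (theta 1 p / p)\<^sup>2) \<longlonglongrightarrow> 0\<^sup>2 * (theta 1 p / p)\<^sup>2"
    by (intro tendsto_intros iterated_square_tendsto p)
  then show "(\<lambda>n. (p^(2^n))\<^sup>2 * (theta 1 p / p)\<^sup>2) \<longlonglongrightarrow> 0" by simp
qed auto

text \<open>With k' the complementary modulus, (1 - k') / (1 + k') \<le> 1 - k'^2 = k^2, so squaring
  the argument brings the modulus down to at most its square. This gives access to moduli near 1
  without a study of \<open>theta\<close> as p tends to 1.\<close>

lemma modulus_iterate_le:
  assumes p: "0 < p" "p < 1"
  shows "modulus (p^(2^n)) \<le> modulus p^(2^n)"
proof (induction n)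
  case (Suc n)
  note i = iterated_square[OF p, of n]
  define x where "x = p^(2^n)"
  have x: "0 < x" "x < 1" using i by (auto simp: x_def)
  note f = modulus_facts[OF x] modulus_lt_1[OF x]
  have "p^(2^Suc n) = x^2" by (simp add: x_def flip: power_mult) (simp add: mult.commute)
  then have "modulus (p^(2^Suc n)) = (1 - comp_modulus x) / (1 + comp_modulus x)" using f(4) by simp
  also have "\<dots> \<le> (1 - comp_modulus x) * (1 + comp_modulus x)"
  proof -
    have "(1 - comp_modulus x) / (1 + comp_modulus x) \<le> (1 - comp_modulus x) / 1" using f by (intro divide_left_mono) auto
    also have "\<dots> \<le> (1 - comp_modulus x) * (1 + comp_modulus x)"
      using f mult_left_mono[of 1 "1 + comp_modulus x" "1 - comp_modulus x"] by simp
    finally show ?thesis .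
  qed
  also have "\<dots> = (modulus x)\<^sup>2" using f(3) by (simp add: algebra_simps power2_eq_square)
  also have "\<dots> \<le> (modulus p^(2^n))\<^sup>2" using Suc f(1) by (intro power_mono) (auto simp: x_def)
  also have "\<dots> = modulus p^(2^Suc n)" by (simp add: mult.commute flip: power_mult)
  finally show ?case .
qed simp

text \<open>An intermediate value argument: small moduli occur along the iterated squares of 1/2,
  large ones at an iterated square root of 1/2.\<close>

lemma modulus_surj:
  assumes \<alpha>: "0 < \<alpha>" "\<alpha> < 1"
  shows "\<exists>p. 0 < p \<and> p < 1 \<and> modulus p = \<alpha>"
proof -
  have cont: "continuous_on {0<..<1} modulus"
    unfolding modulus_def[abs_def] using theta_ge by (intro continuous_intros continuous_on_theta) (force simp: not_le)+
  have conn: "connected (modulus ` {0<..<1})"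
    by (rule connected_continuous_image[OF cont]) simp
  have half: "(0::real) < 1/2" "1/2 < (1::real)" by auto
  have "\<forall>\<^sub>F n in sequentially. modulus ((1/2)^(2^n)) < \<alpha>"
    using modulus_tendsto[OF half] \<alpha>(1) by (rule order_tendstoD)
  then obtain n where lo: "modulus ((1/2)^(2^n)) < \<alpha>"
    using eventually_happens'[OF sequentially_bot] by blast
  have "\<forall>\<^sub>F n in sequentially. \<alpha> ^ (2^n) < modulus (1/2)"
    using iterated_square_tendsto[OF \<alpha>] modulus_facts(1)[OF half] by (rule order_tendstoD)
  then obtain m where m: "\<alpha> ^ (2^m) < modulus (1/2)"
    using eventually_happens'[OF sequentially_bot] by blast
  \<comment> \<open>If modulus r were below \<alpha>, then modulus (1/2) \<le> (modulus r)^(2^m)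
    \<le> \<alpha>^(2^m) would contradict the choice of m.\<close>
  define r where "r = root (2^m) (1/2)"
  have r: "0 < r" "r < 1" "r^(2^m) = 1/2" unfolding r_def by (auto simp: real_root_lt_1_iff)
  have hi: "\<alpha> \<le> modulus r"
  proof (rule ccontr)
    assume "\<not> \<alpha> \<le> modulus r"
    then have "modulus r^(2^m) \<le> \<alpha> ^ (2^m)"
      using modulus_facts(1)[OF r(1,2)] by (intro power_mono) auto
    then show False using modulus_iterate_le[OF r(1,2), of m] m r(3) by simp
  qed
  have "\<alpha> \<in> modulus ` {0<..<1}"
  proof (rule connectedD_interval[OF conn _ _ less_imp_le[OF lo] hi])
    show "modulus ((1/2)^(2^n)) \<in> modulus ` {0<..<1}"
      by (rule imageI) (use iterated_square(1,2)[OF half, of n] in \<open>simp only: greaterThanLessThan_iff\<close>)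
    show "modulus r \<in> modulus ` {0<..<1}" by (rule imageI) (use r in simp)
  qed
  then show ?thesis by auto
qed

text \<open>The Landen chain is p^(2^n), along which ln k is 2^n (2 ln p) plus a bounded term; so
  the limit required by \<open>gauss_int_ratio\<close> is L = -2 ln p.\<close>

lemma nome_formula:
  assumes p: "0 < p" "p < 1"
  shows "gauss_int 1 (modulus p) / gauss_int 1 (comp_modulus p) = - 4 * ln p / pi"
proof -
  note i = iterated_square[OF p]
  define k kp where "k = (\<lambda>n. modulus (p^(2^n)))" and "kp = (\<lambda>n. comp_modulus (p^(2^n)))"
  have s: "p^(2^Suc n) = (p^(2^n))\<^sup>2" for n by (simp add: mult.commute flip: power_mult)
  define c1 c2 where "c1 = ln (1 / theta 0 p^2)" and "c2 = ln ((theta 1 p / p)\<^sup>2)"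
  have pos: "theta 0 p > 0" "theta 1 p > 0" using theta_ge[OF p] p by linarith+
  have lnk: "2^n * (2 * ln p) + c1 \<le> ln (k n)" "ln (k n) \<le> 2^n * (2 * ln p) + c2" for n
  proof -
    have kpos: "k n > 0" unfolding k_def by (rule modulus_facts(1)[OF i(1,2)])
    have e: "ln ((p^(2^n))\<^sup>2) = 2^n * (2 * ln p)" using p by (simp add: ln_realpow)
    have "ln ((p^(2^n))\<^sup>2 * (1 / theta 0 p^2)) \<le> ln (k n)"
      using modulus_bounds(1)[OF i(1) i(3) p(2), of n] kpos pos p by (subst ln_le_cancel_iff) (auto simp: k_def)
    moreover have "ln ((p^(2^n))\<^sup>2 * (1 / theta 0 p^2)) = 2^n * (2 * ln p) + c1"
      unfolding c1_def e[symmetric] using p pos by (intro ln_mult_pos) auto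
    ultimately show "2^n * (2 * ln p) + c1 \<le> ln (k n)" by simp
    have "ln (k n) \<le> ln ((p^(2^n))\<^sup>2 * (theta 1 p / p)\<^sup>2)"
      using modulus_bounds(2)[OF i(1) i(3) p(2), of n] kpos pos p by (subst ln_le_cancel_iff) (auto simp: k_def)
    moreover have "ln ((p^(2^n))\<^sup>2 * (theta 1 p / p)\<^sup>2) = 2^n * (2 * ln p) + c2"
      unfolding c2_def e[symmetric] using p pos by (intro ln_mult_pos) auto
    ultimately show "ln (k n) \<le> 2^n * (2 * ln p) + c2" by simp
  qed
  have lim: "(\<lambda>n. - 2 * ln p - c / 2^n) \<longlonglongrightarrow> - 2 * ln p" for c
    using tendsto_diff[OF tendsto_const divide_pow2_tendsto, of "- 2 * ln p" c] by simp
  have "gauss_int 1 (k 0) / gauss_int 1 (kp 0) = 2 * (- 2 * ln p) / pi"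
  proof (rule gauss_int_ratio)
    show "0 < k n" "0 < kp n" "k n^2 + kp n^2 = 1" for n
      unfolding k_def kp_def by (rule modulus_facts[OF i(1,2)])+
    show "k (Suc n) = (1 - kp n) / (1 + kp n)" for n
      unfolding k_def kp_def s by (rule modulus_facts[OF i(1,2)])
    show "k \<longlonglongrightarrow> 0" unfolding k_def by (rule modulus_tendsto[OF p])
    show "(\<lambda>n. ln (1 / k n) / 2^n) \<longlonglongrightarrow> - 2 * ln p"
    proof (rule tendsto_sandwich[OF _ _ lim lim])
      have l: "ln (1 / k n) = - ln (k n)" for n
        using modulus_facts(1)[OF i(1,2), of n] by (simp add: k_def ln_div)
      show "\<forall>\<^sub>F n in sequentially. - 2 * ln p - c2 / 2^n \<le> ln (1 / k n) / 2^n"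
      proof (intro always_eventually allI)
        fix n
        have "- 2 * ln p - c2 / 2^n = (- (2^n * (2 * ln p) + c2)) / 2^n" by (simp add: field_simps)
        also have "\<dots> \<le> ln (1 / k n) / 2^n" unfolding l using lnk(2)[of n] by (intro divide_right_mono) auto
        finally show "- 2 * ln p - c2 / 2^n \<le> ln (1 / k n) / 2^n" .
      qed
      show "\<forall>\<^sub>F n in sequentially. ln (1 / k n) / 2^n \<le> - 2 * ln p - c1 / 2^n"
      proof (intro always_eventually allI)
        fix n
        have "ln (1 / k n) / 2^n \<le> (- (2^n * (2 * ln p) + c1)) / 2^n" unfolding l using lnk(1)[of n] by (intro divide_right_mono) auto
        also have "\<dots> = - 2 * ln p - c1 / 2^n" by (simp add: field_simps)
        finally show "ln (1 / k n) / 2^n \<le> - 2 * ln p - c1 / 2^n" .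
      qed
    qed
  qed
  then show ?thesis by (simp add: k_def kp_def)
qed

lemma ellK_eq_gauss_int:
  assumes "0 \<le> x" "x \<le> 1"
  shows "ellK x = gauss_int 1 (sqrt (1 - x^2))"
proof -
  have "x^2 \<le> 1" using assms by (simp add: power_le_one)
  then have "1 - x^2 * sin t^2 = 1\<^sup>2 * cos t^2 + (sqrt (1 - x^2))\<^sup>2 * sin t^2" for t
    by (simp add: cos_squared_eq algebra_simps)
  then show ?thesis unfolding ellK_def gauss_int_def by presburger
qed

lemma sqrt_k_inv:
  assumes p: "0 < p" "p < 1"
  shows "sqrt (k_inv (modulus p)) = - 4 * ln p / pi"
proof -
  note f = modulus_facts[OF p] modulus_lt_1[OF p]
  have kp: "sqrt (1 - modulus p^2) = comp_modulus p" and k: "sqrt (1 - comp_modulus p^2) = modulus p"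
    using f by (auto intro!: real_sqrt_unique)
  have "ellK (modulus p) = gauss_int 1 (comp_modulus p)" "ellK (comp_modulus p) = gauss_int 1 (modulus p)"
    using ellK_eq_gauss_int[of "modulus p"] ellK_eq_gauss_int[of "comp_modulus p"] f by (auto simp: kp k)
  then have "sqrt (k_inv (modulus p)) = \<bar>gauss_int 1 (modulus p) / gauss_int 1 (comp_modulus p)\<bar>"
    by (simp add: k_inv_def kp real_sqrt_divide)
  also have "\<dots> = - 4 * ln p / pi"
    unfolding nome_formula[OF p] using p by simp
  finally show ?thesis .
qed

section \<open>The modular equation\<close>

text \<open>The hypotheses \<open>s0\<close> and \<open>s2\<close> are Jacobi's identity at 5\<tau>
  and at \<tau>, with the theta squares expressed by their ratios. In partial fractions both are
  linear in the sums A of 1 / (m - 1) and B of 1 / (5 - m); clearing denominators in the values of A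
  and B gives two linear equations between the elementary symmetric functions.\<close>

lemma quintic_multipliers:
  fixes m2 m3 m4 :: real
  defines "g \<equiv> \<lambda>m. (m - 1) * (5 - m)"
  assumes nz: "g m2 \<noteq> 0" "g m3 \<noteq> 0" "g m4 \<noteq> 0"
    and s0: "1 / g m2 + 1 / g m3 + 1 / g m4 = 0"
    and s2: "m2^2 / g m2 + m3^2 / g m3 + m4^2 / g m4 = 0"
  shows "m2 + m3 + m4 = 10 + m2 * m3 * m4" "m2 * m3 + m2 * m4 + m3 * m4 = 25 + 2 * (m2 * m3 * m4)"
proof -
  define A B where "A = 1 / (m2 - 1) + 1 / (m3 - 1) + 1 / (m4 - 1)" and "B = 1 / (5 - m2) + 1 / (5 - m3) + 1 / (5 - m4)"
  have d: "m2 - 1 \<noteq> 0" "m3 - 1 \<noteq> 0" "m4 - 1 \<noteq> 0" "5 - m2 \<noteq> 0" "5 - m3 \<noteq> 0" "5 - m4 \<noteq> 0"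
    using nz by (auto simp: g_def)
  have pf: "4 * (1 / g m) = 1 / (m - 1) + 1 / (5 - m)" "4 * (m^2 / g m) = 1 / (m - 1) + 25 / (5 - m) - 4"
    if "m - 1 \<noteq> 0" "5 - m \<noteq> 0" for m
    using that unfolding g_def by (simp_all add: divide_simps) (simp_all add: algebra_simps power2_eq_square)
  have "A + B = 4 * (1 / g m2 + 1 / g m3 + 1 / g m4)"
    unfolding distrib_left using pf(1)[of m2] pf(1)[of m3] pf(1)[of m4] d by (simp add: A_def B_def)
  then have 1: "A + B = 0" using s0 by simp
  have "A + 25 * B - 12 = 4 * (m2^2 / g m2 + m3^2 / g m3 + m4^2 / g m4)"
    unfolding distrib_left using pf(2)[of m2] pf(2)[of m3] pf(2)[of m4] d by (simp add: A_def B_def)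
  then have 2: "A + 25 * B = 12" using s2 by simp
  have AB: "A = - 1 / 2" "B = 1 / 2" using 1 2 by linarith+
  have rec: "1 / x + 1 / y + 1 / z = (y * z + x * z + x * y) / (x * y * z)" if "x \<noteq> 0" "y \<noteq> 0" "z \<noteq> 0" for x y z :: real
    using that by (simp add: field_simps)
  have "2 * ((m3 - 1) * (m4 - 1) + (m2 - 1) * (m4 - 1) + (m2 - 1) * (m3 - 1)) = - ((m2 - 1) * (m3 - 1) * (m4 - 1))"
    using AB(1) d unfolding A_def rec[OF d(1-3)] by (simp add: divide_eq_eq)
  then have 3: "5 - 3 * (m2 + m3 + m4) + (m2 * m3 + m2 * m4 + m3 * m4) + m2 * m3 * m4 = 0"
    by (simp add: algebra_simps)
  have "2 * ((5 - m3) * (5 - m4) + (5 - m2) * (5 - m4) + (5 - m2) * (5 - m3)) = (5 - m2) * (5 - m3) * (5 - m4)"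
    using AB(2) d unfolding B_def rec[OF d(4-6)] by (simp add: divide_eq_eq)
  then have 4: "25 + 5 * (m2 + m3 + m4) - 3 * (m2 * m3 + m2 * m4 + m3 * m4) + m2 * m3 * m4 = 0"
    by (simp add: algebra_simps)
  have lin: "e1 = 10 + e3 \<and> e2 = 25 + 2 * e3" if "5 - 3 * e1 + e2 + e3 = 0" "25 + 5 * e1 - 3 * e2 + e3 = 0" for e1 e2 e3 :: real
    using that by auto
  show "m2 + m3 + m4 = 10 + m2 * m3 * m4" "m2 * m3 + m2 * m4 + m3 * m4 = 25 + 2 * (m2 * m3 * m4)"
    using lin[OF 3 4] by blast+
qed

text \<open>By the partial fractions of the previous lemma, \<open>m\<^sub>2, m\<^sub>3, m\<^sub>4\<close> are the roots of \<open>X\<^sup>3 - (10 + Y) X\<^sup>2 + (25 + 2 Y) X - Y\<close>.\<close>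

lemma quintic_symmetric:
  fixes m2 m3 m4 :: real
  defines "g \<equiv> \<lambda>m. (m - 1) * (5 - m)" and "Y \<equiv> m2 * m3 * m4"
  assumes e: "m2 + m3 + m4 = 10 + Y" "m2 * m3 + m2 * m4 + m3 * m4 = 25 + 2 * Y"
  shows "g m2 * g m3 * g m4 = 256 * Y"
    and "m2^2 * m3^2 * g m4 + m2^2 * m4^2 * g m3 + m3^2 * m4^2 * g m2 = - (Y^2 + 250 * Y + 3125)"
proof -
  define e1 e2 where "e1 = m2 + m3 + m4" and "e2 = m2 * m3 + m2 * m4 + m3 * m4"
  \<comment> \<open>This product is minus the value of the cubic at 1, where Y drops out; the next
    one is its value at 5.\<close>
  have "(m2 - 1) * (m3 - 1) * (m4 - 1) = Y - e2 + e1 - 1"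
    unfolding e1_def e2_def Y_def by (simp add: algebra_simps)
  then have 1: "(m2 - 1) * (m3 - 1) * (m4 - 1) = - 16" using e by (simp add: e1_def e2_def)
  have "(5 - m2) * (5 - m3) * (5 - m4) = 125 - 25 * e1 + 5 * e2 - Y"
    unfolding e1_def e2_def Y_def by (simp add: algebra_simps)
  then have 2: "(5 - m2) * (5 - m3) * (5 - m4) = - 16 * Y" using e by (simp add: e1_def e2_def)
  have "g m2 * g m3 * g m4 = ((m2 - 1) * (m3 - 1) * (m4 - 1)) * ((5 - m2) * (5 - m3) * (5 - m4))"
    by (simp add: g_def mult_ac)
  then show "g m2 * g m3 * g m4 = 256 * Y" unfolding 1 2 by simp
  have "m2^2 * m3^2 * g m4 + m2^2 * m4^2 * g m3 + m3^2 * m4^2 * g m2 = - 3 * Y^2 + 6 * Y * e2 - 5 * (e2^2 - 2 * Y * e1)"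
    unfolding e1_def e2_def Y_def g_def by (simp add: algebra_simps power2_eq_square)
  also have "\<dots> = - (Y^2 + 250 * Y + 3125)"
    unfolding e1_def e2_def e by (simp add: algebra_simps power2_eq_square)
  finally show "m2^2 * m3^2 * g m4 + m2^2 * m4^2 * g m3 + m3^2 * m4^2 * g m2 = - (Y^2 + 250 * Y + 3125)" .
qed

text \<open>Up to the factor 16 E and signs, w2, w3, w4 are the squares of x2, x3, x4, and Jacobi's
  identity says that they add up to 0. Thus w3^2 + w2 w3 + w2^2 is minus their second symmetric
  function, the left side depends only on the second and third one, and E cancels by
  homogeneity.\<close>

lemma quintic_modular_equation:
  fixes x2 x3 x4 y2 y3 y4 E :: real
  assumes E: "E \<noteq> 0" and y: "y2 \<noteq> 0" "y3 \<noteq> 0" "y4 \<noteq> 0" and x: "x2 \<noteq> 0" "x3 \<noteq> 0" "x4 \<noteq> 0"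
    and q3: "(x3 - y3) * (5 * y3 - x3) = 16 * E"
    and q4: "(x4 - y4) * (5 * y4 - x4) = - 16 * E"
    and q2: "(x2 - y2) * (5 * y2 - x2) = - 16 * E"
    and jx: "x3^2 = x2^2 + x4^2" and jy: "y3^2 = y2^2 + y4^2"
  defines "Y \<equiv> (x2 * x3 * x4) / (y2 * y3 * y4)"
  shows "256 * (x3^4 - x2^2 * x3^2 + x2^4)^3 / (x2 * x3 * x4)^4 = (Y^2 + 250 * Y + 3125)^3 / Y^5"
proof -
  define g where "g = (\<lambda>m::real. (m - 1) * (5 - m))"
  define m2 m3 m4 where "m2 = x2 / y2" and "m3 = x3 / y3" and "m4 = x4 / y4"
  have Y: "Y = m2 * m3 * m4" by (simp add: Y_def m2_def m3_def m4_def)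
  have Y0: "Y \<noteq> 0" using x y by (simp add: Y_def)
  have gy: "v^2 * g (u / v) = (u - v) * (5 * v - u)" if "v \<noteq> 0" for u v
    using that unfolding g_def by (simp add: field_simps power2_eq_square)
  have g: "y2^2 * g m2 = - 16 * E" "y3^2 * g m3 = 16 * E" "y4^2 * g m4 = - 16 * E"
    unfolding m2_def m3_def m4_def using gy[OF y(1)] gy[OF y(2)] gy[OF y(3)] q2 q3 q4 by auto
  have g0: "g m2 \<noteq> 0" "g m3 \<noteq> 0" "g m4 \<noteq> 0" using g E by auto
  have div: "v = c * (1 / d)" if "v * d = c" "d \<noteq> 0" for v c d :: real
    using that by (simp add: eq_divide_eq)
  have yy: "y2^2 = - 16 * E * (1 / g m2)" "y3^2 = 16 * E * (1 / g m3)" "y4^2 = - 16 * E * (1 / g m4)"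
    by (rule div[OF g(1) g0(1)] div[OF g(2) g0(2)] div[OF g(3) g0(3)])+
  define w2 w3 w4 where "w2 = m2^2 / g m2" and "w3 = m3^2 / g m3" and "w4 = m4^2 / g m4"
  have xm: "x2^2 = m2^2 * y2^2" "x3^2 = m3^2 * y3^2" "x4^2 = m4^2 * y4^2"
    using y by (simp_all add: m2_def m3_def m4_def power_divide)
  have xx: "x2^2 = - 16 * E * w2" "x3^2 = 16 * E * w3" "x4^2 = - 16 * E * w4"
    unfolding xm yy w2_def w3_def w4_def by simp_all
  have "16 * E * (1 / g m2 + 1 / g m3 + 1 / g m4) = y3^2 - y2^2 - y4^2"
    unfolding yy by (simp add: algebra_simps)
  then have s0: "1 / g m2 + 1 / g m3 + 1 / g m4 = 0" using jy E by simp
  have "16 * E * (w2 + w3 + w4) = x3^2 - x2^2 - x4^2"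
    unfolding xx by (simp add: algebra_simps)
  then have s2: "w2 + w3 + w4 = 0" using jx E by simp
  have e: "m2 + m3 + m4 = 10 + m2 * m3 * m4" "m2 * m3 + m2 * m4 + m3 * m4 = 25 + 2 * (m2 * m3 * m4)"
    using quintic_multipliers[of m2 m3 m4] g0 s0 s2 unfolding g_def w2_def w3_def w4_def by blast+
  have G: "g m2 * g m3 * g m4 = 256 * Y"
    and Q: "m2^2 * m3^2 * g m4 + m2^2 * m4^2 * g m3 + m3^2 * m4^2 * g m2 = - (Y^2 + 250 * Y + 3125)"
    using quintic_symmetric[OF e] unfolding g_def Y by auto
  have W: "w2 * w3 * w4 = Y / 256"
  proof -
    have "w2 * w3 * w4 = Y^2 / (g m2 * g m3 * g m4)"
      by (simp add: w2_def w3_def w4_def Y power_mult_distrib)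
    then show ?thesis unfolding G using Y0 by (simp add: power2_eq_square)
  qed
  have "w2 * w3 + w2 * w4 + w3 * w4 =
      (m2^2 * m3^2 * g m4 + m2^2 * m4^2 * g m3 + m3^2 * m4^2 * g m2) / (g m2 * g m3 * g m4)"
    unfolding w2_def w3_def w4_def using g0 by (simp add: add_divide_distrib)
  then have S: "w2 * w3 + w2 * w4 + w3 * w4 = - (Y^2 + 250 * Y + 3125) / (256 * Y)"
    unfolding G Q .
  have w4: "w4 = - w2 - w3" using s2 by simp
  define V where "V = (Y^2 + 250 * Y + 3125) / (256 * Y)"
  have V: "w3^2 + w2 * w3 + w2^2 = V"
  proof -
    have "w3^2 + w2 * w3 + w2^2 = - (w2 * w3 + w2 * w4 + w3 * w4)"
      unfolding w4 by (simp add: algebra_simps power2_eq_square)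
    then show ?thesis unfolding S V_def by (simp only: minus_divide_left minus_minus)
  qed
  have "x3^4 - x2^2 * x3^2 + x2^4 = (x3^2)\<^sup>2 - x2^2 * x3^2 + (x2^2)\<^sup>2" by (simp flip: power_mult)
  also have "\<dots> = 256 * E^2 * V"
    unfolding xx V[symmetric] by (simp add: algebra_simps power2_eq_square)
  finally have num: "x3^4 - x2^2 * x3^2 + x2^4 = 256 * E^2 * V" .
  have "(x2 * x3 * x4)^4 = (x2^2 * x3^2 * x4^2)\<^sup>2" by (simp add: power_mult_distrib flip: power_mult)
  also have "x2^2 * x3^2 * x4^2 = 4096 * E^3 * (w2 * w3 * w4)"
    unfolding xx by (simp add: power3_eq_cube)
  finally have den: "(x2 * x3 * x4)^4 = (16 * E^3 * Y)\<^sup>2" unfolding W by (simp add: power_mult_distrib)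
  have "256 * (x3^4 - x2^2 * x3^2 + x2^4)^3 / (x2 * x3 * x4)^4 = 256^3 * V^3 / Y^2"
    unfolding num den using E Y0 by (simp add: power_mult_distrib flip: power_mult) 
  also have "\<dots> = (Y^2 + 250 * Y + 3125)^3 / (Y^3 * Y^2)"
    by (simp add: V_def power_divide power_mult_distrib)
  finally show ?thesis by (simp flip: power_add)
qed

text \<open>Here Y is (eta(\<tau>) / eta(5\<tau>))^6. It is the product of the three ratios of theta
  squares because theta_2 theta_3 theta_4 = 2 eta^3. With k = theta_2^2 / theta_3^2,
  \<open>U\<close> becomes homogeneous through 1 - k^2 = theta_4^4 / theta_3^4.\<close>

lemma U_modulus:
  assumes p: "0 < p" "p < 1"
  defines "Y \<equiv> qpoch (p^8) (p^8)^6 / (p^8 * qpoch (p^40) (p^40)^6)"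
  shows "U (modulus p) = (Y^2 + 250 * Y + 3125)^3 / Y^5" "Y \<noteq> 0"
proof -
  have p5: "0 < p^5" "p^5 < 1" using p by (auto simp: power_less_one_iff)
  have F0: "qpoch (p^k) (p^k) \<noteq> 0" if "k > 0" for k
    using p that by (simp add: qpoch_nonzero' power_less_one_iff)
  define E where "E = p^4 * (qpoch (p^8) (p^8))^2 * (qpoch (p^40) (p^40))^2"
  have E0: "E \<noteq> 0" using F0 p by (simp add: E_def)
  have nz: "theta 0 r \<noteq> 0" "theta 1 r \<noteq> 0" "theta4 r \<noteq> 0" if "0 < r" "r < 1" for r :: real
    using theta_ge[OF that] theta4_nonzero[OF that] that by auto
  define Z where "Z = (theta 1 p^2 * theta 0 p^2 * theta4 p^2) / (theta 1 (p^5)^2 * theta 0 (p^5)^2 * theta4 (p^5)^2)"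
  have "Z = ((theta 0 p * theta4 p * theta 1 p) / (theta 0 (p^5) * theta4 (p^5) * theta 1 (p^5)))\<^sup>2"
    by (simp add: Z_def power_divide power_mult_distrib mult_ac)
  also have "theta 0 p * theta4 p * theta 1 p = 2 * p * qpoch (p^8) (p^8)^3"
    using p by (intro theta_triple) auto
  also have "theta 0 (p^5) * theta4 (p^5) * theta 1 (p^5) = 2 * p^5 * qpoch (p^40) (p^40)^3"
    using theta_triple[of "p^5"] p5 by (simp flip: power_mult)
  also have "((2 * p * qpoch (p^8) (p^8)^3) / (2 * p^5 * qpoch (p^40) (p^40)^3))\<^sup>2 = Y"
  proof -
    have "p^5 = p * p^4" by (simp flip: power_Suc)
    then have "(2 * p * qpoch (p^8) (p^8)^3) / (2 * p^5 * qpoch (p^40) (p^40)^3) =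
        qpoch (p^8) (p^8)^3 / (p^4 * qpoch (p^40) (p^40)^3)"
      using p by simp
    then show ?thesis unfolding Y_def by (simp add: power_divide power_mult_distrib flip: power_mult)
  qed
  finally have ZY: "Z = Y" .
  have *: "256 * ((theta 0 p^2)^4 - (theta 1 p^2)\<^sup>2 * (theta 0 p^2)\<^sup>2 + (theta 1 p^2)^4)^3 / (theta 1 p^2 * theta 0 p^2 * theta4 p^2)^4 =
      (Y^2 + 250 * Y + 3125)^3 / Y^5"
    unfolding ZY[symmetric] Z_def
    by (rule quintic_modular_equation[OF E0])
       (use nz[OF p] nz[OF p5] quintic_theta_real[OF p] modulus_facts(5)[OF p] modulus_facts(5)[OF p5] in \<open>simp_all add: E_def\<close>)
  define t0 t1 where "t0 = theta 0 p^2" and "t1 = theta 1 p^2"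
  have t0: "t0 \<noteq> 0" "t1 \<noteq> 0" using nz[OF p] by (auto simp: t0_def t1_def)
  have t4: "(theta4 p^2)\<^sup>2 = t0^2 - t1^2" using modulus_facts(5)[OF p] by (simp add: t0_def t1_def)
  have "U (modulus p) = 256 * (t0^4 - t1^2 * t0^2 + t1^4)^3 / (t1 * t0 * theta4 p^2)^4"
  proof -
    have m: "modulus p^2 = t1^2 / t0^2" by (simp add: modulus_def t0_def t1_def power_divide)
    have "modulus p^2 + (1 - modulus p^2)\<^sup>2 = (t0^4 - t1^2 * t0^2 + t1^4) / t0^4"
      unfolding m using t0 by (simp add: field_simps power2_eq_square power4_eq_xxxx)
    moreover have "modulus p^4 * (1 - modulus p^2)\<^sup>2 = t1^4 * (t0^2 - t1^2)\<^sup>2 / t0^8"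
    proof -
      have "1 - modulus p^2 = (t0^2 - t1^2) / t0^2" unfolding m using t0 by (simp add: diff_divide_distrib)
      moreover have "modulus p^4 = t1^4 / t0^4"
        by (simp add: modulus_def t0_def t1_def power_divide flip: power_mult)
      ultimately show ?thesis by (simp add: power_divide flip: power_mult power_add)
    qed
    moreover have "(theta4 p)\<^sup>2^4 = (t0^2 - t1^2)\<^sup>2"
      unfolding t4[symmetric] by (simp flip: power_mult)
    ultimately have "U (modulus p) = 256 * ((t0^4 - t1^2 * t0^2 + t1^4) / t0^4)^3 / (t1^4 * (theta4 p)\<^sup>2^4 / t0^8)"
      by (simp add: U_def)
    also have "\<dots> = 256 * (t0^4 - t1^2 * t0^2 + t1^4)^3 / (t1 * t0 * theta4 p^2)^4"
    proof -
      have h: "256 * (n / u)^3 / (A / u^2) = 256 * n^3 / (A * u)" if "u \<noteq> 0" for n A u :: real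
        using that by (cases "A = 0") (simp_all add: power_divide power2_eq_square power3_eq_cube)
      have "t0^8 = (t0^4)\<^sup>2" "(t1 * t0 * theta4 p^2)^4 = t1^4 * (theta4 p)\<^sup>2^4 * t0^4"
        by (simp_all add: power_mult_distrib flip: power_mult)
      then show ?thesis using h[of "t0^4"] t0 by (simp only: power_not_zero not_False_eq_True)
    qed
    finally show ?thesis .
  qed
  then show "U (modulus p) = (Y^2 + 250 * Y + 3125)^3 / Y^5"
    using * unfolding t0_def t1_def by simp
  show "Y \<noteq> 0" unfolding Y_def using F0 p by simp
qed

section \<open>Ramanujan's formula for R on the reals, and the conclusion\<close>

lemma rr_theta_of_real:
  assumes q: "0 < q" "q < 1"
  shows "rr_theta2 (of_real q :: complex) = of_real (rr_theta2 q)" "rr_theta1 (of_real q :: complex) = of_real (rr_theta1 q)"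
proof -
  have n: "\<bar>q^5\<bar> < 1" using q by (simp add: power_less_one_iff)
  have e: "qpoch (of_real q^k) (of_real q^5 :: complex) = of_real (qpoch (q^k) (q^5))" for k
    using qpoch_of_real[OF n, of "q^k"] by simp
  show "rr_theta2 (of_real q :: complex) = of_real (rr_theta2 q)"
    using q by (simp add: rr_theta2_has_sum(3) e)
  show "rr_theta1 (of_real q :: complex) = of_real (rr_theta1 q)"
    using q e[of 1] by (simp add: rr_theta1_has_sum(3) e)
qed

lemma RR_quintic:
  assumes q: "0 < q" "q < 1"
  shows "RR q powi (-5) - 11 - RR q^5 = qpoch q q^6 / (q * qpoch (q^5) (q^5)^6)"
proof -
  define s where "s = root 5 q"
  have s: "0 < s" "s < 1" "q = s^5" using q by (auto simp: s_def)
  have n: "\<bar>q\<bar> < 1" "\<bar>q^5\<bar> < 1" using q by (simp_all add: power_less_one_iff)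
  have "complex_of_real (inverse (q * (rr_theta1 q / rr_theta2 q)^5) - 11 - q * (rr_theta1 q / rr_theta2 q)^5) =
      complex_of_real (qpoch q q^6 / (q * qpoch (q^5) (q^5)^6))"
    using rr_quintic[of "complex_of_real s", OF _ _ cis_root5, of "of_real q"] s
      qpoch_of_real[OF n(1), of q, where 'a = complex] qpoch_of_real[OF n(2), of "q^5", where 'a = complex] rr_theta_of_real[OF q]
    by simp
  then have *: "inverse (q * (rr_theta1 q / rr_theta2 q)^5) - 11 - q * (rr_theta1 q / rr_theta2 q)^5 = qpoch q q^6 / (q * qpoch (q^5) (q^5)^6)"
    by (simp only: of_real_eq_iff)
  have "(q powr (1/5))^5 = q" using q by (simp add: powr_realpow[symmetric] powr_powr)
  then have "RR q^5 = q * (rr_theta1 q / rr_theta2 q)^5"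
    unfolding RR_eq[OF q] by (simp only: power_mult_distrib)
  moreover have "RR q powi (-5) = inverse (RR q^5)" by (simp add: power_int_minus)
  ultimately show ?thesis using * by simp
qed

theorem theorem3:
  fixes a b C1 \<alpha> q X :: real
  assumes "a \<noteq> 0" and "b \<noteq> 0"
    and "0 < \<alpha>" and "\<alpha> < 1"
    and "U \<alpha> = 250 * (C1^3 / (a^2 * b))"
    and "q = exp (- 2 * pi * sqrt (k_inv \<alpha>))"
    and "X = b / (250 * a) * (RR q powi (-5) - 11 - RR q ^ 5)"
  shows "b^2 / (20 * a) + b * X + a * X^2 = C1 * (root 3 X) ^ 5"
proof -
  obtain p where p: "0 < p" "p < 1" "\<alpha> = modulus p"
    using modulus_surj[OF assms(3,4)] by blast
  \<comment> \<open>The exponent is -2 pi times -4 ln p / pi, so R is evaluated at p^8.\<close>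
  have "q = exp (8 * ln p)"
    unfolding assms(6) p(3) sqrt_k_inv[OF p(1,2)] by simp
  also have "\<dots> = p^8" using p(1) exp_of_nat_mult[of 8 "ln p"] by simp
  finally have q: "q = p^8" .
  have q01: "0 < q" "q < 1" using p by (auto simp: q power_less_one_iff)
  define Y where "Y = qpoch (p^8) (p^8)^6 / (p^8 * qpoch (p^40) (p^40)^6)"
  have X: "X = b / (250 * a) * Y"
    unfolding assms(7) RR_quintic[OF q01] by (simp add: Y_def q flip: power_mult)
  note UY = U_modulus[OF p(1,2), folded Y_def p(3)]
  define W where "W = Y^2 + 250 * Y + 3125"
  have W: "W^3 = 250 * C1^3 * Y^5 / (a^2 * b)"
    using UY assms(5) by (simp add: W_def field_simps)
  define T where "T = b^2 / (20 * a) + b * X + a * X^2"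
  \<comment> \<open>62500 is 250^2, and b^2 / (20 a) is 3125 times b^2 / (62500 a), which matches
    the constant term of \<open>W\<close>.\<close>
  have T: "T = b^2 / (62500 * a) * W"
    unfolding T_def X W_def using assms(1) by (simp add: field_simps power2_eq_square)
  have "T^3 = b^6 / (62500^3 * a^3) * W^3"
    unfolding T by (simp add: power_mult_distrib power_divide flip: power_mult)
  also have "\<dots> = C1^3 * X^5"
    unfolding W X using assms(1,2) by (simp add: power_mult_distrib power_divide field_simps eval_nat_numeral)
  also have "\<dots> = (C1 * root 3 X^5)^3"
  proof -
    have "(root 3 X^5)^3 = (root 3 X^3)^5" by (simp flip: power_mult)
    also have "root 3 X^3 = X" by (simp add: odd_real_root_pow)
    finally show ?thesis by (simp add: power_mult_distrib)
  qed
  \<comment> \<open>Cubing is injective on the reals, so the cubed identity gives the equation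
    itself, whatever the signs of \<open>X\<close> and \<open>C1\<close>.\<close>
  finally have "root 3 (T^3) = root 3 ((C1 * root 3 X^5)^3)" by simp
  then show ?thesis unfolding T_def by (simp add: odd_real_root_power_cancel)
qed

end
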